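(* Let $\mathbf{X}=[\mathbf{x}_1,\ldots,\mathbf{x}_n]\in\mathbb{R}^{d\times n}$ have nonzero columns, let $m$ be an integer with $2\le m<d$, let $0<\alpha<1$, let $\mathbf{C}=\frac1n\mathbf{X}\mathbf{X}^T$, and let $\mathbf{C}_e$ be the DACE estimator described in the context, built with the sampling probabilities $p_{ki}=\alpha\frac{|x_{ki}|}{\|\mathbf{x}_i\|_1}+(1-\alpha)\frac{x_{ki}^2}{\|\mathbf{x}_i\|_2^2}$ for all $k\in[d]$, $i\in[n]$. Then for any $\eta,\delta\in(0,1)$, with probability at least $1-\eta-\delta$, $$\|\mathbf{C}_e-\mathbf{C}\|_2\le \log\Big(\frac{2d}{\delta}\Big)\frac{2R}{3}+\sqrt{2\sigma^2\log\Big(\frac{2d}{\delta}\Big)},$$ where $$R=\max_{i\in[n]}\left[\frac{7\|\mathbf{x}_i\|_2^2}{n}+\log^2\Big(\frac{2nd}{\eta}\Big)\frac{14\|\mathbf{x}_i\|_1^2}{nm\alpha^2}\right],$$ $$\sigma^2=\sum_{i=1}^n\left[\frac{8\|\mathbf{x}_i\|_2^4}{n^2m^2(1-\alpha)^2}+\frac{4\|\mathbf{x}_i\|_1^2\|\mathbf{x}_i\|_2^2}{n^2m^3\alpha^2(1-\alpha)}+\frac{9\|\mathbf{x}_i\|_2^4}{n^2m(1-\alpha)}+\frac{2\|\mathbf{x}_i\|_2^2\|\mathbf{x}_i\|_1^2}{n^2m^2\alpha(1-\alpha)}\right]+\Big\|\sum_{i=1}^n\frac{\|\mathbf{x}_i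\|_1^2\,\mathbf{x}_i\mathbf{x}_i^T}{n^2m\alpha}\Big\|_2.$$
   Context: DACE construction. Given $\mathbf{X}=[\mathbf{x}_1,\ldots,\mathbf{x}_n]\in\mathbb{R}^{d\times n}$ with $\mathbf{x}_i=(x_{1i},\ldots,x_{di})^T$, an integer $m$ with $2\le m<d$ and $\alpha\in(0,1)$, set $p_{ki}=\alpha\frac{|x_{ki}|}{\|\mathbf{x}_i\|_1}+(1-\alpha)\frac{x_{ki}^2}{\|\mathbf{x}_i\|_2^2}$ for $k\in[d]$, $i\in[n]$. For every $i$ and $j\in[m]$, draw indices $t_{ji}\in[d]$ independently (over all $i,j$) with $\mathbb{P}(t_{ji}=k)=p_{ki}$. With $\mathbf{e}_1,\ldots,\mathbf{e}_d$ the standard basis of $\mathbb{R}^d$, let $\mathbf{S}_i\in\mathbb{R}^{d\times m}$ have $j$-th column $\mathbf{e}_{t_{ji}}/\sqrt{m\,p_{t_{ji}i}}$. For a square matrix $\mathbf{A}$, $\mathbb{D}(\mathbf{A})$ is the diagonal matrix with the main diagonal of $\mathbf{A}$; for a vector $\mathbf{b}$, $\mathbb{D}(\mathbf{b})$ is the diagonal matrix with $\mathbf{b}$ on its diagonal. Let $b_{ki}=\frac{1}{1+(m-1)p_{ki}}$, $\mathbf{b}_i=(b_{1i},\ldots,b_{di})^T$, $\widehat{\mathbf{C}}_1=\frac{m}{nm-n}\sum_{i=1}^n\mathbf{S}_i\mathbf{S}_i^T\mathbf{x}_i\mathbf{x}_i^T\mathbf{S}_i\mathbf{S}_i^T$,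 $\widehat{\mathbf{C}}_2=\frac{m}{nm-n}\sum_{i=1}^n\mathbb{D}(\mathbf{S}_i\mathbf{S}_i^T\mathbf{x}_i\mathbf{x}_i^T\mathbf{S}_i\mathbf{S}_i^T)\mathbb{D}(\mathbf{b}_i)$, and $\mathbf{C}_e=\widehat{\mathbf{C}}_1-\widehat{\mathbf{C}}_2$. $\|\cdot\|_2$ of a matrix is the spectral norm. *)

theory Defs
  imports "HOL-Analysis.Analysis"
begin

text \<open>Dimension d is the finite index type 'd (CARD('d) = d); the columns of X are
  x 0, ..., x (n-1) :: real^'d.  Sampled indices form an outcome T :: nat \<times> nat \<Rightarrow> 'd,
  with T (j,i) = t_{ji} for j < m, i < n.\<close>

definition norm1 :: "real^'d \<Rightarrow> real" where
  "norm1 v = (\<Sum>k\<in>UNIV. \<bar>v $ k\<bar>)"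

definition outer :: "real^'d \<Rightarrow> real^'d \<Rightarrow> real^'d^'d" where
  "outer u v = (\<chi> a b. u $ a * v $ b)"

definition diag_mat :: "real^'d^'d \<Rightarrow> real^'d^'d" where
  "diag_mat A = (\<chi> a b. if a = b then A $ a $ a else 0)"

definition diag_vec :: "real^'d \<Rightarrow> real^'d^'d" where
  "diag_vec v = (\<chi> a b. if a = b then v $ a else 0)"

definition spec_norm :: "real^'d^'d \<Rightarrow> real" where
  "spec_norm A = onorm (\<lambda>v. A *v v)"

definition samp_p :: "real \<Rightarrow> (nat \<Rightarrow> real^'d) \<Rightarrow> 'd \<Rightarrow> nat \<Rightarrow> real" where
  "samp_p \<alpha> x k i = \<alpha> * \<bar>x i $ k\<bar> / norm1 (x i) + (1 - \<alpha>) * (x i $ k)^2 / (norm (x i))^2"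

definition S_col :: "real \<Rightarrow> (nat \<Rightarrow> real^'d) \<Rightarrow> nat \<Rightarrow> (nat \<times> nat \<Rightarrow> 'd) \<Rightarrow> nat \<Rightarrow> nat \<Rightarrow> real^'d" where
  "S_col \<alpha> x m T i j = (1 / sqrt (real m * samp_p \<alpha> x (T (j,i)) i)) *\<^sub>R axis (T (j,i)) 1"

text \<open>S_i S_i^T = sum over the columns s_j of S_i of s_j s_j^T\<close>
definition SSt :: "real \<Rightarrow> (nat \<Rightarrow> real^'d) \<Rightarrow> nat \<Rightarrow> (nat \<times> nat \<Rightarrow> 'd) \<Rightarrow> nat \<Rightarrow> real^'d^'d" where
  "SSt \<alpha> x m T i = (\<Sum>j<m. outer (S_col \<alpha> x m T i j) (S_col \<alpha> x m T i j))"

definition b_vec :: "real \<Rightarrow> (nat \<Rightarrow> real^'d) \<Rightarrow> nat \<Rightarrow> nat \<Rightarrow> real^'d" where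
  "b_vec \<alpha> x m i = (\<chi> k. 1 / (1 + (real m - 1) * samp_p \<alpha> x k i))"

definition C1_hat :: "real \<Rightarrow> (nat \<Rightarrow> real^'d) \<Rightarrow> nat \<Rightarrow> nat \<Rightarrow> (nat \<times> nat \<Rightarrow> 'd) \<Rightarrow> real^'d^'d" where
  "C1_hat \<alpha> x n m T = (real m / (real n * real m - real n)) *\<^sub>R
     (\<Sum>i<n. SSt \<alpha> x m T i ** outer (x i) (x i) ** SSt \<alpha> x m T i)"

definition C2_hat :: "real \<Rightarrow> (nat \<Rightarrow> real^'d) \<Rightarrow> nat \<Rightarrow> nat \<Rightarrow> (nat \<times> nat \<Rightarrow> 'd) \<Rightarrow> real^'d^'d" where
  "C2_hat \<alpha> x n m T = (real m / (real n * real m - real n)) *\<^sub>R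
     (\<Sum>i<n. diag_mat (SSt \<alpha> x m T i ** outer (x i) (x i) ** SSt \<alpha> x m T i) ** diag_vec (b_vec \<alpha> x m i))"

definition C_e :: "real \<Rightarrow> (nat \<Rightarrow> real^'d) \<Rightarrow> nat \<Rightarrow> nat \<Rightarrow> (nat \<times> nat \<Rightarrow> 'd) \<Rightarrow> real^'d^'d" where
  "C_e \<alpha> x n m T = C1_hat \<alpha> x n m T - C2_hat \<alpha> x n m T"

definition cov :: "(nat \<Rightarrow> real^'d) \<Rightarrow> nat \<Rightarrow> real^'d^'d" where
  "cov x n = (1 / real n) *\<^sub>R (\<Sum>i<n. outer (x i) (x i))"

text \<open>Sample space: all index assignments (j,i) \<mapsto> t_{ji}, j < m, i < n;
  the t_{ji} are independent with P(t_{ji} = k) = p_{ki}.\<close>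
definition outcomes :: "nat \<Rightarrow> nat \<Rightarrow> (nat \<times> nat \<Rightarrow> 'd) set" where
  "outcomes n m = PiE ({..<m} \<times> {..<n}) (\<lambda>_. UNIV)"

definition outcome_prob :: "real \<Rightarrow> (nat \<Rightarrow> real^'d) \<Rightarrow> nat \<Rightarrow> nat \<Rightarrow> (nat \<times> nat \<Rightarrow> 'd) \<Rightarrow> real" where
  "outcome_prob \<alpha> x n m T = (\<Prod>(j,i)\<in>{..<m} \<times> {..<n}. samp_p \<alpha> x (T (j,i)) i)"

definition dace_prob :: "real \<Rightarrow> (nat \<Rightarrow> real^'d) \<Rightarrow> nat \<Rightarrow> nat \<Rightarrow> ((nat \<times> nat \<Rightarrow> 'd) \<Rightarrow> bool) \<Rightarrow> real" where
  "dace_prob \<alpha> x n m E = (\<Sum>T\<in>{T\<in>outcomes n m. E T}. outcome_prob \<alpha> x n m T)"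

definition R_bound :: "real \<Rightarrow> (nat \<Rightarrow> real^'d) \<Rightarrow> nat \<Rightarrow> nat \<Rightarrow> real \<Rightarrow> real" where
  "R_bound \<alpha> x n m \<eta> = Max ((\<lambda>i. 7 * (norm (x i))^2 / real n
      + (ln (2 * real n * real CARD('d) / \<eta>))^2 * (14 * (norm1 (x i))^2 / (real n * real m * \<alpha>^2))) ` {..<n})"

definition sigma2 :: "real \<Rightarrow> (nat \<Rightarrow> real^'d) \<Rightarrow> nat \<Rightarrow> nat \<Rightarrow> real" where
  "sigma2 \<alpha> x n m =
     (\<Sum>i<n. 8 * (norm (x i))^4 / ((real n)^2 * (real m)^2 * (1 - \<alpha>)^2)
          + 4 * (norm1 (x i))^2 * (norm (x i))^2 / ((real n)^2 * (real m)^3 * \<alpha>^2 * (1 - \<alpha>))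
          + 9 * (norm (x i))^4 / ((real n)^2 * real m * (1 - \<alpha>))
          + 2 * (norm (x i))^2 * (norm1 (x i))^2 / ((real n)^2 * (real m)^2 * \<alpha> * (1 - \<alpha>)))
     + spec_norm (\<Sum>i<n. ((norm1 (x i))^2 / ((real n)^2 * real m * \<alpha>)) *\<^sub>R outer (x i) (x i))"

end

theory Submission
  imports Defs
begin

text \<open>The estimation error is a sum of independent centred matrices, one for each column, so a matrix
  Bernstein inequality with variance parameter \<open>\<parallel>\<Sum> E Z\<^sub>i\<^sup>2\<parallel>\<close> is needed. It is obtained here without
  Lieb's concavity theorem: for symmetric M and X with \<open>\<parallel>X\<parallel> \<le> R\<close>, expanding in eigenbases of M and of
  M + hX shows that \<open>tr (X\<^sup>2 exp (M + sX))\<close> grows at most like \<open>exp (sR)\<close>, hence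
  \<open>tr exp (M + sX) \<le> tr exp M + s tr (X exp M) + ((exp (sR) - 1 - sR) / R\<^sup>2) tr (X\<^sup>2 exp M)\<close>.
  Averaging over X removes the linear term, and convexity of \<open>tr exp\<close> bounds what remains by
  \<open>tr exp (M + g E X\<^sup>2)\<close>.

  The summands are only bounded on the event that no index is sampled far more often than expected.
  They are set to zero off this event, and the means of the truncated matrices are subtracted.
  Chernoff bounds make both the exceptional probability and this bias small; the bias is absorbed by
  the slack in the constants 7 and 14 of R. The second moments follow from exact formulas for
  factorial moments of multinomial counts.\<close>

section \<open>Spectral theorem for real symmetric matrices\<close>

text \<open>The growth estimate rests on expanding traces at M and at N = M + hX over both
  eigenbases at once. Each product of entries then carries a divided difference of exp, which the
  trapezoid bound replaces by the mean of exp at the two eigenvalues. That weight is a function of i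
  plus a function of j, so Parseval collapses the double sum into traces at the two endpoints.
  Working with finite increments avoids differentiating matrix functions, and the noncommutativity
  of M and X never has to be faced. The one-step estimate returns an exponent of the same shape,
  with a deterministic matrix in place of a random one; this is what lets it be iterated over the
  columns. Truncating column by column leaves the sampling law unchanged and the columns
  independent. Since truncation and centring only lower second moments, the exact multinomial
  formulas for the untruncated matrices remain usable. The mixture in p has two purposes: its
  absolute-value part bounds |x_k| / p_k and the sum of x_k^2 / p_k through the l1 norm, its
  quadratic part bounds each x_k^2 / p_k through the l2 norm.\<close>

definition sym_mat :: "real^'n^'n \<Rightarrow> bool" where
  "sym_mat A \<longleftrightarrow> transpose A = A"

definition onb :: "('n \<Rightarrow> real^'n) \<Rightarrow> bool" where
  "onb u \<longleftrightarrow> (\<forall>i j. u i \<bullet> u j = (if i = j then 1 else 0))"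

lemma sym_mat_inner:
  assumes "sym_mat A"
  shows "v \<bullet> (A *v w) = (A *v v) \<bullet> w"
  using assms by (metis sym_mat_def dot_lmul_matrix transpose_matrix_vector)

lemma sym_mat_add: "sym_mat A \<Longrightarrow> sym_mat B \<Longrightarrow> sym_mat (A + B)"
  by (simp add: sym_mat_def transpose_def vec_eq_iff)

lemma sym_mat_scaleR: "sym_mat A \<Longrightarrow> sym_mat (c *\<^sub>R A)"
  by (simp add: sym_mat_def transpose_scalar)

lemma sym_mat_diff: "sym_mat A \<Longrightarrow> sym_mat B \<Longrightarrow> sym_mat (A - B)"
  by (simp add: sym_mat_def transpose_def vec_eq_iff)

lemma sym_mat_0: "sym_mat 0"
  by (simp add: sym_mat_def transpose_def vec_eq_iff)

lemma sym_mat_sum: "(\<And>i. i \<in> I \<Longrightarrow> sym_mat (A i)) \<Longrightarrow> sym_mat (\<Sum>i\<in>I. A i)"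
  by (induction I rule: infinite_finite_induct) (auto intro: sym_mat_add sym_mat_0)

lemma matrix_vector_mult_sum_left:
  fixes A :: "'i \<Rightarrow> real^'n^'m"
  shows "(\<Sum>i\<in>I. A i) *v v = (\<Sum>i\<in>I. A i *v v)"
  by (induction I rule: infinite_finite_induct) (auto simp: matrix_vector_mult_add_rdistrib)

lemma matrix_vector_mult_scaleR_left:
  fixes A :: "real^'n^'m"
  shows "(c *\<^sub>R A) *v v = c *\<^sub>R (A *v v)"
  by (simp add: scaleR_matrix_vector_assoc)

text \<open>Rayleigh quotients: a maximiser of the quadratic form on the unit sphere of an invariant
  subspace is an eigenvector, and its orthogonal complement is again invariant.\<close>

lemma sym_mat_eigenvector_in_subspace:
  fixes A :: "real^'n^'n"
  assumes A: "sym_mat A" and S: "subspace S" and inv: "\<And>v. v \<in> S \<Longrightarrow> A *v v \<in> S"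
    and ne: "\<exists>v\<in>S. v \<noteq> 0"
  obtains v l where "v \<in> S" "norm v = 1" "A *v v = l *\<^sub>R v"
proof -
  let ?K = "S \<inter> sphere 0 1"
  have comp: "compact ?K"
    using closed_subspace[OF S] compact_sphere by (simp add: closed_Int_compact)
  obtain v0 where v0: "v0 \<in> S" "v0 \<noteq> 0" using ne by blast
  have "(1 / norm v0) *\<^sub>R v0 \<in> ?K" using v0 S by (simp add: subspace_scale)
  then have "?K \<noteq> {}" by blast
  moreover have "continuous_on ?K (\<lambda>v. v \<bullet> (A *v v))"
    by (intro continuous_intros linear_continuous_on linear_linear[THEN iffD2]) auto
  ultimately obtain v where v: "v \<in> ?K" and mx: "\<And>w. w \<in> ?K \<Longrightarrow> w \<bullet> (A *v w) \<le> v \<bullet> (A *v v)"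
    using continuous_attains_sup[OF comp] by blast
  define l where "l = v \<bullet> (A *v v)"
  have vS: "v \<in> S" and nv: "norm v = 1" using v by auto
  have vv: "v \<bullet> v = 1" using nv by (simp add: dot_square_norm)
  have quad: "w \<bullet> (A *v w) \<le> l * (w \<bullet> w)" if "w \<in> S" for w
  proof (cases "w = 0")
    case False
    have "(1 / norm w) *\<^sub>R w \<in> ?K" using that False S by (simp add: subspace_scale)
    from mx[OF this] have "w \<bullet> (A *v w) / (norm w)\<^sup>2 \<le> l"
      by (simp add: l_def matrix_vector_mult_scaleR power2_eq_square)
    then show ?thesis using False by (simp add: dot_square_norm field_simps)
  qed simp
  have orth: "(A *v v - l *\<^sub>R v) \<bullet> w = 0" if w: "w \<in> S" for w
  proof -
    define b where "b = (A *v v - l *\<^sub>R v) \<bullet> w"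
    define c where "c = l * (w \<bullet> w) - w \<bullet> (A *v w)"
    have c0: "c \<ge> 0" using quad[OF w] by (simp add: c_def)
    \<comment> \<open>Perturbing the maximiser to v + t w: the first-order term cannot exceed the
      second-order one for any t, which forces b = 0.\<close>
    have q: "2 * t * b \<le> t\<^sup>2 * c" for t
    proof -
      have "v + t *\<^sub>R w \<in> S" using vS w S by (simp add: subspace_add subspace_scale)
      from quad[OF this]
      have "l + 2 * t * ((A *v v) \<bullet> w) + t\<^sup>2 * (w \<bullet> (A *v w)) \<le> l * (1 + 2 * t * (v \<bullet> w) + t\<^sup>2 * (w \<bullet> w))"
        using sym_mat_inner[OF A, of v w]
        by (simp add: matrix_vector_right_distrib matrix_vector_mult_scaleR inner_add_left
            inner_add_right vv l_def power2_eq_square algebra_simps inner_commute)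
      then show ?thesis by (simp add: b_def c_def inner_diff_left algebra_simps)
    qed
    have "b = 0"
    proof (rule ccontr)
      assume "b \<noteq> 0"
      then have b2: "b\<^sup>2 > 0" by simp
      \<comment> \<open>At t = s b the inequality \<open>q\<close> reads 2 <= s c; the summand 1
        keeps s finite when c = 0 and makes s c < 1.\<close>
      define s where "s = 1 / (c + 1)"
      have s: "s > 0" "s * c < 1" using c0 by (auto simp: s_def)
      have "2 * s * b\<^sup>2 \<le> (s * c) * s * b\<^sup>2"
        using q[of "s * b"] by (simp add: power2_eq_square mult_ac)
      then have "2 \<le> s * c" using b2 s(1) by (simp add: mult.commute)
      then show False using s(2) by simp
    qed
    then show ?thesis by (simp add: b_def)
  qed
  have "A *v v - l *\<^sub>R v \<in> S" using inv[OF vS] vS S by (simp add: subspace_diff subspace_scale)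
  from orth[OF this] have "A *v v = l *\<^sub>R v" by simp
  with vS nv show ?thesis by (rule that)
qed

lemma sym_mat_eigenbasis_subspace:
  fixes A :: "real^'n^'n"
  assumes A: "sym_mat A"
  shows "subspace S \<Longrightarrow> (\<And>v. v \<in> S \<Longrightarrow> A *v v \<in> S) \<Longrightarrow>
    \<exists>B. B \<subseteq> S \<and> finite B \<and> card B = dim S \<and> pairwise orthogonal B \<and>
       (\<forall>v\<in>B. norm v = 1 \<and> (\<exists>l. A *v v = l *\<^sub>R v))"
proof (induction "dim S" arbitrary: S)
  case 0
  then show ?case by (intro exI[of _ "{}"]) auto
next
  case (Suc n)
  have "\<exists>v\<in>S. v \<noteq> 0" using Suc.hyps(2) dim_eq_0[of S] by (metis nat.distinct(1) singleton_iff subsetI)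
  then obtain v l where v: "v \<in> S" "norm v = 1" "A *v v = l *\<^sub>R v"
    using sym_mat_eigenvector_in_subspace[OF A Suc.prems] by metis
  define S' where "S' = {w \<in> S. v \<bullet> w = 0}"
  have S'eq: "S' = S \<inter> {w. v \<bullet> w = 0}" by (auto simp: S'_def)
  have sub: "subspace S'" unfolding S'eq
    by (intro subspace_inter Suc.prems(1) subspace_hyperplane)
  have vn: "v \<noteq> 0" using v by auto
  have "S' = {y \<in> S. \<forall>x\<in>span {v}. orthogonal x y}"
    by (auto simp: S'_def orthogonal_def span_singleton)
  moreover have "span {v} \<subseteq> S" using v Suc.prems(1) by (simp add: span_minimal)
  ultimately have dimS': "dim S' + dim (span {v}) = dim S"
    using dim_subspace_orthogonal_to_vectors[of "span {v}" S] Suc.prems(1) by simp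
  have "dim (span {v}) = 1" using vn by (simp add: dim_span)
  with dimS' Suc.hyps(2) have d: "n = dim S'" by simp
  have inv: "A *v w \<in> S'" if "w \<in> S'" for w
    using that Suc.prems(2) sym_mat_inner[OF A, of v w] v(3) by (simp add: S'_def)
  from Suc.hyps(1)[OF d sub inv] obtain B where B: "B \<subseteq> S'" "finite B" "card B = dim S'"
    "pairwise orthogonal B" "\<forall>v\<in>B. norm v = 1 \<and> (\<exists>l. A *v v = l *\<^sub>R v)" by blast
  have "v \<notin> B" using B(1) vn by (auto simp: S'_def)
  then have "card (insert v B) = dim S" using B(2,3) d Suc.hyps(2) by simp
  moreover have "pairwise orthogonal (insert v B)"
    using B(1,4) by (auto simp: pairwise_insert S'_def orthogonal_def inner_commute)
  ultimately show ?case using B v by (intro exI[of _ "insert v B"]) (auto simp: S'_def)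
qed

lemma sym_mat_eigenbasis:
  fixes A :: "real^'n^'n"
  assumes "sym_mat A"
  shows "\<exists>u l. onb u \<and> (\<forall>i. A *v u i = l i *\<^sub>R u i)"
proof -
  obtain B where B: "finite B" "card B = dim (UNIV :: (real^'n) set)" "pairwise orthogonal B"
    "\<forall>v\<in>B. norm v = 1 \<and> (\<exists>l. A *v v = l *\<^sub>R v)"
    using sym_mat_eigenbasis_subspace[OF assms, of UNIV] by auto
  have "card B = card (UNIV :: 'n set)" using B(2) by simp
  then obtain u where u: "bij_betw u (UNIV :: 'n set) B"
    using B(1) by (metis finite_same_card_bij finite_class.finite_UNIV)
  have uB: "u i \<in> B" for i using u by (auto simp: bij_betw_def)
  have "onb u" unfolding onb_def
  proof (intro allI)
    fix i j
    show "u i \<bullet> u j = (if i = j then 1 else 0)"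
      using B(3,4) uB[of i] uB[of j] u
      by (auto simp: pairwise_def orthogonal_def dot_square_norm bij_betw_def inj_eq)
  qed
  moreover have "\<forall>i. \<exists>l. A *v u i = l *\<^sub>R u i" using B(4) uB by blast
  then have "\<exists>l. \<forall>i. A *v u i = l i *\<^sub>R u i" by (rule choice)
  ultimately show ?thesis by blast
qed

lemma onb_expand:
  fixes u :: "'n \<Rightarrow> real^'n"
  assumes "onb u"
  shows "(\<Sum>i\<in>UNIV. (u i \<bullet> v) *\<^sub>R u i) = v"
proof -
  have inj: "inj u" using assms by (auto simp: onb_def inj_def) (metis zero_neq_one)
  have orth: "pairwise orthogonal (range u)"
    using assms by (auto simp: pairwise_def orthogonal_def onb_def)
  have nrm: "norm b = 1" if "b \<in> range u" for b
    using that assms by (auto simp: onb_def norm_eq_sqrt_inner)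
  have "0 \<notin> range u" using nrm[of 0] by auto
  then have "independent (range u)" using orth pairwise_orthogonal_independent by blast
  moreover have "card (range u) = dim (UNIV :: (real^'n) set)" using inj by (simp add: card_image)
  ultimately have "span (range u) = UNIV"
    using card_eq_dim[of "range u" UNIV] by auto
  then have "(\<Sum>b\<in>range u. (v \<bullet> b) *\<^sub>R b) = v"
    using orthonormal_basis_expand[of "range u" v] orth nrm by auto
  then show ?thesis using inj by (simp add: sum.reindex inner_commute)
qed

lemma onb_parseval:
  fixes u :: "'n \<Rightarrow> real^'n"
  assumes "onb u"
  shows "(\<Sum>i\<in>UNIV. (u i \<bullet> v) * (u i \<bullet> w)) = v \<bullet> w"
proof -
  have "v \<bullet> w = (\<Sum>i\<in>UNIV. (u i \<bullet> v) *\<^sub>R u i) \<bullet> w" using onb_expand[OF assms] by simp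
  then show ?thesis by (simp add: inner_sum_left)
qed

lemma onb_norm_sq:
  fixes u :: "'n \<Rightarrow> real^'n"
  assumes "onb u"
  shows "(\<Sum>i\<in>UNIV. (u i \<bullet> v)\<^sup>2) = (norm v)\<^sup>2"
  using onb_parseval[OF assms, of v v] by (simp add: power2_eq_square dot_square_norm)

text \<open>One orthonormal eigenbasis is fixed per matrix by choice. Only the vectors have to be
  chosen, because the eigenvalues are recovered as Rayleigh quotients.\<close>

definition eig_vec :: "real^'n^'n \<Rightarrow> 'n \<Rightarrow> real^'n" where
  "eig_vec A = (SOME u. onb u \<and> (\<exists>l. \<forall>i. A *v u i = l i *\<^sub>R u i))"

definition eig_val :: "real^'n^'n \<Rightarrow> 'n \<Rightarrow> real" where
  "eig_val A i = eig_vec A i \<bullet> (A *v eig_vec A i)"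

lemma eig_vec:
  assumes "sym_mat A"
  shows onb_eig_vec: "onb (eig_vec A)"
    and mult_eig_vec: "A *v eig_vec A i = eig_val A i *\<^sub>R eig_vec A i"
proof -
  have *: "onb (eig_vec A) \<and> (\<exists>l. \<forall>i. A *v eig_vec A i = l i *\<^sub>R eig_vec A i)"
    unfolding eig_vec_def using someI_ex[of "\<lambda>u. onb u \<and> (\<exists>l. \<forall>i. A *v u i = l i *\<^sub>R u i)"]
      sym_mat_eigenbasis[OF assms] by blast
  then show "onb (eig_vec A)" by blast
  from * show "A *v eig_vec A i = eig_val A i *\<^sub>R eig_vec A i"
    by (auto simp: eig_val_def onb_def)
qed

lemma norm_onb: "onb u \<Longrightarrow> norm (u i) = 1"
  by (simp add: onb_def norm_eq_sqrt_inner)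

text \<open>For a symmetric matrix the quadratic form controls the operator norm: at eigenvectors
  the form takes the eigenvalues, and these scale the coordinates of v. All later norm bounds are
  thereby reduced to quadratic forms.\<close>

lemma sym_mat_norm_le:
  fixes A :: "real^'n^'n"
  assumes A: "sym_mat A" and q: "\<And>v. \<bar>v \<bullet> (A *v v)\<bar> \<le> R * (norm v)\<^sup>2"
  shows "norm (A *v v) \<le> R * norm v"
proof -
  let ?u = "eig_vec A"
  note o = onb_eig_vec[OF A]
  have l: "\<bar>eig_val A i\<bar> \<le> R" for i
    using q[of "?u i"] norm_onb[OF o, of i] by (simp add: eig_val_def)
  then have R: "R \<ge> 0" by (meson abs_ge_zero order_trans)
  have "(norm (A *v v))\<^sup>2 = (\<Sum>i\<in>UNIV. (?u i \<bullet> (A *v v))\<^sup>2)" using onb_norm_sq[OF o] by simp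
  also have "\<dots> = (\<Sum>i\<in>UNIV. (eig_val A i)\<^sup>2 * (?u i \<bullet> v)\<^sup>2)"
    by (simp add: sym_mat_inner[OF A] mult_eig_vec[OF A] power_mult_distrib)
  also have "\<dots> \<le> (\<Sum>i\<in>UNIV. R\<^sup>2 * (?u i \<bullet> v)\<^sup>2)"
    by (intro sum_mono mult_right_mono) (use l R in \<open>auto simp: abs_le_square_iff[symmetric]\<close>)
  also have "\<dots> = (R * norm v)\<^sup>2"
    by (simp add: sum_distrib_left[symmetric] onb_norm_sq[OF o] power_mult_distrib)
  finally show ?thesis using R by (simp add: power2_le_iff_abs_le)
qed

section \<open>Trace-exponential functionals\<close>

text \<open>This is tr (Q exp M), written in an eigenbasis of M so that no matrix exponential has to
  be constructed. It is linear in Q, and Q = 1 gives tr exp M.\<close>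

definition trexp :: "real^'n^'n \<Rightarrow> real^'n^'n \<Rightarrow> real" where
  "trexp M Q = (\<Sum>i\<in>UNIV. exp (eig_val M i) * (eig_vec M i \<bullet> (Q *v eig_vec M i)))"

lemma trexp_add: "trexp M (P + Q) = trexp M P + trexp M Q"
  by (simp add: trexp_def matrix_vector_mult_add_rdistrib inner_add_right distrib_left sum.distrib)

lemma trexp_scaleR: "trexp M (c *\<^sub>R Q) = c * trexp M Q"
  by (simp add: trexp_def matrix_vector_mult_scaleR_left sum_distrib_left mult_ac)

lemma trexp_0: "trexp M 0 = 0"
  by (simp add: trexp_def)

lemma trexp_sum: "trexp M (\<Sum>i\<in>I. Q i) = (\<Sum>i\<in>I. trexp M (Q i))"
  by (induction I rule: infinite_finite_induct) (auto simp: trexp_0 trexp_add)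

lemma trexp_mono:
  "(\<And>v. v \<bullet> (P *v v) \<le> v \<bullet> (Q *v v)) \<Longrightarrow> trexp M P \<le> trexp M Q"
  by (auto simp: trexp_def intro!: sum_mono mult_left_mono)

lemma trexp_1: "sym_mat M \<Longrightarrow> trexp M (mat 1) = (\<Sum>i\<in>UNIV. exp (eig_val M i))"
  using onb_eig_vec[of M] by (auto simp: trexp_def onb_def intro!: sum.cong)

lemma inner_square: "sym_mat X \<Longrightarrow> v \<bullet> ((X ** X) *v v) = (norm (X *v v))\<^sup>2"
  by (simp add: matrix_vector_mul_assoc[symmetric] sym_mat_inner dot_square_norm)

lemma trexp_square_nonneg: "sym_mat X \<Longrightarrow> 0 \<le> trexp M (X ** X)"
  by (auto simp: trexp_def inner_square intro!: sum_nonneg)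

text \<open>The logarithmic mean of exp a and exp b is at most their arithmetic mean. The gain is
  that the arithmetic mean separates into a term in a and a term in b.\<close>

lemma exp_trapezoid:
  fixes a b :: real
  shows "\<bar>exp b - exp a\<bar> \<le> \<bar>b - a\<bar> * ((exp a + exp b) / 2)"
proof -
  have base: "exp t - 1 \<le> t * ((exp t + 1) / 2)" if "t \<ge> 0" for t :: real
  proof -
    let ?F = "\<lambda>t::real. t * ((exp t + 1) / 2) - (exp t - 1)"
    have "?F 0 \<le> ?F t"
    proof (rule DERIV_nonneg_imp_nondecreasing[OF that])
      fix x :: real assume "0 \<le> x" "x \<le> t"
      have "1 - x \<le> exp (- x)" using exp_ge_add_one_self[of "- x"] by simp
      then have "(1 - x) * exp x \<le> 1" by (simp add: exp_minus field_simps)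
      then show "\<exists>y. DERIV ?F x :> y \<and> y \<ge> 0"
        by (intro exI[of _ "(1 + (x - 1) * exp x) / 2"] conjI)
           (auto intro!: derivative_eq_intros simp: field_simps)
    qed
    then show ?thesis by simp
  qed
  have *: "exp d - exp c \<le> (d - c) * ((exp c + exp d) / 2)" if "c \<le> d" for c d :: real
  proof -
    have "exp c * (exp (d - c) - 1) \<le> exp c * ((d - c) * ((exp (d - c) + 1) / 2))"
      using base[of "d - c"] that by (intro mult_left_mono) auto
    also have "exp c * (exp (d - c) - 1) = exp d - exp c"
      by (simp add: right_diff_distrib exp_add[symmetric])
    also have "exp c * ((d - c) * ((exp (d - c) + 1) / 2)) = (d - c) * ((exp c + exp c * exp (d - c)) / 2)"
      by (simp add: algebra_simps)
    finally show ?thesis by (simp add: exp_add[symmetric])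
  qed
  show ?thesis
    using *[of a b] *[of b a] by (cases a b rule: linorder_cases) (auto simp: abs_if algebra_simps)
qed

section \<open>Comparing trace functionals across two eigenbases\<close>

context
  fixes M N Q :: "real^'n^'n"
  assumes M: "sym_mat M" and N: "sym_mat N" and Q: "sym_mat Q"
begin

private lemma swap_bases: "eig_vec N j \<bullet> (Q *v eig_vec M i) = eig_vec M i \<bullet> (Q *v eig_vec N j)"
  by (metis sym_mat_inner[OF Q] inner_commute)

private lemma trexp_right: "trexp N Q =
  (\<Sum>i\<in>UNIV. \<Sum>j\<in>UNIV. exp (eig_val N j) * ((eig_vec M i \<bullet> eig_vec N j) * (eig_vec M i \<bullet> (Q *v eig_vec N j))))"
  unfolding trexp_def
  by (subst sum.swap) (simp add: sum_distrib_left[symmetric] onb_parseval[OF onb_eig_vec[OF M]])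

private lemma trexp_left: "trexp M Q =
  (\<Sum>i\<in>UNIV. \<Sum>j\<in>UNIV. exp (eig_val M i) * ((eig_vec M i \<bullet> eig_vec N j) * (eig_vec M i \<bullet> (Q *v eig_vec N j))))"
proof -
  have "(\<Sum>j\<in>UNIV. (eig_vec M i \<bullet> eig_vec N j) * (eig_vec M i \<bullet> (Q *v eig_vec N j)))
      = eig_vec M i \<bullet> (Q *v eig_vec M i)" for i
    using onb_parseval[OF onb_eig_vec[OF N], of "eig_vec M i" "Q *v eig_vec M i"]
    by (simp add: swap_bases inner_commute[of "eig_vec N _" "eig_vec M _"])
  then show ?thesis by (simp add: trexp_def sum_distrib_left[symmetric])
qed

text \<open>Trades an eigenvalue gap for an entry of N - M. As nothing is divided by the gap,
  coinciding eigenvalues need no separate treatment.\<close>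

private lemma eig_gap:
  "(eig_val N j - eig_val M i) * (eig_vec M i \<bullet> eig_vec N j) = eig_vec M i \<bullet> ((N - M) *v eig_vec N j)"
  using sym_mat_inner[OF M, of "eig_vec M i" "eig_vec N j"]
  by (simp add: matrix_vector_mult_diff_rdistrib inner_diff_right mult_eig_vec[OF M] mult_eig_vec[OF N]
      left_diff_distrib)

text \<open>In the mixed bases both traces are sums of the same products and differ only in the
  weights, exp of an eigenvalue of N against exp of one of M. The trapezoid bound on the weights
  produces the gap that \<open>eig_gap\<close> turns into an entry of N - M.\<close>

lemma trexp_diff_le:
  "\<bar>trexp N Q - trexp M Q\<bar> \<le> (\<Sum>i\<in>UNIV. \<Sum>j\<in>UNIV. (exp (eig_val M i) + exp (eig_val N j)) / 2 *
     (\<bar>eig_vec M i \<bullet> ((N - M) *v eig_vec N j)\<bar> * \<bar>eig_vec M i \<bullet> (Q *v eig_vec N j)\<bar>))"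
proof -
  let ?c = "\<lambda>i j. eig_vec M i \<bullet> eig_vec N j" and ?z = "\<lambda>i j. eig_vec M i \<bullet> (Q *v eig_vec N j)"
  have "trexp N Q - trexp M Q = (\<Sum>i\<in>UNIV. \<Sum>j\<in>UNIV. (exp (eig_val N j) - exp (eig_val M i)) * (?c i j * ?z i j))"
    by (simp add: trexp_left trexp_right sum_subtractf[symmetric] left_diff_distrib)
  also have "\<bar>\<dots>\<bar> \<le> (\<Sum>i\<in>UNIV. \<Sum>j\<in>UNIV. \<bar>(exp (eig_val N j) - exp (eig_val M i)) * (?c i j * ?z i j)\<bar>)"
    by (intro order_trans[OF sum_abs] sum_mono order_refl)
  also have "\<dots> \<le> (\<Sum>i\<in>UNIV. \<Sum>j\<in>UNIV. (exp (eig_val M i) + exp (eig_val N j)) / 2 *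
     (\<bar>eig_vec M i \<bullet> ((N - M) *v eig_vec N j)\<bar> * \<bar>?z i j\<bar>))"
  proof (intro sum_mono)
    fix i j
    have "\<bar>(exp (eig_val N j) - exp (eig_val M i)) * (?c i j * ?z i j)\<bar>
        = \<bar>exp (eig_val N j) - exp (eig_val M i)\<bar> * (\<bar>?c i j\<bar> * \<bar>?z i j\<bar>)" by (simp add: abs_mult)
    also have "\<dots> \<le> (\<bar>eig_val N j - eig_val M i\<bar> * ((exp (eig_val M i) + exp (eig_val N j)) / 2)) * (\<bar>?c i j\<bar> * \<bar>?z i j\<bar>)"
      by (intro mult_right_mono exp_trapezoid) auto
    also have "\<dots> = (exp (eig_val M i) + exp (eig_val N j)) / 2 * (\<bar>(eig_val N j - eig_val M i) * ?c i j\<bar> * \<bar>?z i j\<bar>)"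
      by (simp add: abs_mult)
    finally show "\<bar>(exp (eig_val N j) - exp (eig_val M i)) * (?c i j * ?z i j)\<bar> \<le>
      (exp (eig_val M i) + exp (eig_val N j)) / 2 * (\<bar>eig_vec M i \<bullet> ((N - M) *v eig_vec N j)\<bar> * \<bar>?z i j\<bar>)"
      by (simp only: eig_gap)
  qed
  finally show ?thesis .
qed

text \<open>Each half of the weight depends on one index only, so Parseval sums the squares over the
  other index to the squared norm of Q applied to one eigenvector.\<close>

lemma sum_trexp_weights:
  "(\<Sum>i\<in>UNIV. \<Sum>j\<in>UNIV. (exp (eig_val M i) + exp (eig_val N j)) / 2 * (eig_vec M i \<bullet> (Q *v eig_vec N j))\<^sup>2)
   = (trexp M (Q ** Q) + trexp N (Q ** Q)) / 2"
proof -
  let ?z = "\<lambda>i j. (eig_vec M i \<bullet> (Q *v eig_vec N j))\<^sup>2"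
  have 1: "(\<Sum>j\<in>UNIV. ?z i j) = (norm (Q *v eig_vec M i))\<^sup>2" for i
    using onb_norm_sq[OF onb_eig_vec[OF N], of "Q *v eig_vec M i"]
    by (simp add: swap_bases)
  have 2: "(\<Sum>i\<in>UNIV. ?z i j) = (norm (Q *v eig_vec N j))\<^sup>2" for j
    by (rule onb_norm_sq[OF onb_eig_vec[OF M]])
  have "(\<Sum>i\<in>UNIV. \<Sum>j\<in>UNIV. (exp (eig_val M i) + exp (eig_val N j)) / 2 * ?z i j)
      = (\<Sum>i\<in>UNIV. \<Sum>j\<in>UNIV. exp (eig_val M i) * ?z i j) / 2 + (\<Sum>i\<in>UNIV. \<Sum>j\<in>UNIV. exp (eig_val N j) * ?z i j) / 2"
    by (simp add: sum_divide_distrib sum.distrib[symmetric] add_divide_distrib distrib_right)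
  also have "(\<Sum>i\<in>UNIV. \<Sum>j\<in>UNIV. exp (eig_val M i) * ?z i j) = trexp M (Q ** Q)"
    by (simp add: sum_distrib_left[symmetric] 1 trexp_def inner_square[OF Q])
  also have "(\<Sum>i\<in>UNIV. \<Sum>j\<in>UNIV. exp (eig_val N j) * ?z i j) = trexp N (Q ** Q)"
    by (subst sum.swap) (simp add: sum_distrib_left[symmetric] 2 trexp_def inner_square[OF Q])
  finally show ?thesis by simp
qed

end

text \<open>The squares \<open>?c i j\<close> form a doubly stochastic matrix. Averaging the scalar
  tangent inequality exp l (1 + m - l) <= exp m with these weights gives the tangent inequality for
  tr exp at M.\<close>

lemma trexp_klein:
  fixes M N :: "real^'n^'n"
  assumes M: "sym_mat M" and N: "sym_mat N"
  shows "trexp M (mat 1) + trexp M (N - M) \<le> trexp N (mat 1)"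
proof -
  let ?u = "eig_vec M" and ?v = "eig_vec N" and ?l = "eig_val M" and ?m = "eig_val N"
  let ?c = "\<lambda>i j. (?u i \<bullet> ?v j)\<^sup>2"
  have r: "(\<Sum>j\<in>UNIV. ?c i j) = 1" for i
    using onb_norm_sq[OF onb_eig_vec[OF N], of "?u i"] norm_onb[OF onb_eig_vec[OF M], of i]
    by (simp add: inner_commute)
  have c: "(\<Sum>i\<in>UNIV. ?c i j) = 1" for j
    using onb_norm_sq[OF onb_eig_vec[OF M], of "?v j"] norm_onb[OF onb_eig_vec[OF N], of j] by simp
  have q: "?u i \<bullet> (N *v ?u i) = (\<Sum>j\<in>UNIV. ?m j * ?c i j)" for i
  proof -
    have "?u i \<bullet> (N *v ?u i) = (\<Sum>j\<in>UNIV. (?v j \<bullet> ?u i) * (?v j \<bullet> (N *v ?u i)))"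
      by (rule onb_parseval[OF onb_eig_vec[OF N], symmetric])
    also have "\<dots> = (\<Sum>j\<in>UNIV. ?m j * ?c i j)"
      by (intro sum.cong) (auto simp: sym_mat_inner[OF N] mult_eig_vec[OF N] power2_eq_square inner_commute)
    finally show ?thesis .
  qed
  have "trexp M (mat 1) + trexp M (N - M)
      = (\<Sum>i\<in>UNIV. exp (?l i) + exp (?l i) * (?u i \<bullet> (N *v ?u i) - ?l i))"
    using norm_onb[OF onb_eig_vec[OF M]]
    by (simp add: trexp_1[OF M] trexp_def matrix_vector_mult_diff_rdistrib inner_diff_right
        mult_eig_vec[OF M] dot_square_norm sum.distrib)
  also have "\<dots> = (\<Sum>i\<in>UNIV. \<Sum>j\<in>UNIV. exp (?l i) * (1 + (?m j - ?l i)) * ?c i j)"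
  proof (intro sum.cong refl)
    fix i
    have "(\<Sum>j\<in>UNIV. exp (?l i) * (1 + (?m j - ?l i)) * ?c i j)
        = exp (?l i) * (1 - ?l i) * (\<Sum>j\<in>UNIV. ?c i j) + exp (?l i) * (\<Sum>j\<in>UNIV. ?m j * ?c i j)"
      by (simp add: sum_distrib_left sum.distrib[symmetric] algebra_simps)
    then show "exp (?l i) + exp (?l i) * (?u i \<bullet> (N *v ?u i) - ?l i)
        = (\<Sum>j\<in>UNIV. exp (?l i) * (1 + (?m j - ?l i)) * ?c i j)"
      by (simp add: r q algebra_simps)
  qed
  also have "\<dots> \<le> (\<Sum>i\<in>UNIV. \<Sum>j\<in>UNIV. exp (?m j) * ?c i j)"
  proof (intro sum_mono mult_right_mono)
    fix i j
    have "exp (?l i) * (1 + (?m j - ?l i)) \<le> exp (?l i) * exp (?m j - ?l i)"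
      by (intro mult_left_mono exp_ge_add_one_self) auto
    then show "exp (?l i) * (1 + (?m j - ?l i)) \<le> exp (?m j)" by (simp add: exp_diff)
  qed auto
  also have "\<dots> = trexp N (mat 1)"
    by (subst sum.swap) (simp add: sum_distrib_left[symmetric] c trexp_1[OF N])
  finally show ?thesis .
qed

text \<open>With N - M = h X and Q = X the two entries in \<open>trexp_diff_le\<close> agree up to
  the factor h, so their product is the square that \<open>sum_trexp_weights\<close>
  evaluates.\<close>

lemma trexp_slope_le:
  fixes M X :: "real^'n^'n"
  assumes M: "sym_mat M" and X: "sym_mat X" and h: "h \<ge> 0"
  shows "trexp (M + h *\<^sub>R X) X - trexp M X
     \<le> h * ((trexp M (X ** X) + trexp (M + h *\<^sub>R X) (X ** X)) / 2)"
proof -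
  let ?N = "M + h *\<^sub>R X"
  have N: "sym_mat ?N" by (intro sym_mat_add sym_mat_scaleR M X)
  have "trexp ?N X - trexp M X \<le> (\<Sum>i\<in>UNIV. \<Sum>j\<in>UNIV. (exp (eig_val M i) + exp (eig_val ?N j)) / 2 *
     (\<bar>eig_vec M i \<bullet> ((h *\<^sub>R X) *v eig_vec ?N j)\<bar> * \<bar>eig_vec M i \<bullet> (X *v eig_vec ?N j)\<bar>))"
    using trexp_diff_le[OF M N X] by simp
  also have "\<dots> = h * (\<Sum>i\<in>UNIV. \<Sum>j\<in>UNIV. (exp (eig_val M i) + exp (eig_val ?N j)) / 2 *
      (eig_vec M i \<bullet> (X *v eig_vec ?N j))\<^sup>2)"
    unfolding sum_distrib_left using h
    by (intro sum.cong refl)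
       (simp add: matrix_vector_mult_scaleR_left abs_mult power2_eq_square[symmetric])
  finally show ?thesis by (simp only: sum_trexp_weights[OF M N X])
qed

text \<open>Young's inequality entrywise in the two eigenbases: as \<open>X\<^sup>4 \<le> R\<^sup>2 X\<^sup>2\<close>, both squares are bounded by
  the quantity whose growth is being estimated.\<close>

lemma trexp_square_slope_le:
  fixes M X :: "real^'n^'n"
  assumes M: "sym_mat M" and X: "sym_mat X" and h: "h \<ge> 0"
    and R: "R > 0" and XR: "\<And>v. norm (X *v v) \<le> R * norm v"
  shows "trexp (M + h *\<^sub>R X) (X ** X) - trexp M (X ** X)
     \<le> h * R * ((trexp M (X ** X) + trexp (M + h *\<^sub>R X) (X ** X)) / 2)"
proof -
  let ?N = "M + h *\<^sub>R X" and ?Q = "X ** X"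
  have N: "sym_mat ?N" by (intro sym_mat_add sym_mat_scaleR M X)
  have Q: "sym_mat ?Q" using X by (simp add: sym_mat_def matrix_transpose_mul)
  define w where "w = (\<lambda>i j. (exp (eig_val M i) + exp (eig_val ?N j)) / 2)"
  define a where "a = (\<lambda>i j. eig_vec M i \<bullet> (X *v eig_vec ?N j))"
  define b where "b = (\<lambda>i j. eig_vec M i \<bullet> (?Q *v eig_vec ?N j))"
  have w: "w i j \<ge> 0" for i j by (simp add: w_def add_nonneg_nonneg)
  have sa: "(\<Sum>i\<in>UNIV. \<Sum>j\<in>UNIV. w i j * (a i j)\<^sup>2) = (trexp M ?Q + trexp ?N ?Q) / 2"
    unfolding w_def a_def by (rule sum_trexp_weights[OF M N X])
  have QQ: "v \<bullet> ((?Q ** ?Q) *v v) \<le> v \<bullet> ((R\<^sup>2 *\<^sub>R ?Q) *v v)" for v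
  proof -
    have "norm (?Q *v v) \<le> R * norm (X *v v)"
      using XR[of "X *v v"] by (simp add: matrix_vector_mul_assoc)
    then have "(norm (?Q *v v))\<^sup>2 \<le> (R * norm (X *v v))\<^sup>2" by (simp add: power_mono)
    then show ?thesis
      by (simp add: inner_square[OF Q] matrix_vector_mult_scaleR_left inner_square[OF X] power_mult_distrib)
  qed
  have sb: "(\<Sum>i\<in>UNIV. \<Sum>j\<in>UNIV. w i j * (b i j)\<^sup>2) \<le> R\<^sup>2 * ((trexp M ?Q + trexp ?N ?Q) / 2)"
    unfolding w_def b_def sum_trexp_weights[OF M N Q]
    using trexp_mono[OF QQ, of M] trexp_mono[OF QQ, of ?N] by (simp add: trexp_scaleR algebra_simps)
  have "trexp ?N ?Q - trexp M ?Q \<le> (\<Sum>i\<in>UNIV. \<Sum>j\<in>UNIV. w i j *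
     (\<bar>eig_vec M i \<bullet> ((h *\<^sub>R X) *v eig_vec ?N j)\<bar> * \<bar>b i j\<bar>))"
    unfolding w_def b_def using trexp_diff_le[OF M N Q] by simp
  also have "\<dots> = h * (\<Sum>i\<in>UNIV. \<Sum>j\<in>UNIV. w i j * (\<bar>a i j\<bar> * \<bar>b i j\<bar>))"
    unfolding sum_distrib_left using h
    by (intro sum.cong refl) (simp add: matrix_vector_mult_scaleR_left abs_mult a_def)
  also have "\<dots> \<le> h * (\<Sum>i\<in>UNIV. \<Sum>j\<in>UNIV. w i j * (R / 2 * (a i j)\<^sup>2 + 1 / (2 * R) * (b i j)\<^sup>2))"
  proof (intro mult_left_mono sum_mono h w)
    fix i j
    have "0 \<le> (R * \<bar>a i j\<bar> - \<bar>b i j\<bar>)\<^sup>2" by simp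
    then have "2 * R * (\<bar>a i j\<bar> * \<bar>b i j\<bar>) \<le> R\<^sup>2 * (a i j)\<^sup>2 + (b i j)\<^sup>2"
      by (simp add: power2_eq_square algebra_simps)
    then show "\<bar>a i j\<bar> * \<bar>b i j\<bar> \<le> R / 2 * (a i j)\<^sup>2 + 1 / (2 * R) * (b i j)\<^sup>2"
      using R by (simp add: field_simps power2_eq_square)
  qed
  also have "(\<Sum>i\<in>UNIV. \<Sum>j\<in>UNIV. w i j * (R / 2 * (a i j)\<^sup>2 + 1 / (2 * R) * (b i j)\<^sup>2))
      = R / 2 * (\<Sum>i\<in>UNIV. \<Sum>j\<in>UNIV. w i j * (a i j)\<^sup>2) + 1 / (2 * R) * (\<Sum>i\<in>UNIV. \<Sum>j\<in>UNIV. w i j * (b i j)\<^sup>2)"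
    by (simp add: sum_distrib_left sum.distrib[symmetric] algebra_simps)
  also have "h * \<dots> \<le> h * (R / 2 * ((trexp M ?Q + trexp ?N ?Q) / 2)
      + 1 / (2 * R) * (R\<^sup>2 * ((trexp M ?Q + trexp ?N ?Q) / 2)))"
    unfolding sa using sb R by (intro mult_left_mono add_left_mono h) auto
  also have "\<dots> = h * R * ((trexp M ?Q + trexp ?N ?Q) / 2)"
    using R by (simp add: power2_eq_square field_simps)
  finally show ?thesis .
qed

text \<open>A substitute for integration: q is controlled by c at right endpoints, C dominates c at
  left endpoints. Over n equal steps the mismatch telescopes to (T / n) (c T - c 0), which tends to
  0.\<close>

lemma increment_le:
  fixes q c C :: "real \<Rightarrow> real"
  assumes inc: "\<And>a b. 0 \<le> a \<Longrightarrow> a \<le> b \<Longrightarrow> q b - q a \<le> (b - a) * c b"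
    and C: "\<And>a b. 0 \<le> a \<Longrightarrow> a \<le> b \<Longrightarrow> (b - a) * c a \<le> C b - C a"
    and T: "T \<ge> 0"
  shows "q T - q 0 \<le> C T - C 0"
proof -
  define D where "D = (\<lambda>s. q s - C s)"
  have step: "D T - D 0 \<le> (T / real n) * (c T - c 0)" if n: "n > 0" for n
  proof -
    define s where "s = (\<lambda>k::nat. T * real k / real n)"
    have "D (s (Suc k)) - D (s k) \<le> T / real n * (c (s (Suc k)) - c (s k))" for k
    proof -
      have s: "0 \<le> s k" "s k \<le> s (Suc k)" and d: "s (Suc k) - s k = T / real n"
        using T n by (auto simp: s_def field_simps)
      show ?thesis using inc[OF s] C[OF s] unfolding d by (simp add: D_def right_diff_distrib)
    qed
    then have "(\<Sum>k<n. D (s (Suc k)) - D (s k)) \<le> (\<Sum>k<n. T / real n * (c (s (Suc k)) - c (s k)))"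
      by (intro sum_mono)
    then have "D (s n) - D (s 0) \<le> T / real n * (c (s n) - c (s 0))"
      by (simp only: sum_distrib_left[symmetric] sum_lessThan_telescope[of "\<lambda>k. D (s k)"]
          sum_lessThan_telescope[of "\<lambda>k. c (s k)"])
    then show ?thesis using n by (simp add: s_def)
  qed
  have "(\<lambda>n. (T / real (Suc n)) * (c T - c 0)) \<longlonglongrightarrow> 0 * (c T - c 0)"
    by (intro tendsto_mult tendsto_const LIMSEQ_Suc[OF lim_const_over_n])
  then have "D T - D 0 \<le> 0 * (c T - c 0)"
    by (rule LIMSEQ_le_const) (use step in blast)
  then show ?thesis by (simp add: D_def)
qed

text \<open>A Gronwall argument for the implicit trapezoidal rule. With x = T R / (2 n), one of n
  steps multiplies f by at most (1 + x) / (1 - x) <= exp (2 x / (1 - x)); the n-th power is exp (T R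
  / (1 - x)), and x tends to 0.\<close>

lemma exp_growth_bound:
  fixes f :: "real \<Rightarrow> real"
  assumes inc: "\<And>a b. 0 \<le> a \<Longrightarrow> a \<le> b \<Longrightarrow> f b - f a \<le> (b - a) * R * ((f a + f b) / 2)"
    and f0: "\<And>s. f s \<ge> 0" and R: "R > 0" and T: "T \<ge> 0"
  shows "f T \<le> f 0 * exp (T * R)"
proof -
  define x where "x = (\<lambda>n. T * R / (2 * real n))"
  have step: "f T \<le> f 0 * exp (T * R / (1 - x n))" if n: "real n > T * R" for n
  proof -
    have n0: "real n > 0" using n T R by (smt (verit) mult_nonneg_nonneg)
    have x: "0 \<le> x n" "x n < 1" using n n0 T R by (auto simp: x_def field_simps)
    have *: "f (T * real k / real n) \<le> f 0 * exp (2 * x n / (1 - x n)) ^ k" for k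
    proof (induction k)
      case (Suc k)
      let ?a = "T * real k / real n" and ?b = "T * real (Suc k) / real n"
      have ab: "0 \<le> ?a" "?a \<le> ?b" and d: "(?b - ?a) * R = 2 * x n"
        using T n0 by (auto simp: field_simps x_def)
      have "f ?b - f ?a \<le> x n * (f ?a + f ?b)" using inc[OF ab] unfolding d by simp
      then have "f ?b * (1 - x n) \<le> f ?a * (1 + x n)" by (simp add: algebra_simps)
      then have "f ?b \<le> f ?a * ((1 + x n) / (1 - x n))" using x by (simp add: field_simps)
      also have "(1 + x n) / (1 - x n) = 1 + 2 * x n / (1 - x n)" using x by (simp add: field_simps)
      also have "f ?a * \<dots> \<le> f ?a * exp (2 * x n / (1 - x n))"
        by (intro mult_left_mono exp_ge_add_one_self f0)
      also have "\<dots> \<le> (f 0 * exp (2 * x n / (1 - x n)) ^ k) * exp (2 * x n / (1 - x n))"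
        by (intro mult_right_mono Suc.IH) auto
      finally show ?case by (simp add: mult_ac)
    qed simp
    have "real n * (2 * x n / (1 - x n)) = T * R / (1 - x n)" using n0 by (simp add: x_def)
    then have "exp (2 * x n / (1 - x n)) ^ n = exp (T * R / (1 - x n))"
      by (simp only: exp_of_nat_mult[symmetric])
    then show ?thesis using *[of n] n0 by simp
  qed
  have "x \<longlonglongrightarrow> 0"
    unfolding x_def using lim_const_over_n[of "T * R / 2"] by simp
  then have "(\<lambda>n. f 0 * exp (T * R / (1 - x n))) \<longlonglongrightarrow> f 0 * exp (T * R / (1 - 0))"
    by (intro tendsto_intros) auto
  moreover have "\<exists>k. \<forall>n\<ge>k. f T \<le> f 0 * exp (T * R / (1 - x n))"
  proof -
    obtain k :: nat where k: "T * R < real k" using reals_Archimedean2 by blast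
    have "f T \<le> f 0 * exp (T * R / (1 - x n))" if "n \<ge> k" for n
      using k that by (intro step) linarith
    then show ?thesis by blast
  qed
  ultimately have "f T \<le> f 0 * exp (T * R / (1 - 0))"
    by (rule LIMSEQ_le_const)
  then show ?thesis by simp
qed

lemma exp_convex_step:
  fixes a b R :: real
  assumes "R > 0" "a \<le> b"
  shows "(b - a) * R * exp (a * R) \<le> exp (b * R) - exp (a * R)"
proof -
  have "exp (a * R) * (1 + (b - a) * R) \<le> exp (a * R) * exp ((b - a) * R)"
    by (intro mult_left_mono exp_ge_add_one_self) auto
  then show ?thesis by (simp add: exp_add[symmetric] algebra_simps)
qed

text \<open>Here \<open>f\<close>, \<open>q\<close> and \<open>G\<close> stand for the
  second-derivative bound, the first derivative and the value of s |-> tr exp (M + s X). The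
  exponential growth of \<open>f\<close> is integrated twice with
  \<open>increment_le\<close>.\<close>

lemma trexp_bennett:
  fixes M X :: "real^'n^'n"
  assumes M: "sym_mat M" and X: "sym_mat X" and T: "T \<ge> 0"
    and R: "R > 0" and XR: "\<And>v. norm (X *v v) \<le> R * norm v"
  shows "trexp (M + T *\<^sub>R X) (mat 1)
     \<le> trexp M (mat 1) + T * trexp M X + (exp (T * R) - 1 - T * R) / R\<^sup>2 * trexp M (X ** X)"
proof -
  define N where "N = (\<lambda>s. M + s *\<^sub>R X)"
  define f where "f = (\<lambda>s. trexp (N s) (X ** X))"
  define q where "q = (\<lambda>s. trexp (N s) X)"
  define G where "G = (\<lambda>s. trexp (N s) (mat 1))"
  have N: "sym_mat (N s)" for s unfolding N_def by (intro sym_mat_add sym_mat_scaleR M X)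
  have Nb: "N b = N a + (b - a) *\<^sub>R X" for a b by (simp add: N_def algebra_simps)
  have f0: "f s \<ge> 0" for s unfolding f_def by (rule trexp_square_nonneg[OF X])
  have f: "f s \<le> f 0 * exp (s * R)" if "s \<ge> 0" for s
  proof (rule exp_growth_bound[OF _ f0 R that])
    fix a b :: real assume "0 \<le> a" "a \<le> b"
    then show "f b - f a \<le> (b - a) * R * ((f a + f b) / 2)"
      using trexp_square_slope_le[OF N[of a] X _ R XR, of "b - a"] by (simp add: f_def Nb[of b a])
  qed
  have q: "q s \<le> q 0 + f 0 * (exp (s * R) - 1) / R" if s: "s \<ge> 0" for s
  proof -
    have "q s - q 0 \<le> f 0 * exp (s * R) / R - f 0 * exp (0 * R) / R"
    proof (rule increment_le[where c = "\<lambda>s. f 0 * exp (s * R)", OF _ _ s])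
      fix a b :: real assume ab: "0 \<le> a" "a \<le> b"
      have "q b - q a \<le> (b - a) * ((f a + f b) / 2)"
        using trexp_slope_le[OF N[of a] X, of "b - a"] ab by (simp add: f_def q_def Nb[of b a])
      also have "\<dots> \<le> (b - a) * (f 0 * exp (b * R))"
      proof (rule mult_left_mono)
        have "f a \<le> f 0 * exp (a * R)" using f ab by auto
        also have "\<dots> \<le> f 0 * exp (b * R)" using ab R f0 by (intro mult_left_mono) auto
        finally show "(f a + f b) / 2 \<le> f 0 * exp (b * R)" using f[of b] ab by simp
      qed (use ab in simp)
      finally show "q b - q a \<le> (b - a) * (f 0 * exp (b * R))" .
      have "f 0 * ((b - a) * R * exp (a * R)) \<le> f 0 * (exp (b * R) - exp (a * R))"
        using exp_convex_step[OF R ab(2)] f0 by (intro mult_left_mono) auto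
      then show "(b - a) * (f 0 * exp (a * R)) \<le> f 0 * exp (b * R) / R - f 0 * exp (a * R) / R"
        using R by (simp add: field_simps)
    qed
    then show ?thesis by (simp add: right_diff_distrib diff_divide_distrib)
  qed
  define C where "C = (\<lambda>s. q 0 * s + f 0 * (exp (s * R) - 1 - s * R) / R\<^sup>2)"
  have "G T - G 0 \<le> C T - C 0"
  proof (rule increment_le[where c = "\<lambda>s. q 0 + f 0 * (exp (s * R) - 1) / R", OF _ _ T])
    fix a b :: real assume ab: "0 \<le> a" "a \<le> b"
    \<comment> \<open>Klein's inequality is taken with its tangent at the right endpoint b, since
      \<open>increment_le\<close> asks for a bound by the slope there.\<close>
    have "N a - N b = (a - b) *\<^sub>R X" by (simp add: Nb[of b a] algebra_simps)
    then have "G b - G a \<le> (b - a) * q b"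
      using trexp_klein[OF N[of b] N[of a]] by (simp add: G_def q_def trexp_scaleR left_diff_distrib)
    also have "\<dots> \<le> (b - a) * (q 0 + f 0 * (exp (b * R) - 1) / R)"
      using ab q[of b] by (intro mult_left_mono) auto
    finally show "G b - G a \<le> (b - a) * (q 0 + f 0 * (exp (b * R) - 1) / R)" .
    have "f 0 * ((b - a) * R * exp (a * R)) \<le> f 0 * (exp (b * R) - exp (a * R))"
      using exp_convex_step[OF R ab(2)] f0 by (intro mult_left_mono) auto
    then have "f 0 * ((b - a) * R * (exp (a * R) - 1)) / R\<^sup>2
        \<le> f 0 * (exp (b * R) - exp (a * R) - (b - a) * R) / R\<^sup>2"
      by (intro divide_right_mono) (auto simp: algebra_simps)
    moreover have "f 0 * ((b - a) * R * (exp (a * R) - 1)) / R\<^sup>2 = (b - a) * (f 0 * (exp (a * R) - 1) / R)"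
      using R by (simp add: power2_eq_square)
    moreover have "C b - C a = q 0 * (b - a) + f 0 * (exp (b * R) - exp (a * R) - (b - a) * R) / R\<^sup>2"
      by (simp add: C_def right_diff_distrib left_diff_distrib diff_divide_distrib)
    ultimately show "(b - a) * (q 0 + f 0 * (exp (a * R) - 1) / R) \<le> C b - C a"
      by (simp add: distrib_left)
  qed
  then show ?thesis by (simp add: G_def q_def f_def N_def C_def mult_ac)
qed

text \<open>The one-step estimate replacing Lieb's theorem: averaging Bennett's expansion kills the linear
  term, and Klein's inequality puts the remaining linear functional of V back into the exponent.\<close>

lemma trexp_average_le:
  fixes M V :: "real^'n^'n" and X :: "'a \<Rightarrow> real^'n^'n"
  assumes M: "sym_mat M" and V: "sym_mat V" and X: "\<And>a. a \<in> \<Omega> \<Longrightarrow> sym_mat (X a)" and T: "T \<ge> 0"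
    and R: "R > 0" and XR: "\<And>a v. a \<in> \<Omega> \<Longrightarrow> norm (X a *v v) \<le> R * norm v"
    and w: "\<And>a. a \<in> \<Omega> \<Longrightarrow> w a \<ge> 0" "(\<Sum>a\<in>\<Omega>. w a) = 1"
    and mean: "(\<Sum>a\<in>\<Omega>. w a *\<^sub>R X a) = 0"
    and var: "\<And>v. (\<Sum>a\<in>\<Omega>. w a * (norm (X a *v v))\<^sup>2) \<le> v \<bullet> (V *v v)"
  shows "(\<Sum>a\<in>\<Omega>. w a * trexp (M + T *\<^sub>R X a) (mat 1))
      \<le> trexp (M + ((exp (T * R) - 1 - T * R) / R\<^sup>2) *\<^sub>R V) (mat 1)"
proof -
  define g where "g = (exp (T * R) - 1 - T * R) / R\<^sup>2"
  have g: "g \<ge> 0" unfolding g_def using exp_ge_add_one_self[of "T * R"]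
    by (intro divide_nonneg_nonneg) (auto simp: algebra_simps)
  have "(\<Sum>a\<in>\<Omega>. w a * trexp (M + T *\<^sub>R X a) (mat 1))
     \<le> (\<Sum>a\<in>\<Omega>. w a * (trexp M (mat 1) + T * trexp M (X a) + g * trexp M (X a ** X a)))"
    unfolding g_def by (intro sum_mono mult_left_mono trexp_bennett M X T R XR w) auto
  also have "\<dots> = (\<Sum>a\<in>\<Omega>. w a) * trexp M (mat 1) + T * trexp M (\<Sum>a\<in>\<Omega>. w a *\<^sub>R X a)
      + g * trexp M (\<Sum>a\<in>\<Omega>. w a *\<^sub>R (X a ** X a))"
    by (simp add: trexp_sum trexp_scaleR sum_distrib_left sum_distrib_right distrib_left sum.distrib mult_ac)
  also have "\<dots> \<le> trexp M (mat 1) + g * trexp M V"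
  proof -
    have "trexp M (\<Sum>a\<in>\<Omega>. w a *\<^sub>R (X a ** X a)) \<le> trexp M V"
    proof (rule trexp_mono)
      fix v :: "real^'n"
      have "v \<bullet> ((\<Sum>a\<in>\<Omega>. w a *\<^sub>R (X a ** X a)) *v v) = (\<Sum>a\<in>\<Omega>. w a * (norm (X a *v v))\<^sup>2)"
        unfolding matrix_vector_mult_sum_left inner_sum_right
        by (intro sum.cong refl) (simp add: matrix_vector_mult_scaleR_left inner_square[OF X])
      then show "v \<bullet> ((\<Sum>a\<in>\<Omega>. w a *\<^sub>R (X a ** X a)) *v v) \<le> v \<bullet> (V *v v)" using var by simp
    qed
    then show ?thesis using g by (simp add: w(2) mean trexp_0 mult_left_mono)
  qed
  also have "\<dots> \<le> trexp (M + g *\<^sub>R V) (mat 1)"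
    using trexp_klein[OF M sym_mat_add[OF M sym_mat_scaleR[OF V, of g]]] by (simp add: trexp_scaleR)
  finally show ?thesis by (simp add: g_def)
qed

section \<open>Expectation over finitely many independent coordinates\<close>

definition prod_exp :: "nat \<Rightarrow> 'a set \<Rightarrow> (nat \<Rightarrow> 'a \<Rightarrow> real) \<Rightarrow> ((nat \<Rightarrow> 'a) \<Rightarrow> real) \<Rightarrow> real" where
  "prod_exp n \<Omega> w F = (\<Sum>f\<in>PiE {..<n} (\<lambda>_. \<Omega>). (\<Prod>i<n. w i (f i)) * F f)"

lemma prod_exp_0: "prod_exp 0 \<Omega> w F = F (\<lambda>_. undefined)"
  by (simp add: prod_exp_def)

lemma prod_exp_Suc:
  assumes "finite \<Omega>"
  shows "prod_exp (Suc n) \<Omega> w F = prod_exp n \<Omega> w (\<lambda>f. \<Sum>a\<in>\<Omega>. w n a * F (f(n := a)))"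
proof -
  have "prod_exp (Suc n) \<Omega> w F
      = (\<Sum>(a, g)\<in>\<Omega> \<times> PiE {..<n} (\<lambda>_. \<Omega>). (\<Prod>i<Suc n. w i ((g(n := a)) i)) * F (g(n := a)))"
    unfolding prod_exp_def lessThan_Suc PiE_insert_eq
    by (subst sum.reindex[OF inj_combinator]) (simp_all add: case_prod_unfold comp_def)
  also have "\<dots> = (\<Sum>(a, g)\<in>\<Omega> \<times> PiE {..<n} (\<lambda>_. \<Omega>). w n a * (\<Prod>i<n. w i (g i)) * F (g(n := a)))"
  proof (intro sum.cong refl, clarify)
    fix a g assume "g \<in> PiE {..<n} (\<lambda>_. \<Omega>)"
    have "(\<Prod>i<n. w i ((g(n := a)) i)) = (\<Prod>i<n. w i (g i))" by (intro prod.cong) auto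
    then show "(\<Prod>i<Suc n. w i ((g(n := a)) i)) * F (g(n := a)) = w n a * (\<Prod>i<n. w i (g i)) * F (g(n := a))"
      by simp
  qed
  also have "\<dots> = (\<Sum>a\<in>\<Omega>. \<Sum>g\<in>PiE {..<n} (\<lambda>_. \<Omega>). w n a * (\<Prod>i<n. w i (g i)) * F (g(n := a)))"
    by (rule sum.cartesian_product[symmetric])
  also have "\<dots> = prod_exp n \<Omega> w (\<lambda>f. \<Sum>a\<in>\<Omega>. w n a * F (f(n := a)))"
    unfolding prod_exp_def by (subst sum.swap) (simp add: sum_distrib_left mult_ac)
  finally show ?thesis .
qed

lemma prod_exp_mono:
  assumes "\<And>i a. i < n \<Longrightarrow> a \<in> \<Omega> \<Longrightarrow> w i a \<ge> 0"
    and "\<And>f. f \<in> PiE {..<n} (\<lambda>_. \<Omega>) \<Longrightarrow> F f \<le> G f"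
  shows "prod_exp n \<Omega> w F \<le> prod_exp n \<Omega> w G"
  unfolding prod_exp_def using assms
  by (intro sum_mono mult_left_mono prod_nonneg) (auto dest: PiE_mem)

lemma prod_exp_add: "prod_exp n \<Omega> w (\<lambda>f. F f + G f) = prod_exp n \<Omega> w F + prod_exp n \<Omega> w G"
  by (simp add: prod_exp_def distrib_left sum.distrib)

lemma prod_exp_cmult: "prod_exp n \<Omega> w (\<lambda>f. c * F f) = c * prod_exp n \<Omega> w F"
  by (simp add: prod_exp_def sum_distrib_left mult_ac)

lemma prod_exp_sum: "prod_exp n \<Omega> w (\<lambda>f. \<Sum>k\<in>K. F k f) = (\<Sum>k\<in>K. prod_exp n \<Omega> w (F k))"
  unfolding prod_exp_def sum_distrib_left by (rule sum.swap)

lemma prod_exp_const: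
  assumes "finite \<Omega>" "\<And>i. i < n \<Longrightarrow> (\<Sum>a\<in>\<Omega>. w i a) = 1"
  shows "prod_exp n \<Omega> w (\<lambda>_. c) = c"
  using assms(2)
proof (induction n)
  case (Suc n)
  have "(\<Sum>a\<in>\<Omega>. w n a * c) = c" using Suc.prems[of n] by (simp add: sum_distrib_right[symmetric])
  then show ?case using Suc by (simp add: prod_exp_Suc[OF assms(1)])
qed (simp add: prod_exp_0)

lemma prod_exp_marginal:
  assumes "finite \<Omega>" "\<And>i. i < n \<Longrightarrow> (\<Sum>a\<in>\<Omega>. w i a) = 1" "i < n"
  shows "prod_exp n \<Omega> w (\<lambda>f. F (f i)) = (\<Sum>a\<in>\<Omega>. w i a * F a)"
  using assms(2,3)
proof (induction n)
  case (Suc n)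
  show ?case
  proof (cases "i = n")
    case True
    then show ?thesis using Suc.prems
      by (simp add: prod_exp_Suc[OF assms(1)]  prod_exp_const[OF assms(1)])
  next
    case False
    then have "(\<Sum>a\<in>\<Omega>. w n a * F ((f(n := a)) i)) = F (f i)" for f :: "nat \<Rightarrow> 'a"
      using Suc.prems(1)[of n] by (simp add: sum_distrib_right[symmetric])
    then show ?thesis using Suc False by (simp add: prod_exp_Suc[OF assms(1)])
  qed
qed simp

section \<open>Matrix Bernstein inequality\<close>

text \<open>A Rayleigh quotient above t forces an eigenvalue above t, and tr exp dominates its
  exponential. This is the pointwise half of the Laplace transform method.\<close>

lemma trexp_1_ge:
  fixes N :: "real^'n^'n"
  assumes N: "sym_mat N" and v: "v \<bullet> (N *v v) > t * (norm v)\<^sup>2"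
  shows "exp t \<le> trexp N (mat 1)"
proof -
  note o = onb_eig_vec[OF N]
  have "\<exists>i. eig_val N i > t"
  proof (rule ccontr)
    assume "\<not> ?thesis"
    then have le: "eig_val N i \<le> t" for i by (simp add: not_less)
    have "v \<bullet> (N *v v) = (\<Sum>i\<in>UNIV. (eig_vec N i \<bullet> v) * (eig_vec N i \<bullet> (N *v v)))"
      by (rule onb_parseval[OF o, symmetric])
    also have "\<dots> = (\<Sum>i\<in>UNIV. eig_val N i * (eig_vec N i \<bullet> v)\<^sup>2)"
      by (simp add: sym_mat_inner[OF N] mult_eig_vec[OF N] power2_eq_square mult_ac)
    also have "\<dots> \<le> (\<Sum>i\<in>UNIV. t * (eig_vec N i \<bullet> v)\<^sup>2)"
      using le by (intro sum_mono mult_right_mono) auto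
    also have "\<dots> = t * (norm v)\<^sup>2" by (simp add: sum_distrib_left[symmetric] onb_norm_sq[OF o])
    finally show False using v by simp
  qed
  then obtain i where "t < eig_val N i" ..
  then have "exp t \<le> exp (eig_val N i)" by simp
  also have "\<dots> \<le> (\<Sum>i\<in>UNIV. exp (eig_val N i))" by (rule member_le_sum) auto
  finally show ?thesis by (simp add: trexp_1[OF N])
qed

lemma trexp_1_le:
  fixes N :: "real^'n^'n"
  assumes N: "sym_mat N" and q: "\<And>v. v \<bullet> (N *v v) \<le> s * (norm v)\<^sup>2"
  shows "trexp N (mat 1) \<le> real CARD('n) * exp s"
proof -
  have "eig_val N i \<le> s" for i
    using q[of "eig_vec N i"] norm_onb[OF onb_eig_vec[OF N], of i] by (simp add: eig_val_def)
  then have "(\<Sum>i\<in>UNIV. exp (eig_val N i)) \<le> (\<Sum>i\<in>(UNIV :: 'n set). exp s)" by (intro sum_mono) simp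
  then show ?thesis by (simp add: trexp_1[OF N])
qed

text \<open>Turns Bennett's exponent into Bernstein's denominator s + R t / 3. After clearing the
  denominator, the derivative of the difference is \<open>?h\<close> / 3, and \<open>?h\<close> is
  increasing from 0.\<close>

lemma exp_remainder_le:
  fixes x :: real
  assumes "0 \<le> x" "x < 3"
  shows "exp x - 1 - x \<le> x\<^sup>2 / 2 / (1 - x / 3)"
proof -
  let ?h = "\<lambda>x::real. x + 2 + (x - 2) * exp x"
  let ?F = "\<lambda>x::real. x\<^sup>2 / 2 - (1 - x / 3) * (exp x - 1 - x)"
  have h: "?h y \<ge> 0" if "y \<ge> 0" for y
  proof -
    have "?h 0 \<le> ?h y"
    proof (rule DERIV_nonneg_imp_nondecreasing[OF that])
      fix z :: real
      have "1 - z \<le> exp (- z)" using exp_ge_add_one_self[of "- z"] by simp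
      then have "(1 - z) * exp z \<le> 1" by (simp add: exp_minus field_simps)
      then show "\<exists>y. DERIV ?h z :> y \<and> y \<ge> 0"
        by (intro exI[of _ "1 + (z - 1) * exp z"] conjI)
           (auto intro!: derivative_eq_intros simp: algebra_simps)
    qed
    then show ?thesis by simp
  qed
  have "?F 0 \<le> ?F x"
  proof (rule DERIV_nonneg_imp_nondecreasing[OF assms(1)])
    fix y :: real assume y: "0 \<le> y" "y \<le> x"
    show "\<exists>z. DERIV ?F y :> z \<and> z \<ge> 0"
      by (intro exI[of _ "?h y / 3"] conjI)
         (use h[OF y(1)] in \<open>auto intro!: derivative_eq_intros simp: field_simps\<close>)
  qed
  then have "(1 - x / 3) * (exp x - 1 - x) \<le> x\<^sup>2 / 2" by simp
  moreover have "1 - x / 3 > 0" using assms by simp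
  ultimately show ?thesis by (subst pos_le_divide_eq) (auto simp: mult.commute)
qed

section \<open>Spectral norm and quadratic forms\<close>

lemma spec_norm_le:
  assumes "sym_mat A" and "\<And>v. \<bar>v \<bullet> (A *v v)\<bar> \<le> t * (norm v)\<^sup>2"
  shows "spec_norm A \<le> t"
  unfolding spec_norm_def by (intro onorm_le sym_mat_norm_le assms)

lemma norm_mult_le_spec_norm: "norm (A *v v) \<le> spec_norm A * norm v"
  unfolding spec_norm_def by (intro onorm matrix_vector_mul_bounded_linear)

lemma inner_le_spec_norm: "\<bar>v \<bullet> (A *v v)\<bar> \<le> spec_norm A * (norm v)\<^sup>2"
proof -
  have "\<bar>v \<bullet> (A *v v)\<bar> \<le> norm v * norm (A *v v)" by (rule Cauchy_Schwarz_ineq2)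
  also have "\<dots> \<le> norm v * (spec_norm A * norm v)" by (intro mult_left_mono norm_mult_le_spec_norm) auto
  finally show ?thesis by (simp add: power2_eq_square mult_ac)
qed

lemma spec_norm_nonneg: "0 \<le> spec_norm A"
  unfolding spec_norm_def by (intro onorm_pos_le matrix_vector_mul_bounded_linear)

lemma spec_norm_triangle: "spec_norm (A + B) \<le> spec_norm A + spec_norm B"
  unfolding spec_norm_def
  using onorm_triangle[OF matrix_vector_mul_bounded_linear[of A] matrix_vector_mul_bounded_linear[of B]]
  by (simp add: matrix_vector_mult_add_rdistrib[abs_def])

lemma spec_norm_sum: "spec_norm (\<Sum>i\<in>I. A i) \<le> (\<Sum>i\<in>I. spec_norm (A i))"
proof (induction I rule: infinite_finite_induct)
  case (insert i I)
  then show ?case using spec_norm_triangle[of "A i" "\<Sum>i\<in>I. A i"] by simp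
qed (simp_all add: spec_norm_def onorm_zero)

text \<open>Second moments enter through upper bounds \<open>V i\<close> as quadratic forms. These
  can be summed before a norm is taken, so the variance parameter is the norm of a sum and not a sum
  of norms.\<close>

locale independent_matrices =
  fixes \<Omega> :: "'a set" and w :: "nat \<Rightarrow> 'a \<Rightarrow> real" and X :: "nat \<Rightarrow> 'a \<Rightarrow> real^'n^'n"
    and V :: "nat \<Rightarrow> real^'n^'n" and n :: nat and R :: real
  assumes fin: "finite \<Omega>"
    and w_nonneg: "\<And>i a. i < n \<Longrightarrow> a \<in> \<Omega> \<Longrightarrow> w i a \<ge> 0"
    and w_sum: "\<And>i. i < n \<Longrightarrow> (\<Sum>a\<in>\<Omega>. w i a) = 1"
    and X_sym: "\<And>i a. i < n \<Longrightarrow> a \<in> \<Omega> \<Longrightarrow> sym_mat (X i a)"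
    and V_sym: "\<And>i. i < n \<Longrightarrow> sym_mat (V i)"
    and R_pos: "R > 0"
    and X_bound: "\<And>i a v. i < n \<Longrightarrow> a \<in> \<Omega> \<Longrightarrow> norm (X i a *v v) \<le> R * norm v"
    and X_mean: "\<And>i. i < n \<Longrightarrow> (\<Sum>a\<in>\<Omega>. w i a *\<^sub>R X i a) = 0"
    and X_var: "\<And>i v. i < n \<Longrightarrow> (\<Sum>a\<in>\<Omega>. w i a * (norm (X i a *v v))\<^sup>2) \<le> v \<bullet> (V i *v v)"
begin

text \<open>M is arbitrary because each step of the induction moves one summand out of the random
  part and into the deterministic exponent.\<close>

lemma trexp_sum_le:
  assumes M: "sym_mat M" and T: "T \<ge> 0"
  shows "k \<le> n \<Longrightarrow> prod_exp k \<Omega> w (\<lambda>f. trexp (M + T *\<^sub>R (\<Sum>i<k. X i (f i))) (mat 1))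
     \<le> trexp (M + ((exp (T * R) - 1 - T * R) / R\<^sup>2) *\<^sub>R (\<Sum>i<k. V i)) (mat 1)"
  using M
proof (induction k arbitrary: M)
  case 0
  then show ?case by (simp add: prod_exp_0)
next
  case (Suc k)
  let ?g = "(exp (T * R) - 1 - T * R) / R\<^sup>2"
  have k: "k < n" using Suc.prems by simp
  have "prod_exp (Suc k) \<Omega> w (\<lambda>f. trexp (M + T *\<^sub>R (\<Sum>i<Suc k. X i (f i))) (mat 1))
    = prod_exp k \<Omega> w (\<lambda>f. \<Sum>a\<in>\<Omega>. w k a * trexp ((M + T *\<^sub>R (\<Sum>i<k. X i (f i))) + T *\<^sub>R X k a) (mat 1))"
  proof -
    have "(\<Sum>i<Suc k. X i ((f(k := a)) i)) = (\<Sum>i<k. X i (f i)) + X k a" for f :: "nat \<Rightarrow> 'a" and a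
      by simp
    then show ?thesis by (simp only: prod_exp_Suc[OF fin] scaleR_add_right add.assoc)
  qed
  also have "\<dots> \<le> prod_exp k \<Omega> w (\<lambda>f. trexp ((M + T *\<^sub>R (\<Sum>i<k. X i (f i))) + ?g *\<^sub>R V k) (mat 1))"
  proof (rule prod_exp_mono)
    fix f assume f: "f \<in> PiE {..<k} (\<lambda>_. \<Omega>)"
    have "sym_mat (M + T *\<^sub>R (\<Sum>i<k. X i (f i)))"
      using k f by (intro sym_mat_add sym_mat_scaleR sym_mat_sum X_sym Suc.prems) (auto dest: PiE_mem)
    then show "(\<Sum>a\<in>\<Omega>. w k a * trexp ((M + T *\<^sub>R (\<Sum>i<k. X i (f i))) + T *\<^sub>R X k a) (mat 1))
        \<le> trexp ((M + T *\<^sub>R (\<Sum>i<k. X i (f i))) + ?g *\<^sub>R V k) (mat 1)"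
      by (rule trexp_average_le[OF _ V_sym X_sym T R_pos X_bound w_nonneg w_sum X_mean X_var]) (use k in auto)
  qed (use k w_nonneg in auto)
  also have "\<dots> = prod_exp k \<Omega> w (\<lambda>f. trexp ((M + ?g *\<^sub>R V k) + T *\<^sub>R (\<Sum>i<k. X i (f i))) (mat 1))"
    by (simp add: add_ac)
  also have "\<dots> \<le> trexp ((M + ?g *\<^sub>R V k) + ?g *\<^sub>R (\<Sum>i<k. V i)) (mat 1)"
    using Suc k by (intro Suc.IH sym_mat_add sym_mat_scaleR V_sym) auto
  finally show ?case by (simp add: scaleR_add_right add_ac)
qed

lemma upper_tail:
  assumes s: "s > 0" "\<And>v. v \<bullet> ((\<Sum>i<n. V i) *v v) \<le> s * (norm v)\<^sup>2"
    and t: "t > 0"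
  shows "prod_exp n \<Omega> w (\<lambda>f. of_bool (\<exists>v. v \<bullet> ((\<Sum>i<n. X i (f i)) *v v) > t * (norm v)\<^sup>2))
    \<le> real CARD('n) * exp (- (t\<^sup>2 / 2) / (s + R * t / 3))"
proof -
  define D where "D = s + R * t / 3"
  \<comment> \<open>This choice gives 1 - T R / 3 = s / D, hence g s <= T^2 D / 2, and the exponent
    T^2 D / 2 - T t equals -t^2 / (2 D).\<close>
  define T where "T = t / D"
  define g where "g = (exp (T * R) - 1 - T * R) / R\<^sup>2"
  have D: "D > 0" using s(1) t R_pos by (simp add: D_def add_pos_pos)
  have T: "T > 0" using t D by (simp add: T_def)
  have TR: "1 - T * R / 3 = s / D" using D by (simp add: T_def D_def field_simps)
  then have TR3: "T * R < 3" using divide_pos_pos[OF s(1) D] by simp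
  have "exp (T * R) - 1 - T * R \<le> (T * R)\<^sup>2 / 2 / (s / D)"
    using exp_remainder_le[of "T * R"] T R_pos TR3 by (simp add: TR)
  then have "g \<le> (T * R)\<^sup>2 / 2 / (s / D) / R\<^sup>2" unfolding g_def by (rule divide_right_mono) auto
  also have "\<dots> = T\<^sup>2 / 2 * D / s" using R_pos by (simp add: power_mult_distrib)
  finally have gs: "g * s \<le> T\<^sup>2 / 2 * D" using s(1) by (simp add: field_simps)
  have g: "g \<ge> 0" unfolding g_def using exp_ge_add_one_self[of "T * R"]
    by (intro divide_nonneg_nonneg) (auto simp: algebra_simps)
  let ?S = "\<lambda>f. \<Sum>i<n. X i (f i)"
  have "prod_exp n \<Omega> w (\<lambda>f. of_bool (\<exists>v. v \<bullet> (?S f *v v) > t * (norm v)\<^sup>2))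
     \<le> prod_exp n \<Omega> w (\<lambda>f. exp (- (T * t)) * trexp (T *\<^sub>R ?S f) (mat 1))"
  proof (rule prod_exp_mono[OF w_nonneg])
    fix f assume "f \<in> PiE {..<n} (\<lambda>_. \<Omega>)"
    then have N: "sym_mat (T *\<^sub>R ?S f)" by (intro sym_mat_scaleR sym_mat_sum X_sym) (auto dest: PiE_mem)
    show "of_bool (\<exists>v. v \<bullet> (?S f *v v) > t * (norm v)\<^sup>2) \<le> exp (- (T * t)) * trexp (T *\<^sub>R ?S f) (mat 1)"
    proof (cases "\<exists>v. v \<bullet> (?S f *v v) > t * (norm v)\<^sup>2")
      case True
      then obtain v where v: "v \<bullet> (?S f *v v) > t * (norm v)\<^sup>2" ..
      then have "T * (t * (norm v)\<^sup>2) < T * (v \<bullet> (?S f *v v))" using T by (rule mult_strict_left_mono)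
      then have "(T * t) * (norm v)\<^sup>2 < v \<bullet> ((T *\<^sub>R ?S f) *v v)"
        by (simp add: matrix_vector_mult_scaleR_left mult.assoc)
      then have "exp (T * t) \<le> trexp (T *\<^sub>R ?S f) (mat 1)" by (rule trexp_1_ge[OF N])
      then have "exp (- (T * t)) * exp (T * t) \<le> exp (- (T * t)) * trexp (T *\<^sub>R ?S f) (mat 1)"
        by (intro mult_left_mono) auto
      then show ?thesis using True by (simp add: exp_add[symmetric])
    qed (simp add: trexp_1[OF N] sum_nonneg)
  qed
  also have "\<dots> = exp (- (T * t)) * prod_exp n \<Omega> w (\<lambda>f. trexp (0 + T *\<^sub>R ?S f) (mat 1))"
    by (simp add: prod_exp_cmult)
  also have "\<dots> \<le> exp (- (T * t)) * trexp (0 + g *\<^sub>R (\<Sum>i<n. V i)) (mat 1)"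
    unfolding g_def using T by (intro mult_left_mono trexp_sum_le sym_mat_0) auto
  also have "\<dots> \<le> exp (- (T * t)) * (real CARD('n) * exp (g * s))"
  proof (intro mult_left_mono trexp_1_le)
    show "sym_mat (0 + g *\<^sub>R (\<Sum>i<n. V i))"
      by (auto intro!: sym_mat_scaleR sym_mat_sum V_sym)
    show "v \<bullet> ((0 + g *\<^sub>R (\<Sum>i<n. V i)) *v v) \<le> g * s * (norm v)\<^sup>2" for v
      using mult_left_mono[OF s(2)[of v] g] by (simp add: matrix_vector_mult_scaleR_left mult.assoc)
  qed auto
  also have "\<dots> = real CARD('n) * exp (g * s - T * t)" by (simp add: exp_diff exp_minus field_simps)
  also have "g * s - T * t \<le> T\<^sup>2 / 2 * D - T * t" using gs by simp
  also have "T\<^sup>2 / 2 * D - T * t = - (t\<^sup>2 / 2) / D" using D by (simp add: T_def power2_eq_square field_simps)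
  finally show ?thesis by (simp add: D_def)
qed

end

theorem matrix_bernstein:
  fixes X :: "nat \<Rightarrow> 'a \<Rightarrow> real^'n^'n"
  assumes ind: "independent_matrices \<Omega> w X V n R"
    and s: "s > 0" "\<And>v. v \<bullet> ((\<Sum>i<n. V i) *v v) \<le> s * (norm v)\<^sup>2"
    and L: "L > 0"
  shows "prod_exp n \<Omega> w (\<lambda>f. of_bool (spec_norm (\<Sum>i<n. X i (f i)) > 2 * R * L / 3 + sqrt (2 * s * L)))
    \<le> 2 * real CARD('n) * exp (- L)"
proof -
  interpret independent_matrices \<Omega> w X V n R by (rule ind)
  interpret neg: independent_matrices \<Omega> w "\<lambda>i a. - X i a" V n R
  proof
    show "sym_mat (- X i a)" if "i < n" "a \<in> \<Omega>" for i a
      using sym_mat_scaleR[OF X_sym[OF that], of "-1"] by simp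
    have *: "(- X i a) *v v = - (X i a *v v)" for i a v
      using matrix_vector_mult_scaleR_left[of "-1" "X i a" v] by simp
    show "norm ((- X i a) *v v) \<le> R * norm v" if "i < n" "a \<in> \<Omega>" for i a v
      using X_bound[OF that] by (simp add: *)
    show "(\<Sum>a\<in>\<Omega>. w i a * (norm ((- X i a) *v v))\<^sup>2) \<le> v \<bullet> (V i *v v)" if "i < n" for i v
      using X_var[OF that] by (simp add: *)
    show "(\<Sum>a\<in>\<Omega>. w i a *\<^sub>R - X i a) = 0" if "i < n" for i
      using X_mean[OF that] by (simp add: sum_negf)
  qed (use fin w_nonneg w_sum V_sym R_pos in auto)
  define t where "t = 2 * R * L / 3 + sqrt (2 * s * L)"
  let ?S = "\<lambda>f. \<Sum>i<n. X i (f i)"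
  have sL: "2 * s * L > 0" using s L by simp
  then have t: "t > 0" using R_pos L by (simp add: t_def add_pos_pos)
  have D: "s + R * t / 3 > 0" using s t R_pos by (simp add: add_pos_pos)
  have "t\<^sup>2 = (2 * R * L / 3) * t + sqrt (2 * s * L) * (2 * R * L / 3) + (sqrt (2 * s * L))\<^sup>2"
    by (simp add: t_def power2_eq_square algebra_simps)
  also have "(sqrt (2 * s * L))\<^sup>2 = 2 * s * L" using sL by simp
  \<comment> \<open>Writing t = a + b with a = 2 R L / 3 and b^2 = 2 s L, the expansion is t^2 = a t
    + a b + b^2; dropping a b >= 0 leaves what the tail exponent needs to be at most -L.\<close>
  finally have "2 * L * (s + R * t / 3) \<le> t\<^sup>2" using sL R_pos L by (simp add: algebra_simps)
  then have E: "- (t\<^sup>2 / 2) / (s + R * t / 3) \<le> - L" using D by (simp add: field_simps)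
  have tail: "real CARD('n) * exp (- (t\<^sup>2 / 2) / (s + R * t / 3)) \<le> real CARD('n) * exp (- L)"
    using E by (intro mult_left_mono) auto
  have neg_sum: "(\<Sum>i<n. - X i (f i)) *v v = - (?S f *v v)" for f v
    using matrix_vector_mult_scaleR_left[of "-1" "?S f" v] by (simp add: sum_negf)
  have "prod_exp n \<Omega> w (\<lambda>f. of_bool (spec_norm (?S f) > t))
    \<le> prod_exp n \<Omega> w (\<lambda>f. of_bool (\<exists>v. v \<bullet> (?S f *v v) > t * (norm v)\<^sup>2)
        + of_bool (\<exists>v. v \<bullet> ((\<Sum>i<n. - X i (f i)) *v v) > t * (norm v)\<^sup>2))"
  proof (rule prod_exp_mono[OF w_nonneg])
    fix f assume f: "f \<in> PiE {..<n} (\<lambda>_. \<Omega>)"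
    have N: "sym_mat (?S f)" using f by (intro sym_mat_sum X_sym) (auto dest: PiE_mem)
    have "\<exists>v. \<bar>v \<bullet> (?S f *v v)\<bar> > t * (norm v)\<^sup>2" if "spec_norm (?S f) > t"
      using spec_norm_le[OF N, of t] that by (meson not_le)
    then show "of_bool (spec_norm (?S f) > t) \<le> (of_bool (\<exists>v. v \<bullet> (?S f *v v) > t * (norm v)\<^sup>2)
        + of_bool (\<exists>v. v \<bullet> ((\<Sum>i<n. - X i (f i)) *v v) > t * (norm v)\<^sup>2) :: real)"
      unfolding neg_sum by (auto simp: abs_if split: if_splits)
  qed
  also have "\<dots> \<le> real CARD('n) * exp (- L) + real CARD('n) * exp (- L)"
    unfolding prod_exp_add
    by (intro add_mono order_trans[OF upper_tail[OF s t] tail] order_trans[OF neg.upper_tail[OF s t] tail])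
  finally show ?thesis by (simp add: t_def)
qed

section \<open>Moments of multinomial counts\<close>

definition cnt :: "nat \<Rightarrow> (nat \<Rightarrow> 'd) \<Rightarrow> 'd \<Rightarrow> real" where
  "cnt m f k = (\<Sum>j<m. of_bool (f j = k))"

text \<open>The matrix of one column depends on its m draws only through how often each index
  occurs, so expectations are set up for functions of the counts.\<close>

definition mult_exp :: "('d::finite \<Rightarrow> real) \<Rightarrow> nat \<Rightarrow> (('d \<Rightarrow> real) \<Rightarrow> real) \<Rightarrow> real" where
  "mult_exp p m G = prod_exp m UNIV (\<lambda>_. p) (\<lambda>f. G (cnt m f))"

definition lin :: "('d::finite \<Rightarrow> real) \<Rightarrow> ('d \<Rightarrow> real) \<Rightarrow> real" where
  "lin g c = (\<Sum>l\<in>UNIV. g l * c l)"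

lemma norm_sq_cart: "(norm z)\<^sup>2 = (\<Sum>k\<in>UNIV. (z $ k)\<^sup>2)" for z :: "real^'d::finite"
  unfolding power2_norm_eq_inner inner_vec_def by (simp add: power2_eq_square)

lemma cnt_nonneg: "0 \<le> cnt m f k"
  by (simp add: cnt_def sum_nonneg)

lemma cnt_le: "cnt m f k \<le> real m"
proof -
  have "cnt m f k \<le> (\<Sum>j<m. 1)" unfolding cnt_def by (intro sum_mono) auto
  then show ?thesis by simp
qed

lemma sum_cnt: "(\<Sum>k\<in>UNIV. cnt m f (k :: 'd::finite)) = real m"
  unfolding cnt_def by (subst sum.swap) (simp add: of_bool_def)

lemma mult_exp_0: "mult_exp p 0 G = G (\<lambda>_. 0)"
  by (simp add: mult_exp_def prod_exp_0 cnt_def[abs_def])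

lemma mult_exp_Suc:
  "mult_exp p (Suc m) G = mult_exp p m (\<lambda>c. \<Sum>k\<in>UNIV. p k * G (c(k := c k + 1)))"
proof -
  have "cnt (Suc m) (f(m := k)) = (cnt m f)(k := cnt m f k + 1)" for f and k :: 'a
    by (auto simp: cnt_def fun_eq_iff)
  then show ?thesis by (simp add: mult_exp_def prod_exp_Suc)
qed

lemma mult_exp_add: "mult_exp p m (\<lambda>c. F c + G c) = mult_exp p m F + mult_exp p m G"
  by (simp add: mult_exp_def prod_exp_add)

lemma mult_exp_cmult: "mult_exp p m (\<lambda>c. a * F c) = a * mult_exp p m F"
  by (simp add: mult_exp_def prod_exp_cmult)

lemma mult_exp_sum: "mult_exp p m (\<lambda>c. \<Sum>k\<in>K. F k c) = (\<Sum>k\<in>K. mult_exp p m (F k))"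
  by (simp add: mult_exp_def prod_exp_sum)

text \<open>Size biasing: weighting by the count of k amounts to fixing one of the draws to be k.\<close>

lemma mult_exp_size_bias:
  "mult_exp p m (\<lambda>c. c k * G c) = real m * p k * mult_exp p (m - 1) (\<lambda>c. G (c(k := c k + 1)))"
proof (induction m arbitrary: G)
  case 0
  then show ?case by (simp add: mult_exp_0)
next
  case (Suc m)
  note IH = Suc.IH
  let ?H = "\<lambda>c. \<Sum>l\<in>UNIV. p l * G (c(l := c l + 1))"
  have "(\<Sum>l\<in>UNIV. p l * ((c(l := c l + 1)) k * G (c(l := c l + 1))))
      = c k * ?H c + p k * G (c(k := c k + 1))" for c
  proof -
    have "(\<Sum>l\<in>UNIV. p l * ((c(l := c l + 1)) k * G (c(l := c l + 1))))
        = (\<Sum>l\<in>UNIV. c k * (p l * G (c(l := c l + 1))) + (if l = k then p k * G (c(k := c k + 1)) else 0))"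
      by (intro sum.cong) (auto simp: algebra_simps)
    also have "\<dots> = c k * ?H c + p k * G (c(k := c k + 1))"
      by (simp add: sum.distrib sum_distrib_left)
    finally show ?thesis .
  qed
  then have "mult_exp p (Suc m) (\<lambda>c. c k * G c)
      = mult_exp p m (\<lambda>c. c k * ?H c) + p k * mult_exp p m (\<lambda>c. G (c(k := c k + 1)))"
    by (simp add: mult_exp_Suc mult_exp_add mult_exp_cmult)
  also have "mult_exp p m (\<lambda>c. c k * ?H c) = real m * p k * mult_exp p m (\<lambda>c. G (c(k := c k + 1)))"
  \<comment> \<open>The right-hand side of the induction hypothesis has m - 1 draws with truncated
    subtraction; for m = 0 both sides vanish. Otherwise the increments at k and l commute, and the
    extra draw in \<open>?H\<close> restores m draws.\<close>
  proof (cases m)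
    case (Suc m')
    have "?H (c(k := c k + 1)) = (\<Sum>l\<in>UNIV. p l * G ((c(l := c l + 1))(k := (c(l := c l + 1)) k + 1)))" for c
      by (intro sum.cong refl arg_cong[where f = "\<lambda>x. p _ * G x"]) (auto simp: fun_eq_iff)
    then have H: "mult_exp p (m - 1) (\<lambda>c. ?H (c(k := c k + 1))) = mult_exp p m (\<lambda>c. G (c(k := c k + 1)))"
      by (simp only: Suc mult_exp_Suc diff_Suc_1)
    show ?thesis using IH[of ?H] unfolding H .
  qed (simp add: mult_exp_0)
  finally show ?case by (simp only: of_nat_Suc distrib_right mult_1_left add.commute diff_Suc_1)
qed

lemma lin_upd: "lin g (c(k := c k + 1)) = lin g c + g k"
proof -
  have "lin g (c(k := c k + 1)) = (\<Sum>l\<in>UNIV. g l * c l + (if l = k then g k else 0))"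
    unfolding lin_def by (intro sum.cong) (auto simp: algebra_simps)
  then show ?thesis by (simp add: lin_def sum.distrib)
qed

locale prob_weights =
  fixes p :: "'d::finite \<Rightarrow> real"
  assumes p_nonneg: "\<And>k. p k \<ge> 0" and p_sum: "(\<Sum>k\<in>UNIV. p k) = 1"
begin

lemma mult_exp_const: "mult_exp p m (\<lambda>_. a) = a"
  by (simp add: mult_exp_def prod_exp_const p_sum)

lemma mult_exp_mono:
  "(\<And>f. F (cnt m f) \<le> G (cnt m f)) \<Longrightarrow> mult_exp p m F \<le> mult_exp p m G"
  unfolding mult_exp_def by (intro prod_exp_mono p_nonneg)

text \<open>The offset t makes the induction go through, since a further draw of k adds g k to the
  linear form. Size biasing later produces the same kind of offset.\<close>

lemma mult_exp_lin: "mult_exp p m (\<lambda>c. lin g c + t) = t + real m * (\<Sum>k\<in>UNIV. p k * g k)"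
proof (induction m arbitrary: t)
  case 0
  show ?case by (simp add: mult_exp_0 lin_def)
next
  case (Suc m)
  define a where "a = (\<Sum>k\<in>UNIV. p k * g k)"
  have "mult_exp p (Suc m) (\<lambda>c. lin g c + t) = (\<Sum>k\<in>UNIV. p k * mult_exp p m (\<lambda>c. lin g c + (g k + t)))"
    by (simp add: mult_exp_Suc lin_upd mult_exp_sum mult_exp_cmult add.assoc)
  also have "\<dots> = (\<Sum>k\<in>UNIV. p k * g k + (t + real m * a) * p k)"
    by (intro sum.cong refl) (simp only: Suc.IH a_def[symmetric], simp add: algebra_simps)
  also have "\<dots> = a + (t + real m * a)"
    by (simp only: sum.distrib sum_distrib_left[symmetric] p_sum a_def[symmetric] mult_1_right)
  finally show ?case unfolding a_def[symmetric] by (simp add: algebra_simps)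
qed

lemma mult_exp_lin_sq: "mult_exp p m (\<lambda>c. (lin g c + t)\<^sup>2) =
    t\<^sup>2 + 2 * t * real m * (\<Sum>k\<in>UNIV. p k * g k) + real m * (\<Sum>k\<in>UNIV. p k * (g k)\<^sup>2)
     + real m * (real m - 1) * (\<Sum>k\<in>UNIV. p k * g k)\<^sup>2"
proof (induction m arbitrary: t)
  case 0
  show ?case by (simp add: mult_exp_0 lin_def)
next
  case (Suc m)
  define a where "a = (\<Sum>k\<in>UNIV. p k * g k)"
  define b where "b = (\<Sum>k\<in>UNIV. p k * (g k)\<^sup>2)"
  have "mult_exp p (Suc m) (\<lambda>c. (lin g c + t)\<^sup>2) = (\<Sum>k\<in>UNIV. p k * mult_exp p m (\<lambda>c. (lin g c + (g k + t))\<^sup>2))"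
    by (simp add: mult_exp_Suc lin_upd mult_exp_sum mult_exp_cmult add.assoc)
  also have "\<dots> = (\<Sum>k\<in>UNIV. p k * (g k)\<^sup>2 + (2 * t + 2 * real m * a) * (p k * g k)
      + (t\<^sup>2 + 2 * t * real m * a + real m * b + real m * (real m - 1) * a\<^sup>2) * p k)"
    by (intro sum.cong refl)
       (simp only: Suc.IH a_def[symmetric] b_def[symmetric], simp add: algebra_simps power2_eq_square)
  also have "\<dots> = b + (2 * t + 2 * real m * a) * a
      + (t\<^sup>2 + 2 * t * real m * a + real m * b + real m * (real m - 1) * a\<^sup>2)"
    by (simp add: sum.distrib sum_distrib_left[symmetric] p_sum a_def b_def)
  also have "\<dots> = t\<^sup>2 + 2 * t * real (Suc m) * a + real (Suc m) * b + real (Suc m) * (real (Suc m) - 1) * a\<^sup>2"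
    by (simp add: algebra_simps power2_eq_square)
  finally show ?case by (simp only: a_def b_def)
qed

lemma mult_exp_cnt_lin:
  assumes "m \<ge> 1"
  shows "mult_exp p m (\<lambda>c. c k * lin g c) = real m * p k * (g k + (real m - 1) * (\<Sum>l\<in>UNIV. p l * g l))"
  using assms by (simp add: mult_exp_size_bias lin_upd mult_exp_lin of_nat_diff)

text \<open>Size biasing once leaves c k + 1 times a squared form on m - 1 draws; size biasing the c
  k part again leaves a squared form on m - 2 draws. The offsets are g k and 2 g k, and
  \<open>mult_exp_lin_sq\<close> evaluates both.\<close>

lemma mult_exp_cnt_lin_sq:
  fixes g :: "'d \<Rightarrow> real"
  assumes m: "m \<ge> 2"
  defines "\<mu> \<equiv> real m" and "a \<equiv> \<Sum>l\<in>UNIV. p l * g l" and "b \<equiv> \<Sum>l\<in>UNIV. p l * (g l)\<^sup>2"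
  shows "mult_exp p m (\<lambda>c. (c k * lin g c)\<^sup>2) = \<mu> * p k *
    (((g k)\<^sup>2 + 2 * g k * (\<mu> - 1) * a + (\<mu> - 1) * b + (\<mu> - 1) * (\<mu> - 2) * a\<^sup>2)
    + (\<mu> - 1) * p k * (4 * (g k)\<^sup>2 + 4 * g k * (\<mu> - 2) * a + (\<mu> - 2) * b + (\<mu> - 2) * (\<mu> - 3) * a\<^sup>2))"
proof -
  have r: "real (m - 1) = \<mu> - 1" "real (m - Suc 0) = \<mu> - 1" "real (m - 1 - 1) = \<mu> - 2" "real (m - 2) = \<mu> - 2"
    using m by (auto simp: \<mu>_def of_nat_diff)
  have "mult_exp p m (\<lambda>c. (c k * lin g c)\<^sup>2) = mult_exp p m (\<lambda>c. c k * (c k * (lin g c)\<^sup>2))"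
    by (simp add: power2_eq_square mult_ac)
  also have "\<dots> = \<mu> * p k * mult_exp p (m - 1) (\<lambda>c. c k * (lin g c + g k)\<^sup>2 + (lin g c + g k)\<^sup>2)"
    by (simp only: mult_exp_size_bias lin_upd \<mu>_def distrib_right fun_upd_same mult_1_left)
  also have "mult_exp p (m - 1) (\<lambda>c. c k * (lin g c + g k)\<^sup>2 + (lin g c + g k)\<^sup>2)
     = (\<mu> - 1) * p k * mult_exp p (m - 1 - 1) (\<lambda>c. (lin g c + 2 * g k)\<^sup>2)
       + mult_exp p (m - 1) (\<lambda>c. (lin g c + g k)\<^sup>2)"
    unfolding mult_exp_add mult_exp_size_bias lin_upd r by (simp add: add.assoc)
  finally show ?thesis
    unfolding mult_exp_lin_sq r a_def[symmetric] b_def[symmetric] by (simp add: power2_eq_square algebra_simps)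
qed

end

section \<open>Unbiased estimation from one sampled column\<close>

text \<open>For a single column, \<open>Y_mat\<close> is n times its contribution to \<open>C_e\<close>, written as a function of the
  counts c of the sampled indices. The junk value of \<open>x $ k / p k\<close> at \<open>p k = 0\<close> is harmless, since
  then \<open>x $ k = 0\<close>.\<close>

locale column_sampling = prob_weights p for p :: "'d::finite \<Rightarrow> real" +
  fixes x :: "real^'d" and m :: nat
  assumes m: "m \<ge> 2" and p_zero: "\<And>k. p k = 0 \<Longrightarrow> x $ k = 0"
begin

definition ratio :: "'d \<Rightarrow> real" where
  "ratio k = x $ k / p k"

text \<open>The count of k has second moment m p (1 + (m - 1) p). Multiplying by 1 -
  \<open>shrink k\<close> = (m - 1) p \<open>shrink k\<close> cuts it to m (m - 1) p^2, the pattern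
  of the off-diagonal moments, which removes the bias of the diagonal.\<close>

definition shrink :: "'d \<Rightarrow> real" where
  "shrink k = 1 / (1 + (real m - 1) * p k)"

definition Y_mat :: "('d \<Rightarrow> real) \<Rightarrow> real^'d^'d" where
  "Y_mat c = (\<chi> k l. ratio k * c k * ratio l * c l * (if k = l then 1 - shrink k else 1)
     / (real m * (real m - 1)))"

lemma p_ratio: "p k * ratio k = x $ k"
  using p_zero[of k] by (simp add: ratio_def)

lemma shrink_pos: "shrink k > 0"
  using m p_nonneg[of k] by (simp add: shrink_def add_pos_nonneg)

lemma shrink_le: "shrink k \<le> 1"
  using m p_nonneg[of k] by (simp add: shrink_def divide_simps add_pos_nonneg) 

lemma one_minus_shrink: "1 - shrink k = (real m - 1) * p k * shrink k"
proof -
  have "1 + (real m - 1) * p k > 0" using m p_nonneg[of k] by (simp add: add_pos_nonneg)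
  then show ?thesis by (simp add: shrink_def field_simps)
qed

text \<open>Row k of the matrix applied to v is a constant times c k times a linear form in the
  counts; these are the coefficients of that form, so the exact moment formulas apply row by
  row.\<close>

definition coef :: "real^'d \<Rightarrow> 'd \<Rightarrow> 'd \<Rightarrow> real" where
  "coef v k l = ratio l * v $ l * (if k = l then 1 - shrink k else 1)"

lemma Y_mat_mult: "(Y_mat c *v v) $ k = ratio k / (real m * (real m - 1)) * (c k * lin (coef v k) c)"
  unfolding matrix_vector_mult_def Y_mat_def lin_def coef_def
  by (simp add: sum_distrib_left) (intro sum.cong refl, simp add: mult_ac)

lemma coef_diag: "coef v k k = (real m - 1) * (x $ k * v $ k * shrink k)"
  using p_ratio[of k] by (simp add: coef_def one_minus_shrink mult_ac)

lemma coef_mean: "(\<Sum>l\<in>UNIV. p l * coef v k l) = x \<bullet> v - x $ k * v $ k * shrink k"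
proof -
  have "p l * coef v k l = x $ l * v $ l - (if l = k then x $ k * v $ k * shrink k else 0)" for l
    using p_ratio[of l] by (auto simp: coef_def algebra_simps) (metis mult.assoc mult.commute)+
  then show ?thesis by (simp add: sum_subtractf inner_vec_def)
qed

text \<open>With r = x_k v_k \<open>shrink k\<close>, the diagonal coefficient contributes (m - 1) r
  and the mean of the form contributes (m - 1) ((x inner v) - r), so the corrections cancel.\<close>

lemma Y_mat_mean: "mult_exp p m (\<lambda>c. (Y_mat c *v v) $ k) = x $ k * (x \<bullet> v)"
proof -
  have m1: "real m - 1 > 0" using m by simp
  have "mult_exp p m (\<lambda>c. (Y_mat c *v v) $ k) = ratio k / (real m * (real m - 1)) *
     (real m * p k * ((real m - 1) * (x \<bullet> v)))"
    using m unfolding Y_mat_mult mult_exp_cmult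
    by (simp add: mult_exp_cnt_lin coef_diag coef_mean algebra_simps)
  also have "\<dots> = (p k * ratio k) * (x \<bullet> v)" using m1 m by simp
  finally show ?thesis by (simp add: p_ratio)
qed

text \<open>The first summand is the squared length of the mean; its constant must be exactly 1,
  because it is subtracted in the variance. Everything else is of order 1/m and is expressed through
  the maximum and the sum of \<open>Q k\<close>, that is x_k^2 / p_k.\<close>

lemma Y_mat_var:
  assumes \<kappa>: "\<And>k. (ratio k)\<^sup>2 * p k \<le> \<kappa>" and N1: "(\<Sum>k\<in>UNIV. (ratio k)\<^sup>2 * p k) \<le> N1"
  shows "(\<Sum>k\<in>UNIV. mult_exp p m (\<lambda>c. ((Y_mat c *v v) $ k)\<^sup>2)) \<le> (norm x)\<^sup>2 * (x \<bullet> v)\<^sup>2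
    + N1 / real m * (x \<bullet> v)\<^sup>2
    + (8 * \<kappa>\<^sup>2 / (real m)\<^sup>2 + 2 * N1 * \<kappa> / (real m)\<^sup>2 + 9 * \<kappa> * (norm x)\<^sup>2 / real m) * (norm v)\<^sup>2"
proof -
  define M where "M = real m"
  have M: "M \<ge> 2" using m by (simp add: M_def)
  define \<xi> where "\<xi> = x \<bullet> v"
  define W where "W = norm x * norm v"
  define Q where "Q = (\<lambda>k. (ratio k)\<^sup>2 * p k)"
  define e where "e = (\<lambda>k. \<bar>x $ k * v $ k\<bar>)"
  have Q: "0 \<le> Q k" "Q k \<le> \<kappa>" for k using \<kappa> p_nonneg by (auto simp: Q_def)
  have \<kappa>0: "\<kappa> \<ge> 0" using Q order_trans by blast
  have W: "0 \<le> W" "\<bar>\<xi>\<bar> \<le> W" by (auto simp: W_def \<xi>_def Cauchy_Schwarz_ineq2)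
  have e: "0 \<le> e k" for k by (simp add: e_def)
  note sum_sq = norm_sq_cart[symmetric]
  have sum_e: "(\<Sum>k\<in>UNIV. e k) \<le> W"
  proof -
    have "(\<Sum>k\<in>UNIV. e k) = (\<chi> k. \<bar>x $ k\<bar>) \<bullet> (\<chi> k. \<bar>v $ k\<bar>)"
      by (simp add: e_def inner_vec_def abs_mult)
    also have "\<dots> \<le> norm (\<chi> k. \<bar>x $ k\<bar>) * norm (\<chi> k. \<bar>v $ k\<bar>)" by (rule norm_cauchy_schwarz)
    finally show ?thesis by (simp add: W_def norm_vec_def)
  qed
  define B where "B = (\<Sum>l\<in>UNIV. Q l * (v $ l)\<^sup>2)"
  have B: "B \<le> \<kappa> * (norm v)\<^sup>2"
    unfolding B_def sum_sq[symmetric] sum_distrib_left by (intro sum_mono mult_right_mono Q) auto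
  have B0: "B \<ge> 0" unfolding B_def using Q by (intro sum_nonneg) auto
  have term_le: "mult_exp p m (\<lambda>c. ((Y_mat c *v v) $ k)\<^sup>2) \<le> (x $ k)\<^sup>2 * \<xi>\<^sup>2 + Q k * \<xi>\<^sup>2 / M
     + 6 * \<kappa> * W * e k / M + 2 * Q k * B / M\<^sup>2 + 8 * \<kappa>\<^sup>2 * (v $ k)\<^sup>2 / M\<^sup>2 + (x $ k)\<^sup>2 * B / M" for k
  proof -
    define r where "r = x $ k * v $ k * shrink k"
    define G where "G = (\<Sum>l\<in>UNIV. p l * (coef v k l)\<^sup>2)"
    have re: "\<bar>r\<bar> = e k * shrink k" using shrink_pos[of k] by (simp add: r_def e_def abs_mult)
    have re': "\<bar>r\<bar> \<le> e k" unfolding re using shrink_le[of k] e[of k] by (simp add: mult_left_le)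
    have r\<xi>: "r * \<xi> \<le> \<bar>r\<bar> * W" 
    proof -
      have "r * \<xi> \<le> \<bar>r\<bar> * \<bar>\<xi>\<bar>" by (simp add: abs_mult[symmetric])
      also have "\<dots> \<le> \<bar>r\<bar> * W" using W by (intro mult_left_mono) auto
      finally show ?thesis .
    qed
    have G: "G \<le> B"
      unfolding G_def B_def
    proof (intro sum_mono)
      fix l
      have "\<bar>coef v k l\<bar> \<le> \<bar>ratio l * v $ l\<bar>"
        using shrink_pos[of k] shrink_le[of k] by (auto simp: coef_def abs_mult intro: mult_left_le)
      then have "(coef v k l)\<^sup>2 \<le> (ratio l * v $ l)\<^sup>2" by (simp add: abs_le_square_iff)
      then have "p l * (coef v k l)\<^sup>2 \<le> p l * (ratio l * v $ l)\<^sup>2" using p_nonneg by (rule mult_left_mono)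
      then show "p l * (coef v k l)\<^sup>2 \<le> Q l * (v $ l)\<^sup>2" by (simp add: Q_def power_mult_distrib mult_ac)
    qed
    have G0: "G \<ge> 0" unfolding G_def using p_nonneg by (intro sum_nonneg) auto
    have x2: "(ratio k)\<^sup>2 * (p k)\<^sup>2 = (x $ k)\<^sup>2"
      unfolding p_ratio[symmetric] by (simp add: power_mult_distrib mult.commute)
    \<comment> \<open>The diagonal correction gains a factor of order 1/M, because (M - 1) p
      \<open>shrink\<close> = 1 - \<open>shrink\<close> <= 1.\<close>
    have xs: "(x $ k)\<^sup>2 * shrink k \<le> Q k / (M - 1)"
    proof -
      have "(M - 1) * ((x $ k)\<^sup>2 * shrink k) = Q k * ((M - 1) * p k * shrink k)"
        unfolding x2[symmetric] by (simp add: Q_def power2_eq_square mult_ac)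
      also have "\<dots> \<le> Q k * 1"
        using one_minus_shrink[of k] shrink_pos[of k] by (intro mult_left_mono Q) (simp add: M_def)
      finally show ?thesis using M by (simp add: field_simps)
    qed
    have xg: "(x $ k)\<^sup>2 * ((M - 1) * r)\<^sup>2 \<le> \<kappa>\<^sup>2 * (v $ k)\<^sup>2"
    proof -
      have "(x $ k)\<^sup>2 * ((M - 1) * r)\<^sup>2 = (Q k * v $ k)\<^sup>2 * ((M - 1) * p k * shrink k)\<^sup>2"
        unfolding r_def Q_def p_ratio[symmetric] by (simp add: power2_eq_square mult_ac)
      also have "\<dots> \<le> (Q k * v $ k)\<^sup>2 * 1"
        using one_minus_shrink[of k] shrink_pos[of k] shrink_le[of k]
        by (intro mult_left_mono power_le_one) (auto simp: M_def)
      also have "\<dots> \<le> \<kappa>\<^sup>2 * (v $ k)\<^sup>2"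
        using power_mono[OF Q(2)[of k] Q(1)[of k], of 2] by (simp add: power_mult_distrib mult_right_mono)
      finally show ?thesis .
    qed
    have m1: "M - 1 > 0" using M by simp
    have "mult_exp p m (\<lambda>c. ((Y_mat c *v v) $ k)\<^sup>2)
      = (ratio k / (M * (M - 1)))\<^sup>2 * mult_exp p m (\<lambda>c. (c k * lin (coef v k) c)\<^sup>2)"
      unfolding Y_mat_mult power_mult_distrib[of "ratio k / _"] mult_exp_cmult M_def ..
    also have "\<dots> = (ratio k / (M * (M - 1)))\<^sup>2 * (M * p k *
      ((((M - 1) * r)\<^sup>2 + 2 * ((M - 1) * r) * (M - 1) * (\<xi> - r) + (M - 1) * G + (M - 1) * (M - 2) * (\<xi> - r)\<^sup>2)
      + (M - 1) * p k * (4 * ((M - 1) * r)\<^sup>2 + 4 * ((M - 1) * r) * (M - 2) * (\<xi> - r) + (M - 2) * G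
          + (M - 2) * (M - 3) * (\<xi> - r)\<^sup>2)))"
      by (simp only: mult_exp_cnt_lin_sq[OF m] coef_diag coef_mean M_def[symmetric] \<xi>_def[symmetric]
          r_def[symmetric] G_def[symmetric])
    also have "\<dots> = Q k / M * (r\<^sup>2 + 2 * r * (\<xi> - r) + G / (M - 1) + (M - 2) / (M - 1) * (\<xi> - r)\<^sup>2)
      + (ratio k)\<^sup>2 * (p k)\<^sup>2 * (4 * ((M - 1) * r)\<^sup>2 / (M * (M - 1)) + (M - 2) * G / (M * (M - 1))
         + (M - 2) / (M * (M - 1)) * (4 * (M - 1) * r * (\<xi> - r) + (M - 3) * (\<xi> - r)\<^sup>2))"
    proof -
      define h where "h = M - 1"
      have h: "h > 0" "M > 0" using m1 M by (auto simp: h_def)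
      define a where "a = r\<^sup>2 + 2 * r * (\<xi> - r) + G / h + (M - 2) / h * (\<xi> - r)\<^sup>2"
      define b where "b = 4 * (h * r)\<^sup>2 + 4 * (h * r) * (M - 2) * (\<xi> - r) + (M - 2) * G + (M - 2) * (M - 3) * (\<xi> - r)\<^sup>2"
      have A: "(h * r)\<^sup>2 + 2 * (h * r) * h * (\<xi> - r) + h * G + h * (M - 2) * (\<xi> - r)\<^sup>2 = h\<^sup>2 * a"
        using h by (simp add: a_def distrib_left power_mult_distrib) (simp add: power2_eq_square)
      have B: "4 * (h * r)\<^sup>2 / (M * h) + (M - 2) * G / (M * h)
         + (M - 2) / (M * h) * (4 * h * r * (\<xi> - r) + (M - 3) * (\<xi> - r)\<^sup>2) = b / (M * h)"
        by (simp add: b_def add_divide_distrib distrib_left mult_ac) (simp add: algebra_simps)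
      have "(ratio k / (M * h))\<^sup>2 * (M * p k * (h\<^sup>2 * a + h * p k * b))
         = Q k / M * a + (ratio k)\<^sup>2 * (p k)\<^sup>2 * (b / (M * h))"
        unfolding Q_def using h by (simp add: power_divide power_mult_distrib field_simps power2_eq_square)
      then show ?thesis unfolding h_def[symmetric] A B a_def[symmetric] b_def[symmetric] .
    qed
    also have "\<dots> \<le> (Q k * \<xi>\<^sup>2 / M + 2 * \<kappa> * W * e k / M + 2 * Q k * B / M\<^sup>2)
      + (8 * \<kappa>\<^sup>2 * (v $ k)\<^sup>2 / M\<^sup>2 + (x $ k)\<^sup>2 * B / M + ((x $ k)\<^sup>2 * \<xi>\<^sup>2 + 4 * \<kappa> * W * e k / M))"
    proof (rule add_mono)
      define \<rho> where "\<rho> = (M - 2) / (M - 1)"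
      have \<rho>: "0 \<le> \<rho>" "\<rho> \<le> 1" using M by (auto simp: \<rho>_def)
      have "r\<^sup>2 + 2 * r * (\<xi> - r) + \<rho> * (\<xi> - r)\<^sup>2 = \<rho> * \<xi>\<^sup>2 + 2 * (1 - \<rho>) * (r * \<xi>) - (1 - \<rho>) * r\<^sup>2"
        by (simp add: power2_eq_square algebra_simps)
      also have "\<dots> \<le> 1 * \<xi>\<^sup>2 + 2 * (1 - \<rho>) * (e k * W) - 0"
      proof (intro add_mono diff_mono mult_right_mono mult_left_mono)
        show "r * \<xi> \<le> e k * W" using r\<xi> mult_right_mono[OF re' W(1)] by linarith
      qed (use \<rho> in auto)
      also have "\<dots> \<le> \<xi>\<^sup>2 + 2 * (e k * W)"
        using \<rho> e[of k] W(1) mult_right_mono[of "2 * (1 - \<rho>)" 2 "e k * W"] by simp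
      finally have 1: "r\<^sup>2 + 2 * r * (\<xi> - r) + \<rho> * (\<xi> - r)\<^sup>2 \<le> \<xi>\<^sup>2 + 2 * (e k * W)" .
      have "G / (M - 1) \<le> B / (M / 2)" using G B0 M by (intro frac_le) auto
      then have "r\<^sup>2 + 2 * r * (\<xi> - r) + G / (M - 1) + \<rho> * (\<xi> - r)\<^sup>2 \<le> \<xi>\<^sup>2 + 2 * (e k * W) + 2 * B / M"
        using 1 by (simp add: mult.commute)
      then have "Q k / M * (r\<^sup>2 + 2 * r * (\<xi> - r) + G / (M - 1) + \<rho> * (\<xi> - r)\<^sup>2)
         \<le> Q k / M * (\<xi>\<^sup>2 + 2 * (e k * W) + 2 * B / M)"
        using Q(1)[of k] M by (intro mult_left_mono) auto
      also have "\<dots> = Q k * \<xi>\<^sup>2 / M + 2 * Q k * W * e k / M + 2 * Q k * B / M\<^sup>2"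
        by (simp add: power2_eq_square algebra_simps add_divide_distrib)
      also have "2 * Q k * W * e k / M \<le> 2 * \<kappa> * W * e k / M"
        using Q[of k] W e M by (intro divide_right_mono mult_right_mono) auto
      finally show "Q k / M * (r\<^sup>2 + 2 * r * (\<xi> - r) + G / (M - 1) + (M - 2) / (M - 1) * (\<xi> - r)\<^sup>2)
        \<le> Q k * \<xi>\<^sup>2 / M + 2 * \<kappa> * W * e k / M + 2 * Q k * B / M\<^sup>2" by (simp add: \<rho>_def)
    next
      have MM: "M * (M - 1) \<ge> M\<^sup>2 / 2" "M * (M - 1) > 0" "M\<^sup>2 > 0"
        using M mult_left_mono[of "M / 2" "M - 1" M] by (auto simp: power2_eq_square)
      have a: "(x $ k)\<^sup>2 * (4 * ((M - 1) * r)\<^sup>2 / (M * (M - 1))) \<le> 8 * \<kappa>\<^sup>2 * (v $ k)\<^sup>2 / M\<^sup>2"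
      proof -
        have "(x $ k)\<^sup>2 * (4 * ((M - 1) * r)\<^sup>2 / (M * (M - 1))) = 4 * ((x $ k)\<^sup>2 * ((M - 1) * r)\<^sup>2) / (M * (M - 1))"
          by simp
        also have "\<dots> \<le> 4 * (\<kappa>\<^sup>2 * (v $ k)\<^sup>2) / (M\<^sup>2 / 2)"
          using MM xg by (intro frac_le mult_left_mono) auto
        finally show ?thesis by simp
      qed
      have b: "(x $ k)\<^sup>2 * ((M - 2) * G / (M * (M - 1))) \<le> (x $ k)\<^sup>2 * B / M"
      proof -
        have "(M - 2) / (M - 1) * G \<le> 1 * B" using M G G0 by (intro mult_mono) auto
        then have "(M - 2) / (M - 1) * G / M \<le> B / M" using M by (intro divide_right_mono) auto
        then have "(M - 2) * G / (M * (M - 1)) \<le> B / M" by (simp add: mult_ac)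
        then show ?thesis using mult_left_mono[of _ _ "(x $ k)\<^sup>2"] by fastforce
      qed
      have c: "(x $ k)\<^sup>2 * ((M - 2) / (M * (M - 1)) * (4 * (M - 1) * r * (\<xi> - r) + (M - 3) * (\<xi> - r)\<^sup>2))
          \<le> (x $ k)\<^sup>2 * \<xi>\<^sup>2 + 4 * \<kappa> * W * e k / M"
      proof -
        \<comment> \<open>Collecting powers of \<xi> isolates the one contribution that is not of
          order 1/M; after division its coefficient (M - 2) (M - 3) / (M (M - 1)) is at most 1, as
          required for the leading term.\<close>
        have "4 * (M - 1) * r * (\<xi> - r) + (M - 3) * (\<xi> - r)\<^sup>2
            = (M - 3) * \<xi>\<^sup>2 + (2 * M + 2) * (r * \<xi>) - (3 * M - 1) * r\<^sup>2"
          by (simp add: power2_eq_square algebra_simps)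
        also have "\<dots> \<le> (M - 3) * \<xi>\<^sup>2 + (2 * M + 2) * (\<bar>r\<bar> * W) - 0"
          using M r\<xi> by (intro diff_mono add_left_mono mult_left_mono) auto
        finally have "(M - 2) / (M * (M - 1)) * (4 * (M - 1) * r * (\<xi> - r) + (M - 3) * (\<xi> - r)\<^sup>2)
           \<le> (M - 2) / (M * (M - 1)) * ((M - 3) * \<xi>\<^sup>2 + (2 * M + 2) * (\<bar>r\<bar> * W))"
          using M MM by (intro mult_left_mono) auto
        also have "\<dots> = (M - 2) * (M - 3) / (M * (M - 1)) * \<xi>\<^sup>2
            + (M - 2) * (2 * M + 2) / (M * (M - 1)) * (\<bar>r\<bar> * W)"
        proof -
          have "u / w * (a * y + b * z) = u * a / w * y + u * b / w * z" for u w a b y z :: real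
            by (simp add: distrib_left)
          then show ?thesis .
        qed
        also have "(M - 2) * (M - 3) / (M * (M - 1)) * \<xi>\<^sup>2 \<le> 1 * \<xi>\<^sup>2"
          using MM M by (intro mult_right_mono) (auto simp: algebra_simps)
        finally have "(x $ k)\<^sup>2 * ((M - 2) / (M * (M - 1)) * (4 * (M - 1) * r * (\<xi> - r) + (M - 3) * (\<xi> - r)\<^sup>2))
          \<le> (x $ k)\<^sup>2 * (1 * \<xi>\<^sup>2 + (M - 2) * (2 * M + 2) / (M * (M - 1)) * (\<bar>r\<bar> * W))"
          by (intro mult_left_mono) auto
        also have "\<dots> = (x $ k)\<^sup>2 * \<xi>\<^sup>2
            + (M - 2) * (2 * M + 2) / (M * (M - 1)) * (((x $ k)\<^sup>2 * shrink k) * (e k * W))"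
          unfolding re by (simp add: distrib_left mult_ac)
        also have "(M - 2) * (2 * M + 2) / (M * (M - 1)) * (((x $ k)\<^sup>2 * shrink k) * (e k * W))
            \<le> (M - 2) * (2 * M + 2) / (M * (M - 1)) * (\<kappa> / (M - 1) * (e k * W))"
        proof (intro mult_left_mono mult_right_mono)
          show "(x $ k)\<^sup>2 * shrink k \<le> \<kappa> / (M - 1)"
            using xs divide_right_mono[OF Q(2)[of k], of "M - 1"] M by linarith
        qed (use e W M MM in auto)
        also have "\<dots> = (M - 2) * (2 * M + 2) / (M - 1)\<^sup>2 * (\<kappa> * W * e k / M)"
          by (simp add: power2_eq_square mult_ac)
        also have "\<dots> \<le> 4 * (\<kappa> * W * e k / M)"
        proof (rule mult_right_mono)
          \<comment> \<open>The right-hand side is 4 (M - 1)^2 - (M - 2) (2 M + 2) with the square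
            completed.\<close>
          have "0 \<le> 2 * (M - 3 / 2)\<^sup>2 + 7 / 2" by simp
          then have "(M - 2) * (2 * M + 2) \<le> 4 * (M - 1)\<^sup>2" by (simp add: power2_eq_square algebra_simps)
          then show "(M - 2) * (2 * M + 2) / (M - 1)\<^sup>2 \<le> 4" using m1 by (simp add: pos_divide_le_eq)
        qed (use \<kappa>0 W e M in auto)
        finally show ?thesis by simp
      qed
      show "(ratio k)\<^sup>2 * (p k)\<^sup>2 * (4 * ((M - 1) * r)\<^sup>2 / (M * (M - 1)) + (M - 2) * G / (M * (M - 1))
         + (M - 2) / (M * (M - 1)) * (4 * (M - 1) * r * (\<xi> - r) + (M - 3) * (\<xi> - r)\<^sup>2))
       \<le> 8 * \<kappa>\<^sup>2 * (v $ k)\<^sup>2 / M\<^sup>2 + (x $ k)\<^sup>2 * B / M + ((x $ k)\<^sup>2 * \<xi>\<^sup>2 + 4 * \<kappa> * W * e k / M)"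
        unfolding x2 using a b c by (simp only: distrib_left)
    qed
    finally show ?thesis by (simp add: algebra_simps add_divide_distrib)
  qed
  have "(\<Sum>k\<in>UNIV. mult_exp p m (\<lambda>c. ((Y_mat c *v v) $ k)\<^sup>2)) \<le> (\<Sum>k\<in>UNIV. (x $ k)\<^sup>2 * \<xi>\<^sup>2 + Q k * \<xi>\<^sup>2 / M
     + 6 * \<kappa> * W * e k / M + 2 * Q k * B / M\<^sup>2 + 8 * \<kappa>\<^sup>2 * (v $ k)\<^sup>2 / M\<^sup>2 + (x $ k)\<^sup>2 * B / M)"
    by (intro sum_mono term_le)
  also have "\<dots> = (norm x)\<^sup>2 * \<xi>\<^sup>2 + (\<Sum>k\<in>UNIV. Q k) * \<xi>\<^sup>2 / M + 6 * \<kappa> * W * (\<Sum>k\<in>UNIV. e k) / M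
     + 2 * (\<Sum>k\<in>UNIV. Q k) * B / M\<^sup>2 + 8 * \<kappa>\<^sup>2 * (norm v)\<^sup>2 / M\<^sup>2 + (norm x)\<^sup>2 * B / M"
    by (simp add: sum.distrib sum_distrib_left sum_distrib_right sum_divide_distrib sum_sq[symmetric])
  also have "\<dots> \<le> (norm x)\<^sup>2 * \<xi>\<^sup>2 + N1 * \<xi>\<^sup>2 / M + 6 * \<kappa> * W * W / M
     + 2 * N1 * (\<kappa> * (norm v)\<^sup>2) / M\<^sup>2 + 8 * \<kappa>\<^sup>2 * (norm v)\<^sup>2 / M\<^sup>2 + (norm x)\<^sup>2 * (\<kappa> * (norm v)\<^sup>2) / M"
  proof -
    have N: "(\<Sum>k\<in>UNIV. Q k) \<le> N1" "0 \<le> (\<Sum>k\<in>UNIV. Q k)" using N1 Q by (auto simp: Q_def sum_nonneg)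
    have "2 * (\<Sum>k\<in>UNIV. Q k) * B \<le> 2 * N1 * (\<kappa> * (norm v)\<^sup>2)"
      using N B B0 by (intro mult_mono) auto
    moreover have "(\<Sum>k\<in>UNIV. Q k) * \<xi>\<^sup>2 \<le> N1 * \<xi>\<^sup>2" using N by (intro mult_right_mono) auto
    moreover have "6 * \<kappa> * W * (\<Sum>k\<in>UNIV. e k) \<le> 6 * \<kappa> * W * W"
      using sum_e \<kappa>0 W by (intro mult_left_mono) auto
    moreover have "(norm x)\<^sup>2 * B \<le> (norm x)\<^sup>2 * (\<kappa> * (norm v)\<^sup>2)" using B by (intro mult_left_mono) auto
    ultimately show ?thesis using M by (intro add_mono divide_right_mono) auto
  qed
  also have "\<dots> = (norm x)\<^sup>2 * \<xi>\<^sup>2 + N1 / M * \<xi>\<^sup>2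
    + (8 * \<kappa>\<^sup>2 / M\<^sup>2 + 2 * N1 * \<kappa> / M\<^sup>2 + 7 * \<kappa> * (norm x)\<^sup>2 / M) * (norm v)\<^sup>2"
    by (simp add: W_def power2_eq_square algebra_simps add_divide_distrib)
  \<comment> \<open>The 7 is 6 from the cross terms, summed by Cauchy-Schwarz, plus 1 from x_k^2 B;
    the 9 is the constant appearing in \<open>sigma2\<close>.\<close>
  also have "\<dots> \<le> (norm x)\<^sup>2 * \<xi>\<^sup>2 + N1 / M * \<xi>\<^sup>2
    + (8 * \<kappa>\<^sup>2 / M\<^sup>2 + 2 * N1 * \<kappa> / M\<^sup>2 + 9 * \<kappa> * (norm x)\<^sup>2 / M) * (norm v)\<^sup>2"
    using \<kappa>0 M by (intro add_left_mono mult_right_mono divide_right_mono) auto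
  finally show ?thesis by (simp add: M_def \<xi>_def)
qed

end

section \<open>Truncation\<close>

text \<open>Taking 25th powers reduces the claim to a rational upper bound for e;
  \<open>ln_6_ge\<close> is treated alike with 4th powers.\<close>

lemma exp_16_25_le: "exp (16/25 :: real) \<le> 19/10"
proof -
  have "exp (1 :: real) \<le> 272/100" using e_less_272 by simp
  then have "exp (1::real) ^ 16 \<le> (272/100) ^ 16" by (rule power_mono) simp
  also have "\<dots> \<le> (19/10 :: real) ^ 25" by (simp add: power_divide divide_simps)
  finally have "exp (16/25 :: real) ^ 25 \<le> (19/10) ^ 25"
    by (simp add: exp_of_nat_mult[symmetric])
  then show ?thesis by (rule power_le_imp_le_base[of _ 24, simplified]) simp
qed

lemma ln_6_ge: "7/4 \<le> ln (6 :: real)"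
proof -
  have "exp (1 :: real) \<le> 272/100" using e_less_272 by simp
  then have "exp (1::real) ^ 7 \<le> (272/100) ^ 7" by (rule power_mono) simp
  also have "\<dots> \<le> (6 :: real) ^ 4" by (simp add: power_divide divide_simps)
  finally have "exp (7/4 :: real) ^ 4 \<le> 6 ^ 4"
    by (simp add: exp_of_nat_mult[symmetric])
  then have "exp (7/4 :: real) \<le> 6" by (rule power_le_imp_le_base[of _ 3, simplified]) simp
  then show ?thesis by (subst ln_ge_iff) auto
qed

section \<open>Chernoff bounds and the truncation event\<close>

context prob_weights
begin

lemma mult_exp_exp_le: "mult_exp p m (\<lambda>c. exp (t * c k)) \<le> exp (real m * p k * (exp t - 1))"
proof -
  have "mult_exp p m (\<lambda>c. exp (t * c k)) = (1 + p k * (exp t - 1)) ^ m"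
  proof (induction m)
    case (Suc m)
    have "(\<Sum>l\<in>UNIV. p l * exp (t * (c(l := c l + 1)) k)) = (1 + p k * (exp t - 1)) * exp (t * c k)" for c
    proof -
      have "(\<Sum>l\<in>UNIV. p l * exp (t * (c(l := c l + 1)) k))
         = (\<Sum>l\<in>UNIV. exp (t * c k) * p l + (if l = k then exp (t * c k) * (p k * (exp t - 1)) else 0))"
        by (intro sum.cong) (auto simp: exp_add algebra_simps)
      also have "\<dots> = exp (t * c k) * (\<Sum>l\<in>UNIV. p l) + exp (t * c k) * (p k * (exp t - 1))"
        by (simp add: sum.distrib sum_distrib_left)
      finally show ?thesis by (simp add: p_sum algebra_simps)
    qed
    then show ?case by (simp add: mult_exp_Suc mult_exp_cmult Suc.IH)
  qed (simp add: mult_exp_0)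
  also have "\<dots> \<le> exp (p k * (exp t - 1)) ^ m"
  proof (rule power_mono)
    have "p k \<le> 1" using member_le_sum[of k UNIV p] p_nonneg p_sum by simp
    moreover have "1 + p k * (exp t - 1) = (1 - p k) + p k * exp t" by (simp add: algebra_simps)
    ultimately show "0 \<le> 1 + p k * (exp t - 1)" using mult_nonneg_nonneg[OF p_nonneg[of k] exp_ge_zero[of t]] by linarith
  qed (rule exp_ge_add_one_self)
  also have "\<dots> = exp (real m * p k * (exp t - 1))" by (simp add: exp_of_nat_mult[symmetric] mult.assoc)
  finally show ?thesis .
qed

end

context column_sampling
begin

text \<open>With the exponent 3/5 the Chernoff bound costs \<open>3/5 * threshold = 9/10 * m p + 2 L\<close>, and
  \<open>exp (16/25) - 1 \<le> 9/10\<close> cancels the first part; the excess 16/25 - 3/5 absorbs a factor \<open>c k\<close>.\<close>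

definition threshold :: "real \<Rightarrow> 'd \<Rightarrow> real" where
  "threshold L k = 3/2 * real m * p k + 10/3 * L"

definition good :: "real \<Rightarrow> ('d \<Rightarrow> real) \<Rightarrow> bool" where
  "good L c \<longleftrightarrow> (\<forall>k. c k \<le> threshold L k)"

text \<open>The squared length of the sketched column S S^T x, whose k-th entry is c k x_k / (m
  p_k).\<close>

definition y_sq :: "('d \<Rightarrow> real) \<Rightarrow> real" where
  "y_sq c = (\<Sum>k\<in>UNIV. (ratio k * c k / real m)\<^sup>2)"

text \<open>An exponential Markov bound with a weight h, so that one proof covers the probability of
  exceedance (h = 1) and the first moment on it (h u = u).\<close>

lemma exceed_moment_le:
  assumes h: "\<And>u. u \<ge> 0 \<Longrightarrow> h u * exp (3/5 * u) \<le> C * exp (16/25 * u)" "\<And>u. u \<ge> 0 \<Longrightarrow> h u \<ge> 0"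
    and C: "C \<ge> 0"
  shows "mult_exp p m (\<lambda>c. h (c k) * of_bool (c k > threshold L k)) \<le> C * exp (- 2 * L)"
proof -
  let ?s = "threshold L k"
  have "mult_exp p m (\<lambda>c. h (c k) * of_bool (c k > ?s))
      \<le> mult_exp p m (\<lambda>c. (C * exp (- (3/5 * ?s))) * exp (16/25 * c k))"
  proof (rule mult_exp_mono)
    fix f
    let ?c = "cnt m f k"
    have c: "?c \<ge> 0" by (rule cnt_nonneg)
    have "h ?c * of_bool (?c > ?s) \<le> h ?c * exp (3/5 * ?c - 3/5 * ?s)"
      using h(2)[OF c] by (intro mult_left_mono) auto
    also have "\<dots> = (h ?c * exp (3/5 * ?c)) * exp (- (3/5 * ?s))" by (simp only: diff_conv_add_uminus exp_add mult.assoc)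
    also have "\<dots> \<le> (C * exp (16/25 * ?c)) * exp (- (3/5 * ?s))" by (intro mult_right_mono h(1) c) auto
    finally show "h ?c * of_bool (?c > ?s) \<le> (C * exp (- (3/5 * ?s))) * exp (16/25 * ?c)" by (simp add: mult_ac)
  qed
  also have "\<dots> \<le> (C * exp (- (3/5 * ?s))) * exp (real m * p k * (9/10))"
  proof -
    have "exp (real m * p k * (exp (16/25) - 1)) \<le> exp (real m * p k * (9/10))"
      using exp_16_25_le p_nonneg[of k] mult_left_mono[of "exp (16/25) - 1" "9/10" "real m * p k"] by simp
    then show ?thesis
      unfolding mult_exp_cmult using C
      by (intro mult_left_mono order_trans[OF mult_exp_exp_le]) auto
  qed
  also have "\<dots> = C * exp (- 2 * L)" by (simp add: threshold_def exp_add[symmetric] algebra_simps)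
  finally show ?thesis .
qed

lemma prob_exceed_le: "mult_exp p m (\<lambda>c. of_bool (c k > threshold L k)) \<le> exp (- 2 * L)"
  using exceed_moment_le[of "\<lambda>_. 1" 1] by simp

lemma cnt_exceed_le: "mult_exp p m (\<lambda>c. c k * of_bool (c k > threshold L k)) \<le> 25 * exp (- 2 * L)"
proof (rule exceed_moment_le[of "\<lambda>u. u" 25])
  fix u :: real assume "u \<ge> 0"
  have "u \<le> 25 * exp (1/25 * u)" using exp_ge_add_one_self[of "1/25 * u"] by linarith
  then have "u * exp (3/5 * u) \<le> 25 * exp (1/25 * u) * exp (3/5 * u)" by (rule mult_right_mono) simp
  then show "u * exp (3/5 * u) \<le> 25 * exp (16/25 * u)" by (simp add: exp_add[symmetric] mult.assoc)
qed auto

lemma prob_bad_le: "mult_exp p m (\<lambda>c. of_bool (\<not> good L c)) \<le> real CARD('d) * exp (- 2 * L)"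
proof -
  have "mult_exp p m (\<lambda>c. of_bool (\<not> good L c)) \<le> mult_exp p m (\<lambda>c. \<Sum>k\<in>UNIV. of_bool (c k > threshold L k))"
  proof (rule mult_exp_mono)
    fix f
    show "of_bool (\<not> good L (cnt m f)) \<le> (\<Sum>k\<in>UNIV. of_bool (cnt m f k > threshold L k) :: real)"
    proof (cases "good L (cnt m f)")
      case False
      then obtain k where k: "cnt m f k > threshold L k" by (auto simp: good_def not_le)
      have "of_bool (cnt m f k > threshold L k) \<le> (\<Sum>k\<in>UNIV. of_bool (cnt m f k > threshold L k) :: real)"
        by (rule member_le_sum) auto
      then show ?thesis using k False by simp
    qed (simp add: sum_nonneg)
  qed
  also have "\<dots> \<le> (\<Sum>k\<in>(UNIV :: 'd set). exp (- 2 * L))"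
    unfolding mult_exp_sum by (intro sum_mono prob_exceed_le)
  finally show ?thesis by simp
qed

text \<open>The constants come from the threshold: 9/4 = (3/2)^2, and 25/3 = (3/2) (10/3) +
  10/3.\<close>

definition y_cap :: "real \<Rightarrow> real \<Rightarrow> real" where
  "y_cap L A = 9/4 * (norm x)\<^sup>2 + 25/3 * L * (A\<^sup>2 / real m)"

context
  fixes L A :: real
  assumes L: "L \<ge> 0" and A: "\<And>k. \<bar>ratio k\<bar> \<le> A" and A2: "(\<Sum>k\<in>UNIV. (ratio k)\<^sup>2 * p k) \<le> A\<^sup>2"
begin

lemma ratio_sq_le: "(ratio k)\<^sup>2 \<le> A\<^sup>2"
  using power_mono[OF A[of k] abs_ge_zero, of 2] by simp

text \<open>Holds for all counts, with the exceedances kept as an extra sum estimated by c^2 <= m c.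
  On the good event that sum vanishes; in expectation it gives the bias.\<close>

lemma y_sq_le_exceed:
  "y_sq (cnt m f) \<le> y_cap L A + (\<Sum>k\<in>UNIV. (A\<^sup>2 / real m) * (cnt m f k * of_bool (cnt m f k > threshold L k)))"
proof -
  let ?c = "cnt m f" and ?\<mu> = "real m"
  have m0: "?\<mu> > 0" using m by simp
  have "(ratio k * ?c k / ?\<mu>)\<^sup>2 \<le> 9/4 * (x $ k)\<^sup>2 + 5 * L * ((ratio k)\<^sup>2 * p k) / ?\<mu>
      + 10/3 * L * (A\<^sup>2 * ?c k) / ?\<mu>\<^sup>2 + (A\<^sup>2 / ?\<mu>) * (?c k * of_bool (?c k > threshold L k))" for k
  proof -
    have c: "0 \<le> ?c k" "?c k \<le> ?\<mu>" by (rule cnt_nonneg, rule cnt_le)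
    have x2: "(ratio k)\<^sup>2 * (p k)\<^sup>2 = (x $ k)\<^sup>2"
      unfolding p_ratio[symmetric] by (simp add: power_mult_distrib mult.commute)
    have y2: "(ratio k * ?c k / ?\<mu>)\<^sup>2 = (ratio k)\<^sup>2 * (?c k * ?c k) / ?\<mu>\<^sup>2"
      by (simp add: power_divide power_mult_distrib power2_eq_square)
    show ?thesis
    proof (cases "?c k > threshold L k")
      case True
      have "(ratio k * ?c k / ?\<mu>)\<^sup>2 \<le> A\<^sup>2 * (?\<mu> * ?c k) / ?\<mu>\<^sup>2"
        unfolding y2 using c ratio_sq_le by (intro divide_right_mono mult_mono) auto
      also have "\<dots> = (A\<^sup>2 / ?\<mu>) * ?c k" using m0 by (simp add: power2_eq_square)
      finally have "(ratio k * ?c k / ?\<mu>)\<^sup>2 \<le> (A\<^sup>2 / ?\<mu>) * ?c k" .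
      moreover have "0 \<le> 9/4 * (x $ k)\<^sup>2 + 5 * L * ((ratio k)\<^sup>2 * p k) / ?\<mu> + 10/3 * L * (A\<^sup>2 * ?c k) / ?\<mu>\<^sup>2"
        using L p_nonneg c m0 by (intro add_nonneg_nonneg divide_nonneg_nonneg mult_nonneg_nonneg) auto
      ultimately show ?thesis using True by simp
    next
      case False
      \<comment> \<open>The threshold is inserted a second time only into the part containing p. The
        part 10/3 L c k stays linear, because the counts sum to m; bounding it by L^2 for each index
        would cost a factor d.\<close>
      have "?c k * ?c k \<le> (3/2 * ?\<mu> * p k + 10/3 * L) * ?c k"
        using False c by (intro mult_right_mono) (auto simp: threshold_def)
      also have "\<dots> = 3/2 * ?\<mu> * p k * ?c k + 10/3 * L * ?c k" by (simp add: algebra_simps)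
      also have "3/2 * ?\<mu> * p k * ?c k \<le> 3/2 * ?\<mu> * p k * (3/2 * ?\<mu> * p k + 10/3 * L)"
        using False p_nonneg[of k] by (intro mult_left_mono) (auto simp: threshold_def)
      finally have "(ratio k)\<^sup>2 * (?c k * ?c k)
         \<le> (ratio k)\<^sup>2 * (3/2 * ?\<mu> * p k * (3/2 * ?\<mu> * p k + 10/3 * L) + 10/3 * L * ?c k)"
        by (intro mult_left_mono) auto
      also have "\<dots> = 9/4 * ?\<mu>\<^sup>2 * (x $ k)\<^sup>2 + 5 * L * ((ratio k)\<^sup>2 * p k) * ?\<mu> + 10/3 * L * ((ratio k)\<^sup>2 * ?c k)"
        unfolding x2[symmetric] by (simp add: algebra_simps power2_eq_square)
      also have "10/3 * L * ((ratio k)\<^sup>2 * ?c k) \<le> 10/3 * L * (A\<^sup>2 * ?c k)"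
        using L c ratio_sq_le by (intro mult_left_mono mult_right_mono) auto
      finally have "(ratio k)\<^sup>2 * (?c k * ?c k) / ?\<mu>\<^sup>2
         \<le> (9/4 * ?\<mu>\<^sup>2 * (x $ k)\<^sup>2 + 5 * L * ((ratio k)\<^sup>2 * p k) * ?\<mu> + 10/3 * L * (A\<^sup>2 * ?c k)) / ?\<mu>\<^sup>2"
        by (intro divide_right_mono) auto
      also have "\<dots> = 9/4 * (x $ k)\<^sup>2 + 5 * L * ((ratio k)\<^sup>2 * p k) / ?\<mu> + 10/3 * L * (A\<^sup>2 * ?c k) / ?\<mu>\<^sup>2"
        using m0 by (simp add: add_divide_distrib power2_eq_square)
      finally show ?thesis using False unfolding y2 by simp
    qed
  qed
  then have "y_sq ?c \<le> (\<Sum>k\<in>UNIV. 9/4 * (x $ k)\<^sup>2 + 5 * L * ((ratio k)\<^sup>2 * p k) / ?\<mu>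
      + 10/3 * L * (A\<^sup>2 * ?c k) / ?\<mu>\<^sup>2 + (A\<^sup>2 / ?\<mu>) * (?c k * of_bool (?c k > threshold L k)))"
    unfolding y_sq_def by (intro sum_mono)
  also have "\<dots> = 9/4 * (\<Sum>k\<in>UNIV. (x $ k)\<^sup>2) + 5 * L * (\<Sum>k\<in>UNIV. (ratio k)\<^sup>2 * p k) / ?\<mu>
      + 10/3 * L * (A\<^sup>2 * (\<Sum>k\<in>UNIV. ?c k)) / ?\<mu>\<^sup>2
      + (\<Sum>k\<in>UNIV. (A\<^sup>2 / ?\<mu>) * (?c k * of_bool (?c k > threshold L k)))"
    by (simp only: sum.distrib sum_distrib_left sum_divide_distrib)
  also have "(\<Sum>k\<in>UNIV. (x $ k)\<^sup>2) = (norm x)\<^sup>2" by (rule norm_sq_cart[symmetric])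
  also have "10/3 * L * (A\<^sup>2 * (\<Sum>k\<in>UNIV. ?c k)) / ?\<mu>\<^sup>2 = 10/3 * L * A\<^sup>2 / ?\<mu>"
    using m0 by (simp add: sum_cnt power2_eq_square)
  also have "5 * L * (\<Sum>k\<in>UNIV. (ratio k)\<^sup>2 * p k) / ?\<mu> \<le> 5 * L * A\<^sup>2 / ?\<mu>"
    using A2 L m0 by (intro divide_right_mono mult_left_mono) auto
  finally show ?thesis by (simp add: y_cap_def algebra_simps)
qed

lemma y_sq_good: "good L (cnt m f) \<Longrightarrow> y_sq (cnt m f) \<le> y_cap L A"
  using y_sq_le_exceed[of f] by (auto simp: good_def not_less[symmetric])

lemma y_sq_bad_mean:
  "mult_exp p m (\<lambda>c. y_sq c * of_bool (\<not> good L c))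
     \<le> real CARD('d) * exp (- 2 * L) * (y_cap L A + 25 * (A\<^sup>2 / real m))"
proof -
  let ?a = "A\<^sup>2 / real m"
  have cap: "y_cap L A \<ge> 0" using L by (simp add: y_cap_def)
  have "mult_exp p m (\<lambda>c. y_sq c * of_bool (\<not> good L c))
     \<le> mult_exp p m (\<lambda>c. y_cap L A * of_bool (\<not> good L c)
         + (\<Sum>k\<in>UNIV. ?a * (c k * of_bool (c k > threshold L k))))"
  proof (rule mult_exp_mono)
    fix f
    have "0 \<le> (\<Sum>k\<in>UNIV. ?a * (cnt m f k * of_bool (cnt m f k > threshold L k)))"
      by (intro sum_nonneg) (auto simp: cnt_nonneg)
    then show "y_sq (cnt m f) * of_bool (\<not> good L (cnt m f)) \<le> y_cap L A * of_bool (\<not> good L (cnt m f))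
         + (\<Sum>k\<in>UNIV. ?a * (cnt m f k * of_bool (cnt m f k > threshold L k)))"
      using y_sq_le_exceed[of f] by (cases "good L (cnt m f)") auto
  qed
  also have "\<dots> \<le> y_cap L A * (real CARD('d) * exp (- 2 * L)) + (\<Sum>k\<in>(UNIV :: 'd set). ?a * (25 * exp (- 2 * L)))"
    unfolding mult_exp_add mult_exp_cmult mult_exp_sum
    by (intro add_mono mult_left_mono sum_mono prob_bad_le cnt_exceed_le cap) auto
  also have "\<dots> = real CARD('d) * exp (- 2 * L) * (y_cap L A + 25 * ?a)" by (simp add: algebra_simps)
  finally show ?thesis .
qed

end

text \<open>The form equals m / (m - 1) times a difference of two terms, the square of y inner v and
  the diagonal correction \<open>S\<close>. Both lie between 0 and the same bound, so the difference
  costs no extra factor, and m / (m - 1) <= 2.\<close>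

lemma Y_mat_quad: "\<bar>v \<bullet> (Y_mat c *v v)\<bar> \<le> 2 * y_sq c * (norm v)\<^sup>2"
proof -
  let ?\<mu> = "real m"
  define y where "y = (\<chi> k. ratio k * c k / ?\<mu>)"
  have m0: "?\<mu> \<ge> 2" using m by simp
  have y2: "y_sq c = (norm y)\<^sup>2" by (simp add: y_sq_def y_def norm_sq_cart)
  have lin: "lin (coef v k) c = ?\<mu> * (y \<bullet> v) - ratio k * c k * shrink k * v $ k" for k
  proof -
    have "lin (coef v k) c = (\<Sum>l\<in>UNIV. ?\<mu> * (y $ l * v $ l) - (if l = k then ratio k * c k * shrink k * v $ k else 0))"
      unfolding lin_def using m0 by (intro sum.cong) (auto simp: coef_def y_def algebra_simps)
    then show ?thesis by (simp add: sum_subtractf sum_distrib_left[symmetric] inner_vec_def)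
  qed
  define S where "S = (\<Sum>k\<in>UNIV. shrink k * (y $ k * v $ k)\<^sup>2)"
  have "v \<bullet> (Y_mat c *v v) = (\<Sum>k\<in>UNIV. ?\<mu> / (?\<mu> - 1) * ((y \<bullet> v) * (y $ k * v $ k) - shrink k * (y $ k * v $ k)\<^sup>2))"
    unfolding inner_vec_def[of v] Y_mat_mult lin using m0
    by (intro sum.cong) (auto simp: y_def field_simps power2_eq_square)
  also have "\<dots> = ?\<mu> / (?\<mu> - 1) * ((y \<bullet> v)\<^sup>2 - S)"
  proof -
    have "(\<Sum>k\<in>UNIV. y $ k * v $ k) = y \<bullet> v" by (simp add: inner_vec_def)
    then show ?thesis
      by (simp only: sum_distrib_left[symmetric] sum_subtractf S_def[symmetric]) (simp add: power2_eq_square)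
  qed
  finally have eq: "v \<bullet> (Y_mat c *v v) = ?\<mu> / (?\<mu> - 1) * ((y \<bullet> v)\<^sup>2 - S)" .
  have S0: "S \<ge> 0" unfolding S_def using shrink_pos by (intro sum_nonneg) (simp add: less_imp_le)
  have S1: "S \<le> (norm y)\<^sup>2 * (norm v)\<^sup>2"
  proof -
    have "S \<le> (\<Sum>k\<in>UNIV. (norm y)\<^sup>2 * (v $ k)\<^sup>2)" unfolding S_def
    proof (rule sum_mono)
      fix k
      have "shrink k * (y $ k * v $ k)\<^sup>2 \<le> 1 * (y $ k * v $ k)\<^sup>2"
        using shrink_le by (rule mult_right_mono) simp
      also have "\<dots> \<le> (norm y)\<^sup>2 * (v $ k)\<^sup>2"
        using component_le_norm_cart[of y k]
        by (simp add: power_mult_distrib abs_le_square_iff[symmetric] mult_right_mono)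
      finally show "shrink k * (y $ k * v $ k)\<^sup>2 \<le> (norm y)\<^sup>2 * (v $ k)\<^sup>2" .
    qed
    also have "\<dots> = (norm y)\<^sup>2 * (norm v)\<^sup>2"
      by (simp add: sum_distrib_left[symmetric] norm_sq_cart[of v])
    finally show ?thesis .
  qed
  have yv: "(y \<bullet> v)\<^sup>2 \<le> (norm y)\<^sup>2 * (norm v)\<^sup>2"
    using power_mono[OF Cauchy_Schwarz_ineq2[of y v] abs_ge_zero, of 2] by (simp add: power_mult_distrib)
  have "\<bar>v \<bullet> (Y_mat c *v v)\<bar> = ?\<mu> / (?\<mu> - 1) * \<bar>(y \<bullet> v)\<^sup>2 - S\<bar>"
    using m0 by (simp add: eq abs_mult)
  also have "\<dots> \<le> 2 * ((norm y)\<^sup>2 * (norm v)\<^sup>2)"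
  proof (rule mult_mono)
    show "?\<mu> / (?\<mu> - 1) \<le> 2" using m0 by (simp add: field_simps)
    show "\<bar>(y \<bullet> v)\<^sup>2 - S\<bar> \<le> (norm y)\<^sup>2 * (norm v)\<^sup>2"
      using S0 S1 yv zero_le_power2[of "y \<bullet> v"] by linarith
  qed auto
  finally show ?thesis by (simp add: y2)
qed

end

section \<open>Centring a truncated random matrix\<close>

lemma outer_mult: "outer u v *v w = (v \<bullet> w) *\<^sub>R u"
  by (simp add: outer_def matrix_vector_mult_def vec_eq_iff inner_vec_def sum_distrib_left mult_ac)

lemma sym_mat_outer: "sym_mat (outer x x)"
  by (simp add: sym_mat_def outer_def transpose_def mult.commute)

lemma sum_diff_mean_sq_le:
  fixes u :: "'a \<Rightarrow> 'b::real_inner"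
  assumes "(\<Sum>a\<in>\<Omega>. w a) = 1"
  shows "(\<Sum>a\<in>\<Omega>. w a * (norm (u a - (\<Sum>a\<in>\<Omega>. w a *\<^sub>R u a)))\<^sup>2) \<le> (\<Sum>a\<in>\<Omega>. w a * (norm (u a))\<^sup>2)"
proof -
  define b where "b = (\<Sum>a\<in>\<Omega>. w a *\<^sub>R u a)"
  have "(\<Sum>a\<in>\<Omega>. w a * (norm (u a - b))\<^sup>2)
     = (\<Sum>a\<in>\<Omega>. w a * (norm (u a))\<^sup>2 - 2 * ((w a *\<^sub>R u a) \<bullet> b) + w a * (norm b)\<^sup>2)"
    by (intro sum.cong refl)
       (simp add: power2_norm_eq_inner inner_diff_left inner_diff_right inner_commute algebra_simps)
  also have "\<dots> = (\<Sum>a\<in>\<Omega>. w a * (norm (u a))\<^sup>2) - 2 * (b \<bullet> b) + (\<Sum>a\<in>\<Omega>. w a) * (norm b)\<^sup>2"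
    by (simp add: sum.distrib sum_subtractf sum_distrib_left[symmetric] sum_distrib_right[symmetric]
        inner_sum_left b_def del: inner_scaleR_left)
  also have "\<dots> \<le> (\<Sum>a\<in>\<Omega>. w a * (norm (u a))\<^sup>2)"
    using assms by (simp add: power2_norm_eq_inner)
  finally show ?thesis by (simp add: b_def)
qed

text \<open>Truncation to a good event: the mean of the truncated matrix is a bias of size \<open>\<beta>\<close>,
  which is subtracted so that Bernstein's inequality applies.\<close>

locale truncated_matrix =
  fixes \<Omega> :: "'a set" and w :: "'a \<Rightarrow> real" and Z :: "'a \<Rightarrow> real^'n^'n"
    and g :: "'a \<Rightarrow> bool" and h :: "'a \<Rightarrow> real" and r \<beta> :: real
  assumes w_nonneg: "\<And>a. a \<in> \<Omega> \<Longrightarrow> w a \<ge> 0" and w_sum: "(\<Sum>a\<in>\<Omega>. w a) = 1"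
    and Z_sym: "\<And>a. a \<in> \<Omega> \<Longrightarrow> sym_mat (Z a)"
    and Z_mean: "(\<Sum>a\<in>\<Omega>. w a *\<^sub>R Z a) = 0"
    and Z_quad: "\<And>a v. a \<in> \<Omega> \<Longrightarrow> \<bar>v \<bullet> (Z a *v v)\<bar> \<le> h a * (norm v)\<^sup>2"
    and r: "r \<ge> 0" and h_le: "\<And>a. a \<in> \<Omega> \<Longrightarrow> g a \<Longrightarrow> h a \<le> r"
    and bias: "(\<Sum>a\<in>\<Omega>. w a * (h a * of_bool (\<not> g a))) \<le> \<beta>"
begin

definition B :: "real^'n^'n" where
  "B = (\<Sum>a\<in>\<Omega>. w a *\<^sub>R (of_bool (g a) *\<^sub>R Z a))"

definition X :: "'a \<Rightarrow> real^'n^'n" where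
  "X a = of_bool (g a) *\<^sub>R Z a - B"

lemma B_sym: "sym_mat B"
  unfolding B_def by (intro sym_mat_sum sym_mat_scaleR Z_sym)

lemma X_sym: "a \<in> \<Omega> \<Longrightarrow> sym_mat (X a)"
  unfolding X_def by (intro sym_mat_diff sym_mat_scaleR Z_sym B_sym)

lemma X_mean: "(\<Sum>a\<in>\<Omega>. w a *\<^sub>R X a) = 0"
  by (simp add: X_def scaleR_diff_right sum_subtractf B_def[symmetric] scaleR_sum_left[symmetric] w_sum
      del: scaleR_scaleR)

text \<open>As Z has mean zero, the mean of the retained part is minus the mean of the discarded
  part, which \<open>bias\<close> controls.\<close>

lemma B_quad: "\<bar>v \<bullet> (B *v v)\<bar> \<le> \<beta> * (norm v)\<^sup>2"
proof -
  have "B + (\<Sum>a\<in>\<Omega>. w a *\<^sub>R (of_bool (\<not> g a) *\<^sub>R Z a)) = (\<Sum>a\<in>\<Omega>. w a *\<^sub>R Z a)"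
    unfolding B_def sum.distrib[symmetric] by (intro sum.cong) auto
  then have "B = - (\<Sum>a\<in>\<Omega>. w a *\<^sub>R (of_bool (\<not> g a) *\<^sub>R Z a))" by (simp add: Z_mean eq_neg_iff_add_eq_0)
  then have "B = (- 1) *\<^sub>R (\<Sum>a\<in>\<Omega>. w a *\<^sub>R (of_bool (\<not> g a) *\<^sub>R Z a))" by simp
  then have "v \<bullet> (B *v v) = - (\<Sum>a\<in>\<Omega>. w a * (of_bool (\<not> g a) * (v \<bullet> (Z a *v v))))"
    by (simp only: matrix_vector_mult_scaleR_left matrix_vector_mult_sum_left inner_sum_right inner_scaleR_right)
  then have "\<bar>v \<bullet> (B *v v)\<bar> \<le> (\<Sum>a\<in>\<Omega>. \<bar>w a * (of_bool (\<not> g a) * (v \<bullet> (Z a *v v)))\<bar>)" by simp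
  also have "\<dots> \<le> (\<Sum>a\<in>\<Omega>. w a * (h a * of_bool (\<not> g a)) * (norm v)\<^sup>2)"
  proof (rule sum_mono)
    fix a assume a: "a \<in> \<Omega>"
    have "w a * \<bar>v \<bullet> (Z a *v v)\<bar> \<le> w a * (h a * (norm v)\<^sup>2)"
      using a by (intro mult_left_mono Z_quad w_nonneg)
    then show "\<bar>w a * (of_bool (\<not> g a) * (v \<bullet> (Z a *v v)))\<bar> \<le> w a * (h a * of_bool (\<not> g a)) * (norm v)\<^sup>2"
      using w_nonneg[OF a] by (cases "g a") (auto simp: abs_mult mult_ac)
  qed
  also have "\<dots> \<le> \<beta> * (norm v)\<^sup>2"
    unfolding sum_distrib_right[symmetric] by (intro mult_right_mono bias) auto
  finally show ?thesis .
qed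

lemma X_bound:
  assumes a: "a \<in> \<Omega>"
  shows "norm (X a *v v) \<le> (r + \<beta>) * norm v"
proof (rule sym_mat_norm_le[OF X_sym[OF a]])
  fix v :: "real^'n"
  have 1: "\<bar>v \<bullet> ((of_bool (g a) *\<^sub>R Z a) *v v)\<bar> \<le> r * (norm v)\<^sup>2"
    using Z_quad[OF a, of v] mult_right_mono[OF h_le[OF a], of "(norm v)\<^sup>2"] r by (cases "g a") auto
  have "v \<bullet> (X a *v v) = v \<bullet> ((of_bool (g a) *\<^sub>R Z a) *v v) - v \<bullet> (B *v v)"
    by (simp add: X_def matrix_vector_mult_diff_rdistrib inner_diff_right)
  then show "\<bar>v \<bullet> (X a *v v)\<bar> \<le> (r + \<beta>) * (norm v)\<^sup>2"
    using 1 B_quad[of v] by (simp add: distrib_right)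
qed

text \<open>Centring and truncation each lower the second moment, so the variance can be computed
  for the full matrix Z.\<close>

lemma X_var: "(\<Sum>a\<in>\<Omega>. w a * (norm (X a *v v))\<^sup>2) \<le> (\<Sum>a\<in>\<Omega>. w a * (norm (Z a *v v))\<^sup>2)"
proof -
  have "B *v v = (\<Sum>a\<in>\<Omega>. w a *\<^sub>R ((of_bool (g a) *\<^sub>R Z a) *v v))"
    unfolding B_def matrix_vector_mult_sum_left by (simp only: matrix_vector_mult_scaleR_left)
  then have "(\<Sum>a\<in>\<Omega>. w a * (norm (X a *v v))\<^sup>2) \<le> (\<Sum>a\<in>\<Omega>. w a * (norm ((of_bool (g a) *\<^sub>R Z a) *v v))\<^sup>2)"
    using sum_diff_mean_sq_le[OF w_sum, of "\<lambda>a. (of_bool (g a) *\<^sub>R Z a) *v v"]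
    by (simp add: X_def matrix_vector_mult_diff_rdistrib)
  also have "\<dots> \<le> (\<Sum>a\<in>\<Omega>. w a * (norm (Z a *v v))\<^sup>2)"
    by (intro sum_mono mult_left_mono w_nonneg) (auto simp: matrix_vector_mult_scaleR_left)
  finally show ?thesis .
qed

end

lemma mult_exp_eq_sum:
  "mult_exp p m G = (\<Sum>f\<in>PiE {..<m} (\<lambda>_. UNIV). (\<Prod>j<m. p (f j)) * G (cnt m f))"
  by (simp add: mult_exp_def prod_exp_def)

section \<open>Centred contribution of one column\<close>

context column_sampling
begin

lemma Y_mat_sym: "sym_mat (Y_mat c)"
  by (auto simp: sym_mat_def Y_mat_def transpose_def vec_eq_iff mult_ac)

definition Z_mat :: "real \<Rightarrow> ('d \<Rightarrow> real) \<Rightarrow> real^'d^'d" where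
  "Z_mat \<nu> c = (1 / \<nu>) *\<^sub>R (Y_mat c - outer x x)"

lemma Z_mat_sym: "sym_mat (Z_mat \<nu> c)"
  unfolding Z_mat_def by (intro sym_mat_scaleR sym_mat_diff Y_mat_sym sym_mat_outer)

lemma Z_mat_mult: "Z_mat \<nu> c *v v = (1 / \<nu>) *\<^sub>R (Y_mat c *v v - (x \<bullet> v) *\<^sub>R x)"
  by (simp add: Z_mat_def matrix_vector_mult_scaleR_left matrix_vector_mult_diff_rdistrib outer_mult)

lemma Z_mat_mean: "(\<Sum>f\<in>PiE {..<m} (\<lambda>_. UNIV). (\<Prod>j<m. p (f j)) *\<^sub>R Z_mat \<nu> (cnt m f)) = 0"
proof -
  let ?S = "\<Sum>f\<in>PiE {..<m} (\<lambda>_. UNIV). (\<Prod>j<m. p (f j)) *\<^sub>R Z_mat \<nu> (cnt m f)"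
  have "(?S *v v) $ k = 0" for v k
  proof -
    have "(?S *v v) $ k = mult_exp p m (\<lambda>c. (Z_mat \<nu> c *v v) $ k)"
      unfolding mult_exp_eq_sum matrix_vector_mult_sum_left
      by (simp add: matrix_vector_mult_scaleR_left)
    also have "\<dots> = mult_exp p m (\<lambda>c. (1 / \<nu>) * ((Y_mat c *v v) $ k + (- ((x \<bullet> v) * x $ k))))"
      by (simp add: Z_mat_mult)
    also have "\<dots> = 0"
      unfolding mult_exp_cmult mult_exp_add mult_exp_const Y_mat_mean by simp
    finally show ?thesis .
  qed
  then have "?S *v v = 0 *v v" for v by (simp add: vec_eq_iff)
  then show ?thesis by (subst matrix_eq) blast
qed

lemma Z_mat_quad:
  assumes "\<nu> > 0"
  shows "\<bar>v \<bullet> (Z_mat \<nu> c *v v)\<bar> \<le> (2 * y_sq c + (norm x)\<^sup>2) / \<nu> * (norm v)\<^sup>2"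
proof -
  have xv: "(x \<bullet> v)\<^sup>2 \<le> (norm x)\<^sup>2 * (norm v)\<^sup>2"
    using power_mono[OF Cauchy_Schwarz_ineq2[of x v] abs_ge_zero, of 2] by (simp add: power_mult_distrib)
  have "v \<bullet> (Z_mat \<nu> c *v v) = (v \<bullet> (Y_mat c *v v) - (x \<bullet> v)\<^sup>2) / \<nu>"
    by (simp add: Z_mat_mult inner_diff_right power2_eq_square inner_commute)
  then have "\<bar>v \<bullet> (Z_mat \<nu> c *v v)\<bar> = \<bar>v \<bullet> (Y_mat c *v v) - (x \<bullet> v)\<^sup>2\<bar> / \<nu>" using assms by simp
  also have "\<dots> \<le> (2 * y_sq c * (norm v)\<^sup>2 + (norm x)\<^sup>2 * (norm v)\<^sup>2) / \<nu>"
  proof (rule divide_right_mono)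
    show "\<bar>v \<bullet> (Y_mat c *v v) - (x \<bullet> v)\<^sup>2\<bar> \<le> 2 * y_sq c * (norm v)\<^sup>2 + (norm x)\<^sup>2 * (norm v)\<^sup>2"
      using Y_mat_quad[of v c] xv zero_le_power2[of "x \<bullet> v"] by linarith
  qed (use assms in simp)
  also have "\<dots> = (2 * y_sq c + (norm x)\<^sup>2) / \<nu> * (norm v)\<^sup>2" by (simp add: algebra_simps)
  finally show ?thesis .
qed

text \<open>Variance as second moment minus squared mean: the subtraction removes precisely the
  leading term of \<open>Y_mat_var\<close>.\<close>

lemma Z_mat_var:
  assumes \<kappa>: "\<And>k. (ratio k)\<^sup>2 * p k \<le> \<kappa>" and N1: "(\<Sum>k\<in>UNIV. (ratio k)\<^sup>2 * p k) \<le> N1"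
  shows "mult_exp p m (\<lambda>c. (norm (Z_mat \<nu> c *v v))\<^sup>2) \<le> (1 / \<nu>\<^sup>2) * (N1 / real m * (x \<bullet> v)\<^sup>2
    + (8 * \<kappa>\<^sup>2 / (real m)\<^sup>2 + 2 * N1 * \<kappa> / (real m)\<^sup>2 + 9 * \<kappa> * (norm x)\<^sup>2 / real m) * (norm v)\<^sup>2)"
proof -
  let ?\<xi> = "x \<bullet> v"
  have "(norm (Z_mat \<nu> c *v v))\<^sup>2 = (1 / \<nu>\<^sup>2) * (\<Sum>k\<in>UNIV. ((Y_mat c *v v) $ k)\<^sup>2
      + (- 2 * ?\<xi> * x $ k) * (Y_mat c *v v) $ k + ?\<xi>\<^sup>2 * (x $ k)\<^sup>2)" for c
    unfolding Z_mat_mult norm_sq_cart sum_distrib_left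
    by (intro sum.cong refl) (simp add: power_divide power2_diff power_mult_distrib algebra_simps, simp add: power2_eq_square)
  then have "mult_exp p m (\<lambda>c. (norm (Z_mat \<nu> c *v v))\<^sup>2)
    = (1 / \<nu>\<^sup>2) * (\<Sum>k\<in>UNIV. mult_exp p m (\<lambda>c. ((Y_mat c *v v) $ k)\<^sup>2)
        + (- 2 * ?\<xi> * x $ k) * (x $ k * ?\<xi>) + ?\<xi>\<^sup>2 * (x $ k)\<^sup>2)"
    by (simp only: mult_exp_cmult mult_exp_add mult_exp_sum mult_exp_const Y_mat_mean)
  also have "\<dots> = (1 / \<nu>\<^sup>2) * ((\<Sum>k\<in>UNIV. mult_exp p m (\<lambda>c. ((Y_mat c *v v) $ k)\<^sup>2)) - (norm x)\<^sup>2 * ?\<xi>\<^sup>2)"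
  proof -
    have "(\<Sum>k\<in>UNIV. (- 2 * ?\<xi> * x $ k) * (x $ k * ?\<xi>) + ?\<xi>\<^sup>2 * (x $ k)\<^sup>2) = - ((norm x)\<^sup>2 * ?\<xi>\<^sup>2)"
      unfolding norm_sq_cart sum_distrib_right sum_negf[symmetric]
      by (intro sum.cong refl) (simp add: power2_eq_square)
    then show ?thesis by (simp only: sum.distrib add.assoc diff_conv_add_uminus)
  qed
  also have "\<dots> \<le> (1 / \<nu>\<^sup>2) * (N1 / real m * ?\<xi>\<^sup>2
    + (8 * \<kappa>\<^sup>2 / (real m)\<^sup>2 + 2 * N1 * \<kappa> / (real m)\<^sup>2 + 9 * \<kappa> * (norm x)\<^sup>2 / real m) * (norm v)\<^sup>2)"
    using Y_mat_var[OF \<kappa> N1, of v] by (intro mult_left_mono) auto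
  finally show ?thesis .
qed

lemma Z_mat_truncated:
  fixes L A :: real
  assumes \<nu>: "\<nu> > 0" and L: "L \<ge> 0" and A: "\<And>k. \<bar>ratio k\<bar> \<le> A"
    and A2: "(\<Sum>k\<in>UNIV. (ratio k)\<^sup>2 * p k) \<le> A\<^sup>2"
  shows "truncated_matrix (PiE {..<m} (\<lambda>_. UNIV)) (\<lambda>f. \<Prod>j<m. p (f j)) (\<lambda>f. Z_mat \<nu> (cnt m f))
    (\<lambda>f. good L (cnt m f)) (\<lambda>f. (2 * y_sq (cnt m f) + (norm x)\<^sup>2) / \<nu>) ((2 * y_cap L A + (norm x)\<^sup>2) / \<nu>)
    (real CARD('d) * exp (- 2 * L) * (2 * y_cap L A + 50 * (A\<^sup>2 / real m) + (norm x)\<^sup>2) / \<nu>)"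
proof
  show "(\<Sum>f\<in>PiE {..<m} (\<lambda>_. UNIV). \<Prod>j<m. p (f j)) = 1"
    using mult_exp_const[of m 1] by (simp add: mult_exp_eq_sum)
  show "0 \<le> (2 * y_cap L A + (norm x)\<^sup>2) / \<nu>" using L \<nu> by (simp add: y_cap_def)
  show "(2 * y_sq (cnt m f) + (norm x)\<^sup>2) / \<nu> \<le> (2 * y_cap L A + (norm x)\<^sup>2) / \<nu>" if "good L (cnt m f)" for f
    using y_sq_good[OF L A A2 that] \<nu> by (intro divide_right_mono) auto
  let ?D = "real CARD('d) * exp (- 2 * L)"
  have "(\<Sum>f\<in>PiE {..<m} (\<lambda>_. UNIV). (\<Prod>j<m. p (f j)) * ((2 * y_sq (cnt m f) + (norm x)\<^sup>2) / \<nu> * of_bool (\<not> good L (cnt m f))))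
    = mult_exp p m (\<lambda>c. (1 / \<nu>) * (2 * (y_sq c * of_bool (\<not> good L c)) + (norm x)\<^sup>2 * of_bool (\<not> good L c)))"
    unfolding mult_exp_eq_sum by (intro sum.cong refl) (simp add: algebra_simps add_divide_distrib)
  also have "\<dots> \<le> (1 / \<nu>) * (2 * (?D * (y_cap L A + 25 * (A\<^sup>2 / real m))) + (norm x)\<^sup>2 * ?D)"
    unfolding mult_exp_cmult mult_exp_add
    using \<nu> y_sq_bad_mean[OF L A A2] prob_bad_le[of L]
    by (intro mult_left_mono add_mono) auto
  also have "\<dots> = ?D * (2 * y_cap L A + 50 * (A\<^sup>2 / real m) + (norm x)\<^sup>2) / \<nu>" by (simp add: algebra_simps add_divide_distrib)
  finally show "(\<Sum>f\<in>PiE {..<m} (\<lambda>_. UNIV). (\<Prod>j<m. p (f j)) * ((2 * y_sq (cnt m f) + (norm x)\<^sup>2) / \<nu> * of_bool (\<not> good L (cnt m f))))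
    \<le> ?D * (2 * y_cap L A + 50 * (A\<^sup>2 / real m) + (norm x)\<^sup>2) / \<nu>" .
qed (use p_nonneg Z_mat_sym Z_mat_mean Z_mat_quad[OF \<nu>] in \<open>auto intro: prod_nonneg\<close>)

end

section \<open>The DACE estimator\<close>

lemma norm1_pos: "v \<noteq> 0 \<Longrightarrow> norm1 v > 0"
  unfolding norm1_def vec_eq_iff by (auto intro!: sum_pos2)

section \<open>Bounds for the DACE sampling probabilities\<close>

context
  fixes x :: "nat \<Rightarrow> real^'d" and i m :: nat and \<alpha> :: real
  assumes x: "x i \<noteq> 0" and m: "m \<ge> 2" and \<alpha>: "0 < \<alpha>" "\<alpha> < 1"
begin

lemma samp_p_ge:
  "\<alpha> * \<bar>x i $ k\<bar> / norm1 (x i) \<le> samp_p \<alpha> x k i"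
  "(1 - \<alpha>) * (x i $ k)\<^sup>2 / (norm (x i))\<^sup>2 \<le> samp_p \<alpha> x k i"
  using norm1_pos[OF x] \<alpha> by (auto simp: samp_p_def)

lemma column_sampling_samp_p: "column_sampling (\<lambda>k. samp_p \<alpha> x k i) (x i) m"
proof
  show "samp_p \<alpha> x k i \<ge> 0" for k
    using norm1_pos[OF x] \<alpha> by (auto simp: samp_p_def)
  have "(\<Sum>k\<in>UNIV. samp_p \<alpha> x k i) = \<alpha> * (\<Sum>k\<in>UNIV. \<bar>x i $ k\<bar>) / norm1 (x i)
      + (1 - \<alpha>) * (\<Sum>k\<in>UNIV. (x i $ k)\<^sup>2) / (norm (x i))\<^sup>2"
    by (simp only: samp_p_def sum.distrib sum_distrib_left sum_divide_distrib)
  also have "\<dots> = 1"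
    using norm1_pos[OF x] x by (simp add: norm1_def[symmetric] norm_sq_cart[symmetric])
  finally show "(\<Sum>k\<in>UNIV. samp_p \<alpha> x k i) = 1" .
  show "x i $ k = 0" if "samp_p \<alpha> x k i = 0" for k
  proof -
    have "\<alpha> * \<bar>x i $ k\<bar> / norm1 (x i) \<le> 0" using samp_p_ge(1)[of k] that by simp
    then show ?thesis using norm1_pos[OF x] \<alpha> by (simp add: divide_le_0_iff mult_le_0_iff)
  qed
qed (rule m)

interpretation column_sampling "\<lambda>k. samp_p \<alpha> x k i" "x i" m
  by (rule column_sampling_samp_p)

lemma abs_ratio_le: "\<bar>ratio k\<bar> \<le> norm1 (x i) / \<alpha>"
proof (cases "x i $ k = 0")
  case False
  have n: "norm1 (x i) > 0" by (rule norm1_pos[OF x])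
  have "samp_p \<alpha> x k i > 0" using p_nonneg[of k] p_zero[of k] False by (auto simp: less_le)
  then show ?thesis
    using samp_p_ge(1)[of k] n \<alpha> by (simp add: ratio_def field_simps)
qed (use norm1_pos[OF x] \<alpha> in \<open>simp add: ratio_def\<close>)

lemma ratio_sq_p_le: "(ratio k)\<^sup>2 * samp_p \<alpha> x k i \<le> (norm (x i))\<^sup>2 / (1 - \<alpha>)"
proof (cases "x i $ k = 0")
  case False
  have "samp_p \<alpha> x k i > 0" using p_nonneg[of k] p_zero[of k] False by (auto simp: less_le)
  then have pos: "samp_p \<alpha> x k i > 0" .
  then have "(ratio k)\<^sup>2 * samp_p \<alpha> x k i = (x i $ k)\<^sup>2 / samp_p \<alpha> x k i"
    by (simp add: ratio_def power2_eq_square)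
  also have "\<dots> \<le> (x i $ k)\<^sup>2 / ((1 - \<alpha>) * (x i $ k)\<^sup>2 / (norm (x i))\<^sup>2)"
    using samp_p_ge(2)[of k] pos False x \<alpha>
    by (intro divide_left_mono divide_pos_pos mult_pos_pos) auto
  also have "\<dots> = (norm (x i))\<^sup>2 / (1 - \<alpha>)" using False by simp
  finally show ?thesis .
qed (use \<alpha> in \<open>simp add: ratio_def\<close>)

text \<open>One factor \<open>ratio k\<close> is bounded uniformly, the other is absorbed by p into
  |x_k|; summing gives a second l1 norm.\<close>

lemma sum_ratio_sq_p_le: "(\<Sum>k\<in>UNIV. (ratio k)\<^sup>2 * samp_p \<alpha> x k i) \<le> (norm1 (x i))\<^sup>2 / \<alpha>"
proof -
  have "(ratio k)\<^sup>2 * samp_p \<alpha> x k i \<le> norm1 (x i) / \<alpha> * \<bar>x i $ k\<bar>" for k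
  proof -
    have "(ratio k)\<^sup>2 * samp_p \<alpha> x k i = \<bar>ratio k\<bar> * \<bar>samp_p \<alpha> x k i * ratio k\<bar>"
      using p_nonneg[of k] by (simp add: abs_mult power2_eq_square mult_ac)
    also have "\<dots> \<le> norm1 (x i) / \<alpha> * \<bar>x i $ k\<bar>"
      unfolding p_ratio by (intro mult_right_mono abs_ratio_le) auto
    finally show ?thesis .
  qed
  then have "(\<Sum>k\<in>UNIV. (ratio k)\<^sup>2 * samp_p \<alpha> x k i) \<le> (\<Sum>k\<in>UNIV. norm1 (x i) / \<alpha> * \<bar>x i $ k\<bar>)"
    by (intro sum_mono)
  also have "\<dots> = norm1 (x i) / \<alpha> * norm1 (x i)" by (simp only: sum_distrib_left norm1_def[of "x i"])
  finally show ?thesis by (simp add: power2_eq_square)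
qed

lemma sum_ratio_sq_p_le': "(\<Sum>k\<in>UNIV. (ratio k)\<^sup>2 * samp_p \<alpha> x k i) \<le> (norm1 (x i) / \<alpha>)\<^sup>2"
proof -
  have "(norm1 (x i))\<^sup>2 / \<alpha> \<le> (norm1 (x i))\<^sup>2 / \<alpha>\<^sup>2"
    using \<alpha> by (intro divide_left_mono) (auto simp: power2_eq_square mult_left_le)
  then show ?thesis using sum_ratio_sq_p_le by (simp add: power_divide)
qed

lemma SSt_nth:
  "SSt \<alpha> x m T i $ a $ b = (if a = b then cnt m (\<lambda>j. T (j, i)) a / (real m * samp_p \<alpha> x a i) else 0)"
proof -
  have sq: "(sqrt (real m * samp_p \<alpha> x k i))\<^sup>2 = real m * samp_p \<alpha> x k i" for k
    using p_nonneg[of k] by simp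
  have "outer (S_col \<alpha> x m T i j) (S_col \<alpha> x m T i j) $ a $ b
     = (if a = b then of_bool (T (j, i) = a) / (real m * samp_p \<alpha> x a i) else 0)" for j
    using sq[of "T (j, i)"] by (auto simp: outer_def S_col_def axis_def power2_eq_square)
  then show ?thesis
    by (simp add: SSt_def cnt_def sum_divide_distrib del: sum_of_bool_eq)
qed

text \<open>Valid for every outcome, also those of probability zero: where \<open>samp_p\<close>
  vanishes, division by zero makes the entries 0 on both sides.\<close>

lemma Y_mat_eq:
  fixes T :: "nat \<times> nat \<Rightarrow> 'd"
  defines "E \<equiv> SSt \<alpha> x m T i ** outer (x i) (x i) ** SSt \<alpha> x m T i"
  shows "Y_mat (cnt m (\<lambda>j. T (j, i))) = (real m / (real m - 1)) *\<^sub>R (E - diag_mat E ** diag_vec (b_vec \<alpha> x m i))"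
proof -
  let ?c = "cnt m (\<lambda>j. T (j, i))"
  have E: "E $ k $ l = ratio k * ?c k * ratio l * ?c l / (real m)\<^sup>2" for k l
  proof -
    let ?s = "\<lambda>k. ?c k / (real m * samp_p \<alpha> x k i)"
    have left: "(SSt \<alpha> x m T i ** outer (x i) (x i)) $ k $ b = ?s k * (x i $ k * x i $ b)" for b
    proof -
      have "(SSt \<alpha> x m T i ** outer (x i) (x i)) $ k $ b
          = (\<Sum>a\<in>UNIV. SSt \<alpha> x m T i $ k $ a * (x i $ a * x i $ b))"
        by (simp add: matrix_matrix_mult_def outer_def)
      also have "\<dots> = (\<Sum>a\<in>UNIV. if a = k then ?s k * (x i $ k * x i $ b) else 0)"
        by (intro sum.cong refl) (simp add: SSt_nth)
      finally show ?thesis by simp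
    qed
    have "E $ k $ l = (\<Sum>b\<in>UNIV. (SSt \<alpha> x m T i ** outer (x i) (x i)) $ k $ b * SSt \<alpha> x m T i $ b $ l)"
      by (simp add: E_def matrix_matrix_mult_def[of _ "SSt \<alpha> x m T i"])
    also have "\<dots> = (\<Sum>b\<in>UNIV. if b = l then ?s k * (x i $ k * x i $ l) * ?s l else 0)"
      by (intro sum.cong refl) (simp add: left SSt_nth)
    finally show ?thesis by (simp add: ratio_def power2_eq_square mult_ac)
  qed
  have D: "(diag_mat E ** diag_vec (b_vec \<alpha> x m i)) $ k $ l = (if k = l then E $ k $ k * shrink k else 0)" for k l
  proof -
    have "(diag_mat E ** diag_vec (b_vec \<alpha> x m i)) $ k $ l
       = (\<Sum>j\<in>UNIV. diag_mat E $ k $ j * diag_vec (b_vec \<alpha> x m i) $ j $ l)"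
      by (simp add: matrix_matrix_mult_def)
    also have "\<dots> = (\<Sum>j\<in>UNIV. if j = k then (if k = l then E $ k $ k * shrink k else 0) else 0)"
      by (intro sum.cong refl) (simp add: diag_mat_def diag_vec_def b_vec_def shrink_def)
    finally show ?thesis by simp
  qed
  have "real m - 1 > 0" using m by simp
  then have scale: "a * w / (real m * (real m - 1)) = real m / (real m - 1) * (a / (real m)\<^sup>2 * w)" for a w
    using m by (simp add: power2_eq_square)
  have "(E - diag_mat E ** diag_vec (b_vec \<alpha> x m i)) $ k $ l = E $ k $ l * (if k = l then 1 - shrink k else 1)" for k l
    by (simp add: D right_diff_distrib)
  then show ?thesis
    by (simp only: vec_eq_iff Y_mat_def vec_lambda_beta vector_scaleR_component real_scaleR_def E scale) simp
qed

end

section \<open>Assembling the columns\<close>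

lemma C_e_minus_cov:
  assumes n: "n \<ge> 1" and x: "\<And>i. i < n \<Longrightarrow> x i \<noteq> 0" and m: "m \<ge> 2" and \<alpha>: "0 < \<alpha>" "\<alpha> < 1"
  shows "C_e \<alpha> x n m T - cov x n =
    (\<Sum>i<n. column_sampling.Z_mat (\<lambda>k. samp_p \<alpha> x k i) (x i) m (real n) (cnt m (\<lambda>j. T (j, i))))"
proof -
  let ?E = "\<lambda>i. SSt \<alpha> x m T i ** outer (x i) (x i) ** SSt \<alpha> x m T i"
  let ?D = "\<lambda>i. ?E i - diag_mat (?E i) ** diag_vec (b_vec \<alpha> x m i)"
  have "C_e \<alpha> x n m T - cov x n = (\<Sum>i<n. (real m / (real n * real m - real n)) *\<^sub>R ?D i - (1 / real n) *\<^sub>R outer (x i) (x i))"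
    by (simp add: C_e_def C1_hat_def C2_hat_def cov_def scaleR_diff_right sum_subtractf scaleR_sum_right)
  also have "\<dots> = (\<Sum>i<n. column_sampling.Z_mat (\<lambda>k. samp_p \<alpha> x k i) (x i) m (real n) (cnt m (\<lambda>j. T (j, i))))"
  proof (intro sum.cong refl)
    fix i assume "i \<in> {..<n}"
    then have xi: "x i \<noteq> 0" using x by simp
    have e: "real m / (real n * real m - real n) = 1 / real n * (real m / (real m - 1))"
      by (simp add: algebra_simps)
    show "(real m / (real n * real m - real n)) *\<^sub>R ?D i - (1 / real n) *\<^sub>R outer (x i) (x i)
       = column_sampling.Z_mat (\<lambda>k. samp_p \<alpha> x k i) (x i) m (real n) (cnt m (\<lambda>j. T (j, i)))"
      unfolding column_sampling.Z_mat_def[OF column_sampling_samp_p[where x = x and i = i, OF xi m \<alpha>]] Y_mat_eq[where x = x and i = i, OF xi m \<alpha>] e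
        scaleR_diff_right scaleR_scaleR ..
  qed
  finally show ?thesis .
qed

text \<open>Regroups the draws, indexed by pairs, into n rows of m draws, so that the columns become
  the independent coordinates of Bernstein's inequality. The restrictions make the rows extensional,
  as \<open>PiE\<close> demands.\<close>

lemma dace_prob_eq_prod_exp:
  assumes E: "\<And>T. T \<in> outcomes n m \<Longrightarrow> E T \<longleftrightarrow> G (\<lambda>i\<in>{..<n}. \<lambda>j\<in>{..<m}. T (j, i))"
  shows "dace_prob \<alpha> x n m E = prod_exp n (PiE {..<m} (\<lambda>_. UNIV)) (\<lambda>i f. \<Prod>j<m. samp_p \<alpha> x (f j) i)
    (\<lambda>F. of_bool (G F))"
proof -
  let ?row = "\<lambda>T. \<lambda>i\<in>{..<n}. \<lambda>j\<in>{..<m}. T (j, i)"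
  have fin: "finite (outcomes n m :: (nat \<times> nat \<Rightarrow> 'a) set)" unfolding outcomes_def by (intro finite_PiE) auto
  have "dace_prob \<alpha> x n m E = (\<Sum>T\<in>outcomes n m. outcome_prob \<alpha> x n m T * of_bool (G (?row T)))"
    unfolding dace_prob_def using fin E by (simp add: sum.inter_filter of_bool_def if_distrib cong: if_cong)
  also have "\<dots> = (\<Sum>F\<in>PiE {..<n} (\<lambda>_. PiE {..<m} (\<lambda>_. UNIV)). (\<Prod>i<n. \<Prod>j<m. samp_p \<alpha> x (F i j) i) * of_bool (G F))"
  proof (rule sum.reindex_bij_witness[where i = "\<lambda>F. \<lambda>(j, i)\<in>{..<m} \<times> {..<n}. F i j" and j = ?row])
    fix T :: "nat \<times> nat \<Rightarrow> 'a" assume T: "T \<in> outcomes n m"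
    show "(\<lambda>(j, i)\<in>{..<m} \<times> {..<n}. ?row T i j) = T"
      using T by (auto simp: outcomes_def fun_eq_iff restrict_def PiE_def extensional_def)
    show "?row T \<in> PiE {..<n} (\<lambda>_. PiE {..<m} (\<lambda>_. UNIV))" by auto
    have "outcome_prob \<alpha> x n m T = (\<Prod>j<m. \<Prod>i<n. samp_p \<alpha> x (T (j, i)) i)"
      unfolding outcome_prob_def by (simp add: prod.cartesian_product)
    also have "\<dots> = (\<Prod>i<n. \<Prod>j<m. samp_p \<alpha> x (?row T i j) i)" by (subst prod.swap) simp
    finally show "(\<Prod>i<n. \<Prod>j<m. samp_p \<alpha> x (?row T i j) i) * of_bool (G (?row T)) = outcome_prob \<alpha> x n m T * of_bool (G (?row T))"
      by simp
  next
    fix F :: "nat \<Rightarrow> nat \<Rightarrow> 'a" assume F: "F \<in> PiE {..<n} (\<lambda>_. PiE {..<m} (\<lambda>_. UNIV))"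
    show "?row (\<lambda>(j, i)\<in>{..<m} \<times> {..<n}. F i j) = F"
      using F by (auto simp: fun_eq_iff restrict_def PiE_def extensional_def Pi_def)
    show "(\<lambda>(j, i)\<in>{..<m} \<times> {..<n}. F i j) \<in> outcomes n m" by (auto simp: outcomes_def)
  qed
  finally show ?thesis by (simp add: prod_exp_def)
qed

text \<open>Bernstein's inequality is applied with 86/100 of R. As K is at least 7/4, the remaining 14/100
  contribute at least \<open>14/100 * 2/3 * 7/4 > 155/1000\<close> times R, which covers the bias.\<close>

lemma truncation_budget:
  fixes q N L D0 \<nu> :: real
  assumes q: "q \<ge> 0" and N: "N \<ge> 0" and L: "L \<ge> 7/4" and \<nu>: "\<nu> \<ge> 1" and D0: "0 \<le> D0" "D0 \<le> 1 / (12 * \<nu>)"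
  defines "cap \<equiv> 9/4 * q + 25/3 * L * N" and "\<rho> \<equiv> 7 * q / \<nu> + L\<^sup>2 * (14 * N / \<nu>)"
  shows "D0 * (2 * cap + 50 * N + q) \<le> 155/1000 * \<rho>"
    and "(2 * cap + q) / \<nu> + D0 * (2 * cap + 50 * N + q) / \<nu> \<le> 86/100 * \<rho>"
proof -
  define P where "P = L\<^sup>2 * N"
  \<comment> \<open>L >= 7/4 converts lower powers of L into L^2, so that every term is measured
    against q and P alone.\<close>
  have LN: "L * N \<le> 4/7 * P"
  proof -
    have "7/4 * (L * N) \<le> L * (L * N)" using L N by (intro mult_right_mono) auto
    then show ?thesis by (simp add: P_def power2_eq_square)
  qed
  have N': "7/4 * N \<le> L * N" using L N by (intro mult_right_mono) auto
  have P: "P \<ge> 0" using N by (simp add: P_def)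
  have \<rho>: "\<rho> = (7 * q + 14 * P) / \<nu>" by (simp add: \<rho>_def P_def add_divide_distrib)
  define U where "U = 2 * cap + 50 * N + q"
  \<comment> \<open>Here 953/100 rounds up (50/3) (4/7), and 186/100 = 12 * 155/1000 matches the
    factor 1 / (12 \<nu>) in the bound on D0.\<close>
  have U: "0 \<le> U" "U \<le> 186/100 * (7 * q + 14 * P)" and r: "2 * cap + q \<le> 55/10 * q + 953/100 * P"
    using q N L LN N' P mult_nonneg_nonneg[of L N] unfolding U_def cap_def by auto
  have "D0 * U \<le> 1 / (12 * \<nu>) * U" using D0 U by (intro mult_right_mono) auto
  then have D: "D0 * U \<le> (U / 12) / \<nu>" by simp
  also have "\<dots> \<le> (155/1000 * (7 * q + 14 * P)) / \<nu>" using U \<nu> by (intro divide_right_mono) auto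
  finally show "D0 * (2 * cap + 50 * N + q) \<le> 155/1000 * \<rho>" by (simp add: U_def \<rho>)
  have "(U / 12) / \<nu> \<le> U / 12" using U \<nu> by (simp add: field_simps mult_le_cancel_left1)
  then have DU: "D0 * U \<le> U / 12" using D by linarith
  \<comment> \<open>Coefficient of q: 5.5 + 0.46 against 0.86 * 7 = 6.02. Coefficient of P: 9.53 +
    2.16 against 0.86 * 14 = 12.04.\<close>
  have "2 * cap + q + D0 * U \<le> 86/100 * (7 * q + 14 * P)"
  proof -
    have "N \<le> 16/49 * P" using N' LN by simp
    then have "U \<le> 65/10 * q - q + 953/100 * P + 800/49 * P" using r by (simp add: U_def)
    then have "D0 * U \<le> 46/100 * q + 216/100 * P" using DU q P by simp
    then show ?thesis using r q P by simp
  qed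
  then have "(2 * cap + q + D0 * U) / \<nu> \<le> 86/100 * (7 * q + 14 * P) / \<nu>"
    using \<nu> by (intro divide_right_mono) auto
  then show "(2 * cap + q) / \<nu> + D0 * (2 * cap + 50 * N + q) / \<nu> \<le> 86/100 * \<rho>"
    by (simp add: U_def \<rho> add_divide_distrib)
qed

theorem theorem2:
  fixes x :: "nat \<Rightarrow> real^'d" and n m :: nat and \<alpha> \<eta> \<delta> :: real
  assumes "n \<ge> 1"
    and "\<And>i. i < n \<Longrightarrow> x i \<noteq> 0"
    and "2 \<le> m" and "m < CARD('d)"
    and "0 < \<alpha>" and "\<alpha> < 1"
    and "0 < \<eta>" and "\<eta> < 1" and "0 < \<delta>" and "\<delta> < 1"
  shows "dace_prob \<alpha> x n m
           (\<lambda>T. spec_norm (C_e \<alpha> x n m T - cov x n)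
              \<le> ln (2 * real CARD('d) / \<delta>) * (2 * R_bound \<alpha> x n m \<eta> / 3)
                 + sqrt (2 * sigma2 \<alpha> x n m * ln (2 * real CARD('d) / \<delta>)))
         \<ge> 1 - \<eta> - \<delta>"
proof -
  note x = assms(2) and m = assms(3) and \<alpha> = assms(5,6)
  define d where "d = real CARD('d)"
  have d: "d \<ge> 3" using assms(3,4) by (simp add: d_def)
  have n: "real n \<ge> 1" using assms(1) by simp
  define L where "L = ln (2 * real n * d / \<eta>)"
  define K where "K = ln (2 * d / \<delta>)"
  define R where "R = R_bound \<alpha> x n m \<eta>"
  define s where "s = sigma2 \<alpha> x n m"
  \<comment> \<open>2 <= m < d forces d >= 3, so both logarithms are at least ln 6; this is the
    source of the 7/4 in the constant budget.\<close>
  have six: "6 \<le> 2 * d / \<delta>" "6 \<le> 2 * real n * d / \<eta>"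
  proof -
    have "6 * \<delta> \<le> 6 * 1" using assms by simp
    then show "6 \<le> 2 * d / \<delta>" using d assms by (simp add: field_simps)
    have "6 * \<eta> \<le> 6 * 1" using assms by simp
    also have "\<dots> \<le> 2 * (real n * d)" using mult_mono[OF n d] by (simp add: mult.commute)
    finally show "6 \<le> 2 * real n * d / \<eta>" using assms by (simp add: pos_le_divide_eq mult.assoc)
  qed
  have L: "L \<ge> 7/4" and K: "K \<ge> 7/4"
    using ln_6_ge ln_mono[OF six(1)] ln_mono[OF six(2)] by (auto simp: L_def K_def)
  have expK: "2 * d * exp (- K) = \<delta>"
    using d assms by (simp add: K_def exp_minus)
  \<comment> \<open>A bound for the chance that one column is bad. Since exp (-2 L) squares the
    ratio in the logarithm, it equals \<eta>^2 / (4 n^2 d): small enough for a union over n columns,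
    with a further factor 1/n to spare for the bias.\<close>
  define D0 where "D0 = d * exp (- 2 * L)"
  have D0_eq: "D0 = d * (\<eta> / (2 * real n * d))\<^sup>2"
  proof -
    have "exp (- 2 * L) = exp (- L) * exp (- L)" by (simp add: exp_add[symmetric])
    also have "\<dots> = (inverse (exp L))\<^sup>2" by (simp only: exp_minus power2_eq_square)
    also have "exp L = 2 * real n * d / \<eta>" using d n assms by (simp add: L_def)
    finally show ?thesis by (simp add: D0_def)
  qed
  have D0: "D0 \<ge> 0" "D0 \<le> 1 / (12 * real n)" "real n * D0 \<le> \<eta>"
  proof -
    show "D0 \<ge> 0" using d by (simp add: D0_def)
    have e: "D0 = \<eta>\<^sup>2 / (4 * (real n)\<^sup>2 * d)"
      using d n by (simp add: D0_eq power2_eq_square divide_simps)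
    have \<eta>2: "\<eta>\<^sup>2 \<le> \<eta>" "\<eta>\<^sup>2 \<le> 1" using assms by (auto simp: power2_eq_square mult_le_one)
    have nd: "12 * real n \<le> 4 * (real n)\<^sup>2 * d"
    proof -
      have "real n * 3 \<le> (real n * real n) * d" using n d by (intro mult_mono) auto
      then show ?thesis by (simp add: power2_eq_square mult_ac)
    qed
    show "D0 \<le> 1 / (12 * real n)"
      unfolding e by (rule frac_le[OF zero_le_one \<eta>2(2) _ nd]) (use n in simp)
    have "real n * D0 = \<eta>\<^sup>2 / (4 * real n * d)" using n by (simp add: e power2_eq_square)
    also have "\<dots> \<le> \<eta> / 1"
    proof (rule frac_le[OF _ \<eta>2(1) zero_less_one])
      have "1 * 3 \<le> real n * d" using n d by (intro mult_mono) auto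
      then show "1 \<le> 4 * real n * d" by simp
    qed (use assms in simp)
    finally show "real n * D0 \<le> \<eta>" by simp
  qed
  let ?\<Omega> = "PiE {..<m} (\<lambda>_. UNIV :: 'd set)"
  let ?w = "\<lambda>i f. \<Prod>j<m. samp_p \<alpha> x (f j) i"
  let ?Z = "\<lambda>i f. column_sampling.Z_mat (\<lambda>k. samp_p \<alpha> x k i) (x i) m (real n) (cnt m f)"
  let ?g = "\<lambda>i f. column_sampling.good (\<lambda>k. samp_p \<alpha> x k i) m L (cnt m f)"
  let ?h = "\<lambda>i f. (2 * column_sampling.y_sq (\<lambda>k. samp_p \<alpha> x k i) (x i) m (cnt m f) + (norm (x i))\<^sup>2) / real n"
  define N where "N = (\<lambda>i. (norm1 (x i) / \<alpha>)\<^sup>2 / real m)"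
  define cap where "cap = (\<lambda>i. 9/4 * (norm (x i))\<^sup>2 + 25/3 * L * N i)"
  define r where "r = (\<lambda>i. (2 * cap i + (norm (x i))\<^sup>2) / real n)"
  define \<beta> where "\<beta> = (\<lambda>i. D0 * (2 * cap i + 50 * N i + (norm (x i))\<^sup>2) / real n)"
  let ?X = "\<lambda>i. truncated_matrix.X ?\<Omega> (?w i) (?Z i) (?g i)"
  let ?B = "\<lambda>i. truncated_matrix.B ?\<Omega> (?w i) (?Z i) (?g i)"
  have cs: "column_sampling (\<lambda>k. samp_p \<alpha> x k i) (x i) m" if "i < n" for i
    by (rule column_sampling_samp_p[where x = x and i = i, OF x[OF that] m \<alpha>])
  have tm: "truncated_matrix ?\<Omega> (?w i) (?Z i) (?g i) (?h i) (r i) (\<beta> i)" if i: "i < n" for i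
    using column_sampling.Z_mat_truncated[OF cs[OF i], of "real n" L "norm1 (x i) / \<alpha>"]
      abs_ratio_le[where x = x and i = i, OF x[OF i] m \<alpha>] sum_ratio_sq_p_le'[where x = x and i = i, OF x[OF i] m \<alpha>] n L
    by (simp add: column_sampling.y_cap_def[OF cs[OF i]] r_def \<beta>_def cap_def N_def D0_def d_def mult_ac)
  have R_le: "7 * (norm (x i))\<^sup>2 / real n + L\<^sup>2 * (14 * N i / real n) \<le> R" if i: "i < n" for i
  proof -
    have "7 * (norm (x i))\<^sup>2 / real n + L\<^sup>2 * (14 * N i / real n)
      = 7 * (norm (x i))\<^sup>2 / real n + (ln (2 * real n * real CARD('d) / \<eta>))\<^sup>2 * (14 * (norm1 (x i))\<^sup>2 / (real n * real m * \<alpha>\<^sup>2))"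
      by (simp add: L_def N_def d_def power_divide mult_ac)
    also have "\<dots> \<le> R" unfolding R_def R_bound_def using i by (intro Max_ge) auto
    finally show ?thesis .
  qed
  have N0: "N i \<ge> 0" for i by (simp add: N_def)
  have bias: "real n * \<beta> i \<le> 155/1000 * R" and size: "r i + \<beta> i \<le> 86/100 * R" if i: "i < n" for i
  proof -
    note b = truncation_budget[OF zero_le_power2[of "norm (x i)"] N0[of i] L n D0(1,2)]
    have "real n * \<beta> i = D0 * (2 * cap i + 50 * N i + (norm (x i))\<^sup>2)" using n by (simp add: \<beta>_def)
    then show "real n * \<beta> i \<le> 155/1000 * R" using b(1) R_le[OF i] by (simp add: cap_def)
    show "r i + \<beta> i \<le> 86/100 * R" using b(2) R_le[OF i] by (simp add: r_def \<beta>_def cap_def)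
  qed
  have R: "R > 0"
  proof -
    have "0 < 7 * (norm (x 0))\<^sup>2 / real n + L\<^sup>2 * (14 * N 0 / real n)"
      using x[of 0] n N0 by (intro add_pos_nonneg divide_pos_pos mult_nonneg_nonneg divide_nonneg_nonneg) auto
    then show ?thesis using R_le[of 0] n by simp
  qed
  have bias_sum: "(\<Sum>i<n. \<beta> i) \<le> 155/1000 * R"
  proof -
    have "real n * (\<Sum>i<n. \<beta> i) \<le> (\<Sum>i<n. 155/1000 * R)"
      unfolding sum_distrib_left using bias by (intro sum_mono) auto
    then show ?thesis using n by (simp add: mult_le_cancel_left_pos)
  qed
  define S where "S = (\<lambda>i. 8 * (norm (x i))^4 / ((real n)^2 * (real m)^2 * (1 - \<alpha>)^2)
          + 4 * (norm1 (x i))^2 * (norm (x i))^2 / ((real n)^2 * (real m)^3 * \<alpha>^2 * (1 - \<alpha>))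
          + 9 * (norm (x i))^4 / ((real n)^2 * real m * (1 - \<alpha>))
          + 2 * (norm (x i))^2 * (norm1 (x i))^2 / ((real n)^2 * (real m)^2 * \<alpha> * (1 - \<alpha>)))"
  define W where "W = (\<lambda>i. ((norm1 (x i))\<^sup>2 / ((real n)\<^sup>2 * real m * \<alpha>)) *\<^sub>R outer (x i) (x i))"
  have s_eq: "s = (\<Sum>i<n. S i) + spec_norm (\<Sum>i<n. W i)" by (simp add: s_def sigma2_def S_def W_def)
  \<comment> \<open>The isotropic part S is summed as scalars, while the rank-one parts W stay
    matrices, so that only their sum enters the spectral norm in \<open>sigma2\<close>.\<close>
  define V where "V = (\<lambda>i. S i *\<^sub>R mat 1 + W i)"
  have m0: "real m > 0" using m by simp
  have ind: "independent_matrices ?\<Omega> ?w ?X V n (86/100 * R)"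
  proof
    fix i assume i: "i < n"
    interpret column_sampling "\<lambda>k. samp_p \<alpha> x k i" "x i" m by (rule cs[OF i])
    interpret t: truncated_matrix ?\<Omega> "?w i" "?Z i" "?g i" "?h i" "r i" "\<beta> i" by (rule tm[OF i])
    show "(\<Sum>f\<in>?\<Omega>. ?w i f) = 1" by (rule t.w_sum)
    show "(\<Sum>f\<in>?\<Omega>. ?w i f *\<^sub>R ?X i f) = 0" by (rule t.X_mean)
    show "sym_mat (V i)" unfolding V_def W_def
      by (intro sym_mat_add sym_mat_scaleR sym_mat_outer) (simp add: sym_mat_def)
    {
      fix f assume f: "f \<in> ?\<Omega>"
      show "0 \<le> ?w i f" using f by (rule t.w_nonneg)
      show "sym_mat (?X i f)" using f by (rule t.X_sym)
      fix v
      have "norm (?X i f *v v) \<le> (r i + \<beta> i) * norm v" using f by (rule t.X_bound)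
      also have "\<dots> \<le> 86/100 * R * norm v" using size[OF i] by (intro mult_right_mono) auto
      finally show "norm (?X i f *v v) \<le> 86/100 * R * norm v" .
    }
    fix v
    let ?\<kappa> = "(norm (x i))\<^sup>2 / (1 - \<alpha>)" and ?N1 = "(norm1 (x i))\<^sup>2 / \<alpha>"
    have "(\<Sum>f\<in>?\<Omega>. ?w i f * (norm (?X i f *v v))\<^sup>2) \<le> (\<Sum>f\<in>?\<Omega>. ?w i f * (norm (?Z i f *v v))\<^sup>2)"
      by (rule t.X_var)
    also have "\<dots> = mult_exp (\<lambda>k. samp_p \<alpha> x k i) m (\<lambda>c. (norm (Z_mat (real n) c *v v))\<^sup>2)"
      by (simp add: mult_exp_eq_sum)
    also have "\<dots> \<le> (1 / (real n)\<^sup>2) * (?N1 / real m * (x i \<bullet> v)\<^sup>2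
       + (8 * ?\<kappa>\<^sup>2 / (real m)\<^sup>2 + 2 * ?N1 * ?\<kappa> / (real m)\<^sup>2 + 9 * ?\<kappa> * (norm (x i))\<^sup>2 / real m) * (norm v)\<^sup>2)"
      by (intro Z_mat_var ratio_sq_p_le[where x = x and i = i, OF x[OF i] m \<alpha>] sum_ratio_sq_p_le[where x = x and i = i, OF x[OF i] m \<alpha>])
    also have "\<dots> = (norm1 (x i))\<^sup>2 / ((real n)\<^sup>2 * real m * \<alpha>) * (x i \<bullet> v)\<^sup>2
       + (S i - 4 * (norm1 (x i))^2 * (norm (x i))^2 / ((real n)^2 * (real m)^3 * \<alpha>^2 * (1 - \<alpha>))) * (norm v)\<^sup>2"
    proof -
      have factor: "c * (a * y + b * z) = (c * a) * y + (c * b) * z" for c a y b z :: real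
        by (simp add: distrib_left)
      have N1: "(1 / (real n)\<^sup>2) * (?N1 / real m) = (norm1 (x i))\<^sup>2 / ((real n)\<^sup>2 * real m * \<alpha>)"
        by (simp add: mult_ac)
      have S: "(1 / (real n)\<^sup>2) * (8 * ?\<kappa>\<^sup>2 / (real m)\<^sup>2 + 2 * ?N1 * ?\<kappa> / (real m)\<^sup>2 + 9 * ?\<kappa> * (norm (x i))\<^sup>2 / real m)
        = S i - 4 * (norm1 (x i))^2 * (norm (x i))^2 / ((real n)^2 * (real m)^3 * \<alpha>^2 * (1 - \<alpha>))"
        by (simp add: S_def distrib_left power_divide mult_ac)
      show ?thesis unfolding factor N1 S ..
    qed
    also have "\<dots> \<le> (norm1 (x i))\<^sup>2 / ((real n)\<^sup>2 * real m * \<alpha>) * (x i \<bullet> v)\<^sup>2 + S i * (norm v)\<^sup>2"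
      using \<alpha> by (intro add_left_mono mult_right_mono) auto
    also have "\<dots> = v \<bullet> (V i *v v)"
      by (simp add: V_def W_def matrix_vector_mult_add_rdistrib matrix_vector_mult_scaleR_left outer_mult
          inner_add_right dot_square_norm power2_eq_square[of "x i \<bullet> v"] inner_commute[of v] mult_ac)
    finally show "(\<Sum>f\<in>?\<Omega>. ?w i f * (norm (?X i f *v v))\<^sup>2) \<le> v \<bullet> (V i *v v)" .
  qed (use R in \<open>auto intro: finite_PiE\<close>)
  have S0: "S i > 0" if "i < n" for i
    unfolding S_def using x[OF that] n m0 \<alpha>
    by (intro add_pos_nonneg divide_pos_pos divide_nonneg_nonneg mult_nonneg_nonneg mult_pos_pos) auto
  have s0: "s > 0"
    unfolding s_eq using S0 assms(1)
    by (intro add_pos_nonneg sum_pos spec_norm_nonneg) (auto simp: lessThan_empty_iff)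
  have V_le: "v \<bullet> ((\<Sum>i<n. V i) *v v) \<le> s * (norm v)\<^sup>2" for v
  proof -
    have "(\<Sum>i<n. V i) *v v = (\<Sum>i<n. S i) *\<^sub>R v + (\<Sum>i<n. W i) *v v"
      by (simp add: V_def sum.distrib matrix_vector_mult_add_rdistrib scaleR_sum_left[symmetric]
          matrix_vector_mult_scaleR_left)
    then have "v \<bullet> ((\<Sum>i<n. V i) *v v) = (\<Sum>i<n. S i) * (norm v)\<^sup>2 + v \<bullet> ((\<Sum>i<n. W i) *v v)"
      by (simp add: inner_add_right power2_norm_eq_inner)
    also have "\<dots> \<le> (\<Sum>i<n. S i) * (norm v)\<^sup>2 + spec_norm (\<Sum>i<n. W i) * (norm v)\<^sup>2"
      using inner_le_spec_norm[of v "\<Sum>i<n. W i"] by simp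
    finally show ?thesis by (simp add: s_eq distrib_right)
  qed
  define t where "t = 2 * (86/100 * R) * K / 3 + sqrt (2 * s * K)"
  define \<tau> where "\<tau> = K * (2 * R / 3) + sqrt (2 * s * K)"
  have t\<tau>: "t + (\<Sum>i<n. \<beta> i) \<le> \<tau>"
  proof -
    have "7/4 * R \<le> K * R" using K R by (intro mult_right_mono) auto
    moreover have "2 * (86/100 * R) * K / 3 = 43/75 * (K * R)" "K * (2 * R / 3) = 2/3 * (K * R)" by simp_all
    ultimately show ?thesis unfolding t_def \<tau>_def using bias_sum R by linarith
  qed
  have tail: "prod_exp n ?\<Omega> ?w (\<lambda>F. of_bool (spec_norm (\<Sum>i<n. ?X i (F i)) > t)) \<le> \<delta>"
    using matrix_bernstein[OF ind s0 V_le, of K] K expK by (simp add: t_def d_def)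
  let ?G = "\<lambda>F. spec_norm (\<Sum>i<n. ?Z i (F i)) \<le> \<tau>"
  have "1 = prod_exp n ?\<Omega> ?w (\<lambda>_. 1)"
    by (rule prod_exp_const[symmetric]) (auto intro: finite_PiE independent_matrices.w_sum[OF ind])
  \<comment> \<open>The union bound as a pointwise inequality of indicators: the claim holds, or
    some column is bad, or the Bernstein sum is large.\<close>
  also have "\<dots> \<le> prod_exp n ?\<Omega> ?w (\<lambda>F. of_bool (?G F) + ((\<Sum>i<n. of_bool (\<not> ?g i (F i)))
      + of_bool (spec_norm (\<Sum>i<n. ?X i (F i)) > t)))"
  proof (rule prod_exp_mono[OF independent_matrices.w_nonneg[OF ind]])
    fix F assume F: "F \<in> PiE {..<n} (\<lambda>_. ?\<Omega>)"
    have nn: "0 \<le> (\<Sum>i<n. of_bool (\<not> ?g i (F i)) :: real)" by (intro sum_nonneg) auto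
    consider (bad) j where "j < n" "\<not> ?g j (F j)" | (big) "spec_norm (\<Sum>i<n. ?X i (F i)) > t"
      | (ok) "\<And>i. i < n \<Longrightarrow> ?g i (F i)" "spec_norm (\<Sum>i<n. ?X i (F i)) \<le> t" by force
    then show "1 \<le> of_bool (?G F) + ((\<Sum>i<n. of_bool (\<not> ?g i (F i)))
      + of_bool (spec_norm (\<Sum>i<n. ?X i (F i)) > t) :: real)"
    proof cases
      case bad
      have "of_bool (\<not> ?g j (F j)) \<le> (\<Sum>i<n. of_bool (\<not> ?g i (F i)) :: real)"
        using bad by (intro member_le_sum) auto
      then have "1 \<le> (\<Sum>i<n. of_bool (\<not> ?g i (F i)) :: real)" using bad by simp
      then show ?thesis by (simp add: add_increasing)
    next
      case big
      then show ?thesis using nn by simp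
    next
      case ok
      \<comment> \<open>On a good column truncation changes nothing, so the estimation error is the
        Bernstein sum plus the deterministic biases.\<close>
      have "?Z i (F i) = ?X i (F i) + ?B i" if "i < n" for i
        using ok(1)[OF that] by (simp add: truncated_matrix.X_def[OF tm[OF that]])
      then have sum_Z: "(\<Sum>i<n. ?Z i (F i)) = (\<Sum>i<n. ?X i (F i)) + (\<Sum>i<n. ?B i)"
        by (simp add: sum.distrib[symmetric])
      have "spec_norm (\<Sum>i<n. ?Z i (F i)) \<le> spec_norm (\<Sum>i<n. ?X i (F i)) + (\<Sum>i<n. spec_norm (?B i))"
        unfolding sum_Z by (rule order_trans[OF spec_norm_triangle add_left_mono[OF spec_norm_sum]])
      also have "\<dots> \<le> t + (\<Sum>i<n. \<beta> i)"
        by (intro add_mono ok sum_mono spec_norm_le truncated_matrix.B_sym[OF tm] truncated_matrix.B_quad[OF tm]) auto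
      finally have "?G F" using t\<tau> by linarith
      then show ?thesis using nn by simp
    qed
  qed
  also have "\<dots> \<le> prod_exp n ?\<Omega> ?w (\<lambda>F. of_bool (?G F)) + (\<eta> + \<delta>)"
  proof -
    have "prod_exp n ?\<Omega> ?w (\<lambda>F. of_bool (\<not> ?g i (F i))) \<le> D0" if i: "i < n" for i
    proof -
      have "prod_exp n ?\<Omega> ?w (\<lambda>F. of_bool (\<not> ?g i (F i))) = (\<Sum>f\<in>?\<Omega>. ?w i f * of_bool (\<not> ?g i f))"
        by (rule prod_exp_marginal[OF _ _ i]) (auto intro: finite_PiE independent_matrices.w_sum[OF ind])
      also have "\<dots> \<le> D0"
        using column_sampling.prob_bad_le[OF cs[OF i], of L] by (simp add: mult_exp_eq_sum D0_def d_def)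
      finally show ?thesis .
    qed
    then have "(\<Sum>i<n. prod_exp n ?\<Omega> ?w (\<lambda>F. of_bool (\<not> ?g i (F i)))) \<le> (\<Sum>i<n. D0)"
      by (intro sum_mono) auto
    then have "(\<Sum>i<n. prod_exp n ?\<Omega> ?w (\<lambda>F. of_bool (\<not> ?g i (F i)))) \<le> \<eta>" using D0(3) by simp
    then show ?thesis unfolding prod_exp_add prod_exp_sum using tail by linarith
  qed
  also have "prod_exp n ?\<Omega> ?w (\<lambda>F. of_bool (?G F)) = dace_prob \<alpha> x n m
     (\<lambda>T. spec_norm (C_e \<alpha> x n m T - cov x n) \<le> \<tau>)"
  proof (rule dace_prob_eq_prod_exp[symmetric])
    fix T :: "nat \<times> nat \<Rightarrow> 'd"
    \<comment> \<open>Counts look only at draws j < m, so restricting a row to its domain leaves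
      them unchanged.\<close>
    have "cnt m (\<lambda>j. T (j, i)) = cnt m ((\<lambda>i\<in>{..<n}. \<lambda>j\<in>{..<m}. T (j, i)) i)" if "i < n" for i
      using that by (simp add: cnt_def fun_eq_iff)
    then have "(\<Sum>i<n. ?Z i (\<lambda>j. T (j, i))) = (\<Sum>i<n. ?Z i ((\<lambda>i\<in>{..<n}. \<lambda>j\<in>{..<m}. T (j, i)) i))"
      by (intro sum.cong refl) (simp only: lessThan_iff)
    then show "spec_norm (C_e \<alpha> x n m T - cov x n) \<le> \<tau> \<longleftrightarrow> ?G (\<lambda>i\<in>{..<n}. \<lambda>j\<in>{..<m}. T (j, i))"
      by (simp only: C_e_minus_cov[OF assms(1) x m \<alpha>])
  qed
  finally have "1 - \<eta> - \<delta> \<le> dace_prob \<alpha> x n m (\<lambda>T. spec_norm (C_e \<alpha> x n m T - cov x n) \<le> \<tau>)" by linarith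
  then show ?thesis by (simp only: \<tau>_def K_def d_def R_def s_def)
qed

end
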